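(* Let $\pi=(d_1,\dots,d_n)$ be a non-split graphic sequence (with $d_1\ge\cdots\ge d_n$). All realizations of $\pi$ are indecomposable and in $HCU$ if and only if $d_n\ge 1$, $d_1\le n-2$, and at least one of the following holds: (1) $d_2=1$; (2) $d_{n-1}=n-2$; (3) $d_1=n-2$ and $d_2=2$; (4) $d_n=1$ and $d_{n-1}=n-3$; (5) $\pi=(2,2,2,2,2)$.
   Context: All graphs are finite and simple. The degree sequence of a graph is the list of its vertex degrees in non-increasing order. A sequence is graphic if it is the degree sequence of a graph; such a graph is a realization of it. A \emph{unigraph} is a graph that is isomorphic to every graph with the same degree sequence. $HCU$ is the class of all graphs that are induced subgraphs of some unigraph. A \emph{split graph} is a graph whose vertex set can be partitioned as $K\cup S$ with $K$ a clique and $S$ a stable set ($K$ or $S$ may be empty); such a partition is a $KS$-partition. Whether a graph is split is determined by its degree sequence; a degree sequence is called non-split if its realizations are not split graphs. For a split graph $G$ with fixed $KS$-partition $K\cup S$ and any graph $H$, the composition $G\circ H$ is the graph obtained from the disjoint union of $G$ and $H$ by joining every vertex of $K$ to every vertex of $H$. A graph is \emph{decomposable} if it equals $G_1\circ G_0$ for some nonempty graphs $G_1,G_0$ with $G_1$ split (with some $KS$-partition); otherwise it is \emph{indecomposable}. *)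

theory Defs
  imports "HOL-Library.Multiset"
begin

datatype 'a ugraph = Ugraph (verts: "'a set") (edges: "'a set set")

definition simple_graph :: "'a ugraph \<Rightarrow> bool" where
  "simple_graph G \<longleftrightarrow> finite (verts G) \<and> (\<forall>e \<in> edges G. e \<subseteq> verts G \<and> card e = 2)"

definition adjacent :: "'a ugraph \<Rightarrow> 'a \<Rightarrow> 'a \<Rightarrow> bool" where
  "adjacent G x y \<longleftrightarrow> {x, y} \<in> edges G"

definition degree :: "'a ugraph \<Rightarrow> 'a \<Rightarrow> nat" where
  "degree G v = card {u \<in> verts G. adjacent G v u}"

definition isomorphic :: "'a ugraph \<Rightarrow> 'b ugraph \<Rightarrow> bool" where
  "isomorphic G H \<longleftrightarrow> (\<exists>f. bij_betw f (verts G) (verts H) \<and>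
     (\<forall>x \<in> verts G. \<forall>y \<in> verts G. adjacent G x y \<longleftrightarrow> adjacent H (f x) (f y)))"

definition induced :: "'a ugraph \<Rightarrow> 'a set \<Rightarrow> 'a ugraph" where
  "induced G W = Ugraph W {e \<in> edges G. e \<subseteq> W}"

text \<open>The vertex degrees with multiplicity, in non-increasing order.\<close>

definition degree_seq :: "'a ugraph \<Rightarrow> nat list" where
  "degree_seq G = rev (sorted_list_of_multiset (image_mset (degree G) (mset_set (verts G))))"

definition realizes :: "'a ugraph \<Rightarrow> nat list \<Rightarrow> bool" where
  "realizes G \<pi> \<longleftrightarrow> simple_graph G \<and> degree_seq G = \<pi>"

text \<open>Every finite graph has an isomorphic copy with vertices in \<open>nat\<close>, so graphs that are
  quantified without a given ambient vertex type are taken over \<open>nat\<close>.\<close>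

definition graphic :: "nat list \<Rightarrow> bool" where
  "graphic \<pi> \<longleftrightarrow> (\<exists>G :: nat ugraph. realizes G \<pi>)"

text \<open>In the next definition \<open>H\<close> ranges over the vertex type of \<open>G\<close>. This loses nothing: a graph
  with the degree sequence of \<open>G\<close> has as many vertices as \<open>G\<close> and hence an isomorphic copy on
  \<open>verts G\<close>.\<close>

definition unigraph :: "'a ugraph \<Rightarrow> bool" where
  "unigraph G \<longleftrightarrow> simple_graph G \<and>
     (\<forall>H :: 'a ugraph. simple_graph H \<and> degree_seq H = degree_seq G \<longrightarrow> isomorphic G H)"

definition HCU :: "'a ugraph set" where
  "HCU = {G. simple_graph G \<and>
     (\<exists>U :: nat ugraph. unigraph U \<and> (\<exists>W \<subseteq> verts U. isomorphic G (induced U W)))}"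

definition clique :: "'a ugraph \<Rightarrow> 'a set \<Rightarrow> bool" where
  "clique G K \<longleftrightarrow> K \<subseteq> verts G \<and> (\<forall>x \<in> K. \<forall>y \<in> K. x \<noteq> y \<longrightarrow> adjacent G x y)"

definition stable :: "'a ugraph \<Rightarrow> 'a set \<Rightarrow> bool" where
  "stable G S \<longleftrightarrow> S \<subseteq> verts G \<and> (\<forall>x \<in> S. \<forall>y \<in> S. \<not> adjacent G x y)"

definition KS_partition :: "'a ugraph \<Rightarrow> 'a set \<Rightarrow> 'a set \<Rightarrow> bool" where
  "KS_partition G K S \<longleftrightarrow>
     verts G = K \<union> S \<and> K \<inter> S = {} \<and> clique G K \<and> stable G S"

definition split_graph :: "'a ugraph \<Rightarrow> bool" where
  "split_graph G \<longleftrightarrow> simple_graph G \<and> (\<exists>K S. KS_partition G K S)"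

definition nonsplit_seq :: "nat list \<Rightarrow> bool" where
  "nonsplit_seq \<pi> \<longleftrightarrow> (\<forall>G :: nat ugraph. realizes G \<pi> \<longrightarrow> \<not> split_graph G)"

text \<open>The composition of \<open>G\<close>, with \<open>KS\<close>-partition \<open>K \<union> S\<close>, and \<open>H\<close>. It is only meaningful for
  disjoint vertex sets, which \<open>decomposable\<close> requires; \<open>S\<close> is determined by \<open>K\<close>.\<close>

definition compose :: "'a ugraph \<Rightarrow> 'a set \<Rightarrow> 'a ugraph \<Rightarrow> 'a ugraph" where
  "compose G K H = Ugraph (verts G \<union> verts H)
     (edges G \<union> edges H \<union> {{k, h} | k h. k \<in> K \<and> h \<in> verts H})"

definition decomposable :: "'a ugraph \<Rightarrow> bool" where
  "decomposable G \<longleftrightarrow> (\<exists>G1 K S G0.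
     simple_graph G1 \<and> simple_graph G0 \<and> verts G1 \<noteq> {} \<and> verts G0 \<noteq> {} \<and>
     verts G1 \<inter> verts G0 = {} \<and> KS_partition G1 K S \<and> G = compose G1 K G0)"

abbreviation indecomposable :: "'a ugraph \<Rightarrow> bool" where
  "indecomposable G \<equiv> \<not> decomposable G"

end

theory Submission
  imports Defs
begin

text \<open>The theorem rests on a classification of the nonsplit indecomposable unigraphs by their degrees:
  all vertices but one have degree 1, or one vertex misses a single vertex and all others have
  degree 2, or the complement is of one of these two kinds, or the graph is the five-cycle
  (\<open>rigid_classification\<close>). Everything else is a reduction to this classification.

  For the reduction, let \<open>G\<close> be nonsplit, indecomposable and an induced subgraph of a unigraph
  \<open>U\<close>. In any decomposition of \<open>U\<close> the graph \<open>G\<close> lies in the nonsplit factor, the core. The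
  smallest core around \<open>G\<close> is indecomposable, and it inherits the unigraph property, because a
  different realization of its degrees can be spliced into \<open>U\<close> (\<open>exists_indecomposable_core\<close>).
  So the degrees of the core are known, and with them those of \<open>G\<close>
  (\<open>induced_rigid_hcu_degrees\<close>). Conversely, a graph with such degrees is indecomposable, as all
  but one of its vertices (or the vertices of its complement) have very small degree
  (\<open>hcu_degrees_indecomposable\<close>), and up to complementation it is a unigraph or becomes one when
  its pendant vertices are completed to triangles or to a four-cycle (\<open>hcu_degrees_HCU\<close>).

  The classification uses that all realizations of the degrees of a unigraph are isomorphic and
  that a switch, which trades the edges \<open>ab\<close>, \<open>cd\<close> for \<open>ac\<close>, \<open>bd\<close>, leads from one realization to
  another. Hence no switch changes an invariant of the graph. The first invariant is the number
  of edges inside a union of degree classes. In a graph that is not split the theorem of Foeldes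
  and Hammer supplies a degree class \<open>D\<close> that is neither a clique nor stable. Since the number
  of edges inside \<open>D\<close> cannot change, certain alternating four-cycles between \<open>D\<close> and the rest
  never occur in any realization. This forces the vertices outside \<open>D\<close> into the clique, the
  stable set and the core of a decomposition, with at most one vertex in the core besides \<open>D\<close>
  (locale \<open>mixed_class\<close>). By indecomposability, at most one vertex \<open>c\<close> has an exceptional degree
  (\<open>rigid_one_exception\<close>).

  If there is such a \<open>c\<close>, it is fixed by all isomorphisms, so the number of edges inside its
  neighbourhood is an invariant too, and the analysis of mixed classes repeats itself in the
  graph without \<open>c\<close> (locale \<open>exceptional_vertex\<close>). If the graph is regular, the invariant is the
  number of triangles. Up to complementation some realization has two adjacent vertices without
  common neighbours; their other neighbours can be redistributed between them at will, and the
  number of triangles changes unless the degree is 1 or the graph is a five-cycle (locale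
  \<open>sparse_regular\<close>).\<close>

section \<open>Simple graphs, complements and switches\<close>

lemma adjacent_sym: "adjacent G x y \<longleftrightarrow> adjacent G y x"
  by (simp add: adjacent_def insert_commute)

lemma adjacentD:
  assumes "simple_graph G" "adjacent G x y"
  shows "x \<in> verts G" "y \<in> verts G" "x \<noteq> y"
  using assms unfolding simple_graph_def adjacent_def by (force dest!: bspec[of _ _ "{x, y}"])+

lemma adjacent_irrefl: "simple_graph G \<Longrightarrow> \<not> adjacent G x x"
  using adjacentD(3) by fastforce

lemma edgesE:
  assumes "simple_graph G" "e \<in> edges G"
  obtains x y where "e = {x, y}" "x \<noteq> y" "adjacent G x y"
  using assms unfolding simple_graph_def adjacent_def by (metis card_2_iff)

lemma simple_graph_eqI:
  assumes "simple_graph G" "simple_graph H" "verts G = verts H"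
    "\<And>x y. adjacent G x y \<longleftrightarrow> adjacent H x y"
  shows "G = H"
proof -
  have "edges G = edges H"
    using assms by (metis (no_types, lifting) adjacent_def edgesE subsetI subset_antisym)
  with assms(3) show ?thesis by (cases G; cases H) auto
qed

text \<open>An edge is present as soon as \<open>R\<close> holds in one of the two directions, so the graphs built from
  this definition come without a symmetry proof for \<open>R\<close>.\<close>

definition graph_of :: "'a set \<Rightarrow> ('a \<Rightarrow> 'a \<Rightarrow> bool) \<Rightarrow> 'a ugraph" where
  "graph_of V R = Ugraph V {{x, y} | x y. x \<in> V \<and> y \<in> V \<and> x \<noteq> y \<and> R x y}"

lemma verts_graph_of [simp]: "verts (graph_of V R) = V"
  by (simp add: graph_of_def)

lemma adjacent_graph_of:
  "adjacent (graph_of V R) x y \<longleftrightarrow> x \<in> V \<and> y \<in> V \<and> x \<noteq> y \<and> (R x y \<or> R y x)"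
  unfolding adjacent_def graph_of_def by (auto simp: doubleton_eq_iff)

lemma simple_graph_of: "finite V \<Longrightarrow> simple_graph (graph_of V R)"
  unfolding simple_graph_def graph_of_def by auto

lemma finite_verts: "simple_graph G \<Longrightarrow> finite (verts G)"
  by (simp add: simple_graph_def)

definition nbhd :: "'a ugraph \<Rightarrow> 'a \<Rightarrow> 'a set" where
  "nbhd G v = {u \<in> verts G. adjacent G v u}"

lemma degree_nbhd: "degree G v = card (nbhd G v)"
  by (simp add: degree_def nbhd_def)

lemma in_nbhd: "simple_graph G \<Longrightarrow> u \<in> nbhd G v \<longleftrightarrow> adjacent G v u"
  by (auto simp: nbhd_def dest: adjacentD)

lemma finite_nbhd: "simple_graph G \<Longrightarrow> finite (nbhd G v)"
  by (simp add: nbhd_def finite_verts)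

lemma nbhd_subset: "nbhd G v \<subseteq> verts G"
  by (auto simp: nbhd_def)

lemma degree_le_card:
  assumes "finite X" "\<And>u. u \<in> verts G \<Longrightarrow> adjacent G v u \<Longrightarrow> u \<in> X"
  shows "degree G v \<le> card X"
  unfolding degree_def by (rule card_mono) (use assms in auto)

lemma degree_ge_card:
  assumes "simple_graph G" "\<And>u. u \<in> X \<Longrightarrow> adjacent G v u"
  shows "card X \<le> degree G v"
  unfolding degree_nbhd using assms by (intro card_mono) (auto simp: finite_nbhd in_nbhd)

text \<open>The degree of \<open>y\<close> is at least that of \<open>x\<close>, so a neighbour of \<open>x\<close> that \<open>y\<close> lacks is made up for
  by a neighbour of \<open>y\<close> that \<open>x\<close> lacks. The fourth vertex of most switches comes from here.\<close>

lemma exists_exchange: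
  assumes "simple_graph G" "degree G x \<le> degree G y"
    "adjacent G x u" "\<not> adjacent G y u" "u \<noteq> y"
  obtains z where "adjacent G y z" "\<not> adjacent G x z" "z \<noteq> x" "z \<noteq> u"
proof -
  have "\<exists>z. adjacent G y z \<and> \<not> adjacent G x z \<and> z \<noteq> x"
  proof (rule ccontr)
    assume no: "\<not> ?thesis"
    have "nbhd G y - {x} \<subseteq> nbhd G x - {y} - {u}"
    proof
      fix z assume "z \<in> nbhd G y - {x}"
      hence "adjacent G y z" "z \<noteq> x" using assms(1) by (auto simp: in_nbhd)
      moreover from this have "z \<noteq> y" using adjacentD(3)[OF assms(1)] by blast
      ultimately show "z \<in> nbhd G x - {y} - {u}"
        using no assms(1,4) by (auto simp: in_nbhd)
    qed
    hence "card (nbhd G y - {x}) \<le> card (nbhd G x - {y} - {u})"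
      using assms(1) by (simp add: card_mono finite_nbhd)
    moreover have "card (nbhd G x - {y} - {u}) < card (nbhd G x - {y})"
      using assms by (intro card_Diff1_less) (auto simp: finite_nbhd in_nbhd)
    ultimately have lt: "card (nbhd G y - {x}) < card (nbhd G x - {y})" by simp
    show False
    proof (cases "adjacent G x y")
      case True
      hence "x \<in> nbhd G y" "y \<in> nbhd G x" using assms(1) by (auto simp: in_nbhd adjacent_sym)
      thus False using lt assms(1,2) by (simp add: degree_nbhd finite_nbhd)
    next
      case False
      hence "x \<notin> nbhd G y" "y \<notin> nbhd G x" using assms(1) by (auto simp: in_nbhd adjacent_sym)
      thus False using lt assms(1,2) by (simp add: degree_nbhd)
    qed
  qed
  thus ?thesis using that assms(4) by blast
qed

definition co :: "'a ugraph \<Rightarrow> 'a ugraph" where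
  "co G = graph_of (verts G) (\<lambda>x y. \<not> adjacent G x y)"

lemma verts_co [simp]: "verts (co G) = verts G"
  by (simp add: co_def)

lemma adjacent_co:
  "adjacent (co G) x y \<longleftrightarrow> x \<in> verts G \<and> y \<in> verts G \<and> x \<noteq> y \<and> \<not> adjacent G x y"
  by (auto simp: co_def adjacent_graph_of adjacent_sym)

lemma simple_co: "simple_graph G \<Longrightarrow> simple_graph (co G)"
  by (simp add: co_def simple_graph_of finite_verts)

lemma co_co: "simple_graph G \<Longrightarrow> co (co G) = G"
  by (rule simple_graph_eqI) (auto simp: simple_co adjacent_co dest: adjacentD)

lemma degree_co:
  assumes "simple_graph G" "v \<in> verts G"
  shows "degree (co G) v = card (verts G) - 1 - degree G v"
proof -
  have "nbhd (co G) v = verts G - {v} - nbhd G v"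
    using assms by (auto simp: in_nbhd simple_co adjacent_co)
  moreover have "nbhd G v \<subseteq> verts G - {v}"
    using assms by (auto simp: in_nbhd dest: adjacentD)
  ultimately show ?thesis
    using assms by (simp add: degree_nbhd card_Diff_subset finite_nbhd)
qed

lemma degree_lt:
  assumes "simple_graph G" "v \<in> verts G"
  shows "degree G v \<le> card (verts G) - 1"
  using degree_le_card[of "verts G - {v}" G v] assms
  by (auto simp: finite_verts dest: adjacentD)

lemma degree_co_eq_iff:
  assumes "simple_graph G" "v \<in> verts G" "w \<in> verts G"
  shows "degree (co G) v = degree (co G) w \<longleftrightarrow> degree G v = degree G w"
  using degree_co[OF assms(1,2)] degree_co[OF assms(1,3)]
    degree_lt[OF assms(1,2)] degree_lt[OF assms(1,3)] by linarith

text \<open>Two realizations of one degree sequence are compared on the same vertex set with the degree of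
  every single vertex prescribed. Every realization has an isomorphic copy of this form.\<close>

definition same_degrees :: "'a ugraph \<Rightarrow> 'a ugraph \<Rightarrow> bool" where
  "same_degrees G H \<longleftrightarrow> simple_graph H \<and> verts H = verts G \<and>
     (\<forall>v \<in> verts G. degree H v = degree G v)"

lemma same_degrees_refl: "simple_graph G \<Longrightarrow> same_degrees G G"
  by (simp add: same_degrees_def)

lemma same_degrees_trans: "same_degrees G H \<Longrightarrow> same_degrees H L \<Longrightarrow> same_degrees G L"
  by (simp add: same_degrees_def)

lemma same_degrees_co:
  assumes "simple_graph G" "same_degrees (co G) H"
  shows "same_degrees G (co H)"
proof -
  have "degree (co H) v = degree G v" if "v \<in> verts G" for v
  proof -
    have "degree (co H) v = card (verts G) - 1 - degree (co G) v"
      using assms that degree_co[of H v] by (simp add: same_degrees_def)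
    also have "\<dots> = degree (co (co G)) v"
      using degree_co[of "co G" v] assms(1) that by (simp add: simple_co)
    finally show ?thesis by (simp add: co_co assms(1))
  qed
  thus ?thesis using assms by (simp add: same_degrees_def simple_co)
qed

definition switch :: "'a ugraph \<Rightarrow> 'a \<Rightarrow> 'a \<Rightarrow> 'a \<Rightarrow> 'a \<Rightarrow> 'a ugraph" where
  "switch G a b c d = graph_of (verts G) (\<lambda>x y.
     adjacent G x y \<and> {x, y} \<noteq> {a, b} \<and> {x, y} \<noteq> {c, d} \<or> {x, y} = {a, c} \<or> {x, y} = {b, d})"

text \<open>The four-cycle \<open>a b d c\<close> alternates between the edges \<open>ab\<close>, \<open>cd\<close> and the non-edges \<open>bd\<close>, \<open>ac\<close>
  that a switch exchanges.\<close>

definition alternating :: "'a ugraph \<Rightarrow> 'a \<Rightarrow> 'a \<Rightarrow> 'a \<Rightarrow> 'a \<Rightarrow> bool" where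
  "alternating G a b c d \<longleftrightarrow> adjacent G a b \<and> adjacent G c d \<and>
     \<not> adjacent G a c \<and> \<not> adjacent G b d \<and> a \<noteq> c \<and> b \<noteq> d"

lemma alternating_distinct:
  assumes "simple_graph G" "alternating G a b c d"
  shows "distinct [a, b, c, d]" "{a, b, c, d} \<subseteq> verts G"
  using assms adjacentD[OF assms(1)] unfolding alternating_def
  by (auto simp: adjacent_sym)

lemma verts_switch [simp]: "verts (switch G a b c d) = verts G"
  by (simp add: switch_def)

lemma simple_switch: "simple_graph G \<Longrightarrow> simple_graph (switch G a b c d)"
  by (simp add: switch_def simple_graph_of finite_verts)

lemma adjacent_switch:
  assumes "simple_graph G" "alternating G a b c d"
  shows "adjacent (switch G a b c d) x y \<longleftrightarrow>
    adjacent G x y \<and> {x, y} \<noteq> {a, b} \<and> {x, y} \<noteq> {c, d} \<or> {x, y} = {a, c} \<or> {x, y} = {b, d}"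
proof -
  have "{x, y} = {y, x}" by auto
  thus ?thesis
    using alternating_distinct[OF assms] adjacentD[OF assms(1), of x y]
    unfolding switch_def adjacent_graph_of
    by (auto simp: adjacent_sym doubleton_eq_iff)
qed

lemma alternating_switch:
  assumes "simple_graph G" "alternating G a b c d"
  shows "alternating (switch G a b c d) a c b d"
  using alternating_distinct[OF assms] assms(2)
  unfolding alternating_def adjacent_switch[OF assms]
  by (auto simp: doubleton_eq_iff)

lemma switch_switch:
  assumes "simple_graph G" "alternating G a b c d"
  shows "switch (switch G a b c d) a c b d = G"
proof (rule simple_graph_eqI)
  fix x y
  show "adjacent (switch (switch G a b c d) a c b d) x y = adjacent G x y"
    using alternating_distinct[OF assms] assms(2)
    unfolding adjacent_switch[OF simple_switch[OF assms(1)] alternating_switch[OF assms]]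
      adjacent_switch[OF assms] alternating_def
    by (auto simp: doubleton_eq_iff adjacent_sym)
qed (use assms in \<open>auto simp: simple_switch\<close>)

lemma nbhd_switch:
  assumes "simple_graph G" "alternating G a b c d"
  shows "nbhd (switch G a b c d) v =
    (if v = a then insert c (nbhd G a - {b}) else
     if v = b then insert d (nbhd G b - {a}) else
     if v = c then insert a (nbhd G c - {d}) else
     if v = d then insert b (nbhd G d - {c}) else nbhd G v)"
  using alternating_distinct[OF assms]
  by (auto simp: in_nbhd assms(1) simple_switch adjacent_switch[OF assms] doubleton_eq_iff)

lemma same_degrees_switch:
  assumes "simple_graph G" "alternating G a b c d"
  shows "same_degrees G (switch G a b c d)"
proof -
  have "degree (switch G a b c d) v = degree G v" for v
  proof -
    have pos: "card (nbhd G x) > 0" if "adjacent G x y" for x y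
      using that assms(1) by (auto simp: card_gt_0_iff finite_nbhd in_nbhd)
    show ?thesis
      unfolding degree_nbhd nbhd_switch[OF assms]
      using assms(2) alternating_distinct[OF assms] pos[of a b] pos[of b a] pos[of c d] pos[of d c]
      by (auto simp: alternating_def in_nbhd assms(1) finite_nbhd adjacent_sym)
  qed
  thus ?thesis by (simp add: same_degrees_def simple_switch assms(1))
qed

section \<open>Induced subgraphs and isomorphisms\<close>

lemma verts_induced [simp]: "verts (induced G W) = W"
  by (simp add: induced_def)

lemma adjacent_induced: "adjacent (induced G W) x y \<longleftrightarrow> adjacent G x y \<and> x \<in> W \<and> y \<in> W"
  by (auto simp: induced_def adjacent_def)

lemma simple_induced: "simple_graph G \<Longrightarrow> W \<subseteq> verts G \<Longrightarrow> simple_graph (induced G W)"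
  by (auto simp: induced_def simple_graph_def intro: finite_subset)

lemma induced_induced: "W \<subseteq> C \<Longrightarrow> induced (induced G C) W = induced G W"
  by (auto simp: induced_def)

definition graph_iso :: "('a \<Rightarrow> 'b) \<Rightarrow> 'a ugraph \<Rightarrow> 'b ugraph \<Rightarrow> bool" where
  "graph_iso f G H \<longleftrightarrow> bij_betw f (verts G) (verts H) \<and>
     (\<forall>x \<in> verts G. \<forall>y \<in> verts G. adjacent G x y \<longleftrightarrow> adjacent H (f x) (f y))"

lemma isomorphic_iff: "isomorphic G H \<longleftrightarrow> (\<exists>f. graph_iso f G H)"
  by (simp add: isomorphic_def graph_iso_def)

lemma graph_iso_inv:
  assumes "graph_iso f G H"
  shows "graph_iso (inv_into (verts G) f) H G"
proof -
  from assms have bij: "bij_betw f (verts G) (verts H)" by (simp add: graph_iso_def)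
  have "adjacent H x y \<longleftrightarrow> adjacent G (inv_into (verts G) f x) (inv_into (verts G) f y)"
    if "x \<in> verts H" "y \<in> verts H" for x y
  proof -
    have "inv_into (verts G) f x \<in> verts G" "inv_into (verts G) f y \<in> verts G"
      using that bij_betw_apply[OF bij_betw_inv_into[OF bij]] by auto
    thus ?thesis
      using assms that bij_betw_inv_into_right[OF bij] by (simp add: graph_iso_def)
  qed
  thus ?thesis using bij_betw_inv_into[OF bij] by (simp add: graph_iso_def)
qed

lemma isomorphic_refl: "isomorphic G G"
  by (auto simp: isomorphic_def intro: exI[of _ id])

lemma isomorphic_sym: "isomorphic G H \<Longrightarrow> isomorphic H G"
  using graph_iso_inv isomorphic_iff by metis

lemma graph_iso_nbhd:
  assumes "graph_iso f G H" "v \<in> verts G"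
  shows "nbhd H (f v) = f ` nbhd G v"
  using assms unfolding graph_iso_def nbhd_def bij_betw_def by force

lemma graph_iso_degree:
  assumes "graph_iso f G H" "v \<in> verts G"
  shows "degree H (f v) = degree G v"
  unfolding degree_nbhd graph_iso_nbhd[OF assms]
  using assms by (intro card_image) (auto simp: graph_iso_def bij_betw_def nbhd_def inj_on_def)

lemma graph_iso_co:
  assumes "graph_iso f G H"
  shows "graph_iso f (co G) (co H)"
  using assms unfolding graph_iso_def
  by (simp add: adjacent_co) (metis bij_betw_imp_inj_on bij_betwE inj_on_def)

lemma isomorphic_co: "isomorphic G H \<Longrightarrow> isomorphic (co G) (co H)"
  using graph_iso_co isomorphic_iff by metis

lemma co_induced: "simple_graph G \<Longrightarrow> W \<subseteq> verts G \<Longrightarrow> co (induced G W) = induced (co G) W"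
  by (rule simple_graph_eqI)
    (auto simp: simple_co simple_induced adjacent_co adjacent_induced)

definition edge_count :: "'a ugraph \<Rightarrow> 'a set \<Rightarrow> nat" where
  "edge_count G S = card {e \<in> edges G. e \<subseteq> S}"

lemma finite_edges: "simple_graph G \<Longrightarrow> finite (edges G)"
  unfolding simple_graph_def by (meson Pow_iff finite_Pow_iff rev_finite_subset subsetI)

lemma edges_switch:
  assumes "simple_graph G" "alternating G a b c d"
  shows "edges (switch G a b c d) = insert {a, c} (insert {b, d} (edges G - {{a, b}, {c, d}}))"
    (is "edges ?H = ?E")
proof -
  have iff: "{x, y} \<in> edges ?H \<longleftrightarrow> {x, y} \<in> ?E" for x y
    using adjacent_switch[OF assms, of x y] unfolding adjacent_def insert_iff Diff_iff empty_iff by argo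
  have "e \<in> edges ?H \<longleftrightarrow> e \<in> ?E" for e
  proof (cases "\<exists>x y. e = {x, y}")
    case True
    thus ?thesis using iff by blast
  next
    case False
    have "e \<notin> edges G" "e \<notin> edges ?H"
      using False by (metis assms(1) edgesE, metis assms(1) simple_switch edgesE)
    moreover have "e \<noteq> {a, c}" "e \<noteq> {b, d}" using False by blast+
    ultimately show ?thesis by simp
  qed
  thus ?thesis by (rule set_eqI)
qed

lemma card_filter_insert2:
  assumes "finite E" "e \<notin> E" "f \<notin> E" "e \<noteq> f"
  shows "card {x \<in> insert e (insert f E). P x} = of_bool (P e) + of_bool (P f) + card {x \<in> E. P x}"
proof -
  have "{x \<in> insert e (insert f E). P x} =
      (if P e then {e} else {}) \<union> ((if P f then {f} else {}) \<union> {x \<in> E. P x})"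
    by auto
  thus ?thesis using assms by simp
qed

lemma edge_count_switch:
  assumes "simple_graph G" "alternating G a b c d"
  shows "edge_count (switch G a b c d) S + (of_bool (a \<in> S \<and> b \<in> S) + of_bool (c \<in> S \<and> d \<in> S))
    = edge_count G S + (of_bool (a \<in> S \<and> c \<in> S) + of_bool (b \<in> S \<and> d \<in> S))"
proof -
  let ?E = "edges G - {{a, b}, {c, d}}"
  have fin: "finite ?E" using finite_edges[OF assms(1)] by simp
  have dist: "a \<noteq> b" "a \<noteq> c" "a \<noteq> d" "b \<noteq> c" "b \<noteq> d" "c \<noteq> d"
    using alternating_distinct(1)[OF assms] by auto
  have e: "{a, b} \<in> edges G" "{c, d} \<in> edges G" "{a, c} \<notin> ?E" "{b, d} \<notin> ?E"
    using assms(2) by (auto simp: alternating_def adjacent_def)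
  have ne: "{a, b} \<noteq> {c, d}" "{a, c} \<noteq> {b, d}"
    using dist by (auto simp: doubleton_eq_iff)
  have E: "edges G = insert {a, b} (insert {c, d} ?E)" using e(1,2) by blast
  have "edge_count G S = of_bool ({a, b} \<subseteq> S) + of_bool ({c, d} \<subseteq> S) + card {e \<in> ?E. e \<subseteq> S}"
    unfolding edge_count_def by (subst E, rule card_filter_insert2) (use fin ne in auto)
  moreover have "edge_count (switch G a b c d) S =
      of_bool ({a, c} \<subseteq> S) + of_bool ({b, d} \<subseteq> S) + card {e \<in> ?E. e \<subseteq> S}"
    unfolding edge_count_def edges_switch[OF assms]
    by (rule card_filter_insert2[OF fin e(3,4) ne(2)])
  ultimately show ?thesis by simp
qed

lemma graph_iso_edge_count:
  assumes "simple_graph G" "simple_graph H" "graph_iso f G H" "S \<subseteq> verts G"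
  shows "edge_count H (f ` S) = edge_count G S"
proof -
  from assms(3) have inj: "inj_on f (verts G)" and im: "f ` verts G = verts H"
    by (auto simp: graph_iso_def bij_betw_def)
  have "bij_betw ((`) f) {e \<in> edges G. e \<subseteq> S} {e \<in> edges H. e \<subseteq> f ` S}"
  proof (rule bij_betw_imageI)
    show "inj_on ((`) f) {e \<in> edges G. e \<subseteq> S}"
      using inj_on_image_Pow[OF inj_on_subset[OF inj assms(4)]]
      by (rule inj_on_subset) auto
    show "(`) f ` {e \<in> edges G. e \<subseteq> S} = {e \<in> edges H. e \<subseteq> f ` S}"
    proof (intro equalityI subsetI)
      fix e assume "e \<in> (`) f ` {e \<in> edges G. e \<subseteq> S}"
      then obtain e0 where e0: "e = f ` e0" "e0 \<in> edges G" "e0 \<subseteq> S" by auto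
      from e0(2) obtain x y where "e0 = {x, y}" "adjacent G x y" by (rule edgesE[OF assms(1)])
      with e0 assms show "e \<in> {e \<in> edges H. e \<subseteq> f ` S}"
        by (auto simp: graph_iso_def adjacent_def)
    next
      fix e assume e: "e \<in> {e \<in> edges H. e \<subseteq> f ` S}"
      hence "e \<in> edges H" by simp
      then obtain x y where xy: "e = {x, y}" "adjacent H x y" by (rule edgesE[OF assms(2)])
      with e obtain u v where uv: "u \<in> S" "v \<in> S" "x = f u" "y = f v" by auto
      hence "adjacent G u v" using xy assms(3,4) by (auto simp: graph_iso_def)
      thus "e \<in> (`) f ` {e \<in> edges G. e \<subseteq> S}"
        using uv xy by (intro image_eqI[of _ _ "{u, v}"]) (auto simp: adjacent_def)
    qed
  qed
  from bij_betw_same_card[OF this] show ?thesis by (simp add: edge_count_def)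
qed

section \<open>Switching between a degree class and the remaining vertices\<close>

text \<open>The two clauses exclude the alternating four-cycles, with two vertices in \<open>A\<close> and two in \<open>B\<close>,
  whose switch would change the number of edges inside \<open>A\<close> by one: in the first clause \<open>ac\<close> and
  \<open>bd\<close> would be traded for \<open>ab\<close> and \<open>cd\<close>, in the second the other way round. The condition is
  invariant under exchanging \<open>A\<close> with \<open>B\<close> and edges with non-edges, and both symmetries are used
  below.\<close>

definition uncrossed :: "'a ugraph \<Rightarrow> 'a set \<Rightarrow> 'a set \<Rightarrow> bool" where
  "uncrossed H A B \<longleftrightarrow> (\<forall>a \<in> A. \<forall>c \<in> A. \<forall>b \<in> B. \<forall>d \<in> B. a \<noteq> c \<longrightarrow> b \<noteq> d \<longrightarrow>
     (adjacent H a c \<and> adjacent H b d \<longrightarrow> adjacent H a b \<or> adjacent H c d) \<and>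
     (\<not> adjacent H a c \<and> \<not> adjacent H b d \<longrightarrow> \<not> adjacent H a b \<or> \<not> adjacent H c d))"

lemma uncrossed_edge:
  "uncrossed H A B \<Longrightarrow> a \<in> A \<Longrightarrow> c \<in> A \<Longrightarrow> b \<in> B \<Longrightarrow> d \<in> B \<Longrightarrow> a \<noteq> c \<Longrightarrow> b \<noteq> d \<Longrightarrow>
   adjacent H a c \<Longrightarrow> adjacent H b d \<Longrightarrow> adjacent H a b \<or> adjacent H c d"
  unfolding uncrossed_def by blast

lemma uncrossed_nonedge:
  "uncrossed H A B \<Longrightarrow> a \<in> A \<Longrightarrow> c \<in> A \<Longrightarrow> b \<in> B \<Longrightarrow> d \<in> B \<Longrightarrow> a \<noteq> c \<Longrightarrow> b \<noteq> d \<Longrightarrow>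
   \<not> adjacent H a c \<Longrightarrow> \<not> adjacent H b d \<Longrightarrow> adjacent H a b \<Longrightarrow> \<not> adjacent H c d"
  unfolding uncrossed_def by blast

lemma uncrossed_sym: "uncrossed H A B \<longleftrightarrow> uncrossed H B A"
proof -
  have "uncrossed H B A" if u: "uncrossed H A B" for A B
    unfolding uncrossed_def
  proof (intro ballI impI)
    fix b d a c assume *: "b \<in> B" "d \<in> B" "a \<in> A" "c \<in> A" "b \<noteq> d" "a \<noteq> c"
    show "(adjacent H b d \<and> adjacent H a c \<longrightarrow> adjacent H b a \<or> adjacent H d c) \<and>
      (\<not> adjacent H b d \<and> \<not> adjacent H a c \<longrightarrow> \<not> adjacent H b a \<or> \<not> adjacent H d c)"
      using uncrossed_edge[OF u *(3,4,1,2,6,5)] uncrossed_nonedge[OF u *(3,4,1,2,6,5)]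
      by (auto simp: adjacent_sym)
  qed
  thus ?thesis by blast
qed

lemma uncrossed_co:
  assumes "uncrossed H A B" "A \<union> B \<subseteq> verts H" "A \<inter> B = {}"
  shows "uncrossed (co H) A B"
  unfolding uncrossed_def adjacent_co
  using assms uncrossed_edge[OF assms(1)] uncrossed_nonedge[OF assms(1)] by blast

definition uncrossable :: "'a ugraph \<Rightarrow> 'a set \<Rightarrow> 'a set \<Rightarrow> bool" where
  "uncrossable G A B \<longleftrightarrow> (\<forall>H. same_degrees G H \<longrightarrow> uncrossed H A B)"

lemma uncrossable_sym: "uncrossable G A B \<longleftrightarrow> uncrossable G B A"
  unfolding uncrossable_def using uncrossed_sym by blast

lemma uncrossable_co:
  assumes "simple_graph G" "uncrossable G A B" "A \<union> B \<subseteq> verts G" "A \<inter> B = {}"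
  shows "uncrossable (co G) A B"
  unfolding uncrossable_def
proof (intro allI impI)
  fix H assume H: "same_degrees (co G) H"
  have "uncrossed (co H) A B"
    using assms(2) same_degrees_co[OF assms(1) H] by (simp add: uncrossable_def)
  moreover have "verts (co H) = verts G" using H by (simp add: same_degrees_def)
  ultimately have "uncrossed (co (co H)) A B"
    using uncrossed_co assms(3,4) by metis
  thus "uncrossed H A B" using H by (simp add: co_co same_degrees_def)
qed

lemma uncrossable_if_edge_count_fixed:
  assumes "\<And>H. same_degrees G H \<Longrightarrow> edge_count H A = edge_count G A" "A \<inter> B = {}"
  shows "uncrossable G A B"
  unfolding uncrossable_def uncrossed_def
proof (intro allI impI ballI)
  fix H a c b d
  assume H: "same_degrees G H" and abcd: "a \<in> A" "c \<in> A" "b \<in> B" "d \<in> B" "a \<noteq> c" "b \<noteq> d"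
  from H have s: "simple_graph H" by (simp add: same_degrees_def)
  have fix_count: "edge_count (switch H p q r t) A = edge_count H A" if "alternating H p q r t" for p q r t
    using assms(1) H same_degrees_switch[OF s that] same_degrees_trans by metis
  have nin: "b \<notin> A" "d \<notin> A" using abcd assms(2) by auto
  have 1: "\<not> alternating H a c b d" "\<not> alternating H a b c d"
    using edge_count_switch[OF s, of a c b d A] edge_count_switch[OF s, of a b c d A]
      fix_count abcd nin by auto
  thus "(adjacent H a c \<and> adjacent H b d \<longrightarrow> adjacent H a b \<or> adjacent H c d) \<and>
     (\<not> adjacent H a c \<and> \<not> adjacent H b d \<longrightarrow> \<not> adjacent H a b \<or> \<not> adjacent H c d)"
    using abcd nin by (auto simp: alternating_def)
qed

definition full_to :: "'a ugraph \<Rightarrow> 'a set \<Rightarrow> 'a \<Rightarrow> bool" where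
  "full_to G D x \<longleftrightarrow> (\<forall>y \<in> D. adjacent G x y)"

definition empty_to :: "'a ugraph \<Rightarrow> 'a set \<Rightarrow> 'a \<Rightarrow> bool" where
  "empty_to G D x \<longleftrightarrow> (\<forall>y \<in> D. \<not> adjacent G x y)"

text \<open>\<open>D\<close> consists of vertices of equal degree and is neither a clique nor stable; no realization of
  the degrees has a forbidden crossing between \<open>D\<close> and the remaining vertices. Since vertices of
  equal degree can take over each other's neighbours by switches, the position of a vertex
  outside \<open>D\<close> relative to an edge (or non-edge) of \<open>D\<close> can be varied. This leaves very little
  freedom: outside \<open>D\<close>, the vertices full to \<open>D\<close> form a clique, those empty to \<open>D\<close> form a stable
  set, and there is at most one further vertex, adjacent to all full and to no empty ones.\<close>

locale mixed_class =
  fixes G :: "'a ugraph" and D :: "'a set"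
  assumes simple: "simple_graph G"
    and D_sub: "D \<subseteq> verts G"
    and D_deg: "\<And>x y. x \<in> D \<Longrightarrow> y \<in> D \<Longrightarrow> degree G x = degree G y"
    and uncr: "uncrossable G D (verts G - D)"
    and has_edge: "\<exists>p \<in> D. \<exists>q \<in> D. adjacent G p q"
    and has_nonedge: "\<exists>p \<in> D. \<exists>q \<in> D. p \<noteq> q \<and> \<not> adjacent G p q"
begin

lemma mixed_class_co: "mixed_class (co G) D"
proof unfold_locales
  show "simple_graph (co G)" by (simp add: simple_co simple)
  show "degree (co G) x = degree (co G) y" if "x \<in> D" "y \<in> D" for x y
    using that D_deg D_sub degree_co_eq_iff[OF simple] by blast
  show "uncrossable (co G) D (verts (co G) - D)"
    using uncrossable_co[OF simple uncr] D_sub by auto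
  show "\<exists>p \<in> D. \<exists>q \<in> D. adjacent (co G) p q"
    using has_nonedge D_sub by (auto simp: adjacent_co)
  show "\<exists>p \<in> D. \<exists>q \<in> D. p \<noteq> q \<and> \<not> adjacent (co G) p q"
    using has_edge adjacentD(3)[OF simple] unfolding adjacent_co by blast
qed (use D_sub in simp)

lemma exchange:
  assumes "same_degrees G H" "x \<in> D" "y \<in> D" "adjacent H x u" "\<not> adjacent H y u" "u \<noteq> y"
  obtains z where "adjacent H y z" "\<not> adjacent H x z" "z \<noteq> x" "z \<noteq> u"
    "alternating H x u z y"
proof -
  have "degree H v = degree G v" if "v \<in> D" for v
    using that assms(1) D_sub by (auto simp: same_degrees_def)
  with D_deg[OF assms(2,3)] assms(1-3) have s: "simple_graph H" "degree H x \<le> degree H y"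
    by (simp_all add: same_degrees_def)
  obtain z where z: "adjacent H y z" "\<not> adjacent H x z" "z \<noteq> x" "z \<noteq> u"
    using exists_exchange[OF s assms(4-6)] by blast
  hence "alternating H x u z y"
    using assms by (auto simp: alternating_def adjacent_sym)
  with z that show ?thesis by blast
qed

lemma uncrossed_class: "same_degrees G H \<Longrightarrow> uncrossed H D (verts G - D)"
  using uncr by (simp add: uncrossable_def)

lemma empty_not_adjacent_empty:
  assumes "x \<in> verts G - D" "y \<in> verts G - D" "empty_to G D x" "empty_to G D y"
  shows "\<not> adjacent G x y"
proof
  assume xy: "adjacent G x y"
  obtain p q where pq: "p \<in> D" "q \<in> D" "adjacent G p q" using has_edge by blast
  from uncrossed_edge[OF uncrossed_class[OF same_degrees_refl[OF simple]] pq(1,2) assms(1,2) _ _ pq(3) xy]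
  show False
    using assms(3,4) pq adjacentD(3)[OF simple] xy by (metis adjacent_sym empty_to_def)
qed

text \<open>If \<open>xe\<close> were an edge, both ends of an edge \<open>pq\<close> of \<open>D\<close> would be adjacent to \<open>x\<close>, as \<open>e\<close> is
  adjacent to neither. A switch that makes \<open>x\<close> give up \<open>p\<close> for a non-neighbour \<open>w\<close> keeps \<open>pq\<close>
  and \<open>xe\<close> and thereby produces a forbidden crossing.\<close>

lemma empty_not_adjacent_mixed:
  assumes "x \<in> verts G - D" "e \<in> verts G - D" "empty_to G D e" "\<not> full_to G D x"
  shows "\<not> adjacent G x e"
proof
  assume xe: "adjacent G x e"
  note ne = adjacentD(3)[OF simple xe]
  obtain p q where pq: "p \<in> D" "q \<in> D" "adjacent G p q" using has_edge by blast
  note pq_ne = adjacentD(3)[OF simple pq(3)]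
  have px: "adjacent G p x"
    using uncrossed_edge[OF uncrossed_class[OF same_degrees_refl[OF simple]] pq(1,2) assms(1,2) pq_ne ne pq(3) xe]
      assms(3) pq(2) by (auto simp: empty_to_def adjacent_sym)
  have qx: "adjacent G q x"
    using uncrossed_edge[OF uncrossed_class[OF same_degrees_refl[OF simple]] pq(2,1) assms(1,2) _ ne _ xe]
      pq_ne assms(3) pq by (auto simp: empty_to_def adjacent_sym)
  obtain w where w: "w \<in> D" "\<not> adjacent G w x"
    using assms(4) by (auto simp: full_to_def adjacent_sym)
  have xw: "x \<noteq> w" using w assms(1) by auto
  obtain z where z: "adjacent G w z" "\<not> adjacent G p z" "z \<noteq> p" "z \<noteq> x" "alternating G p x z w"
    using exchange[OF same_degrees_refl[OF simple] pq(1) w(1) px w(2) xw] by blast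
  let ?H = "switch G p x z w"
  have H: "same_degrees G ?H" by (rule same_degrees_switch[OF simple z(5)])
  note adj = adjacent_switch[OF simple z(5)]
  have "w \<noteq> q" "w \<noteq> p" using w px qx by auto
  have "adjacent ?H p q" using pq z \<open>w \<noteq> q\<close> \<open>w \<noteq> p\<close> assms(1) pq_ne by (auto simp: adj doubleton_eq_iff)
  moreover have "adjacent ?H x e"
    using xe z w(1) pq assms by (auto simp: adj doubleton_eq_iff)
  moreover have "\<not> adjacent ?H p x"
    using z \<open>w \<noteq> p\<close> xw assms pq by (auto simp: adj doubleton_eq_iff)
  moreover have "\<not> adjacent ?H q e"
    using z xw pq_ne \<open>w \<noteq> q\<close> ne assms pq
    by (auto simp: adj doubleton_eq_iff empty_to_def adjacent_sym)
  ultimately show False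
    using uncrossed_edge[OF uncrossed_class[OF H] pq(1,2) assms(1,2) pq_ne ne] by blast
qed

text \<open>Starting from an edge \<open>pq\<close> of \<open>D\<close> and an edge \<open>bd\<close> outside, two switches detach \<open>p\<close> from \<open>b\<close> and
  \<open>q\<close> from \<open>d\<close> while they keep \<open>pq\<close> and \<open>bd\<close>; the result is a forbidden crossing.\<close>

lemma mixed_not_adjacent_mixed:
  assumes "b \<in> verts G - D" "d \<in> verts G - D" "\<not> full_to G D b" "\<not> full_to G D d"
  shows "\<not> adjacent G b d"
proof
  assume bd: "adjacent G b d"
  note ne = adjacentD(3)[OF simple bd]
  obtain p q where pq: "p \<in> D" "q \<in> D" "adjacent G p q" using has_edge by blast
  note pq_ne = adjacentD(3)[OF simple pq(3)]
  \<comment> \<open>first free \<open>p\<close> from \<open>b\<close>\<close>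
  obtain H where H: "same_degrees G H" "adjacent H p q" "adjacent H b d" "\<not> adjacent H p b"
    "\<exists>y \<in> D. \<not> adjacent H y d"
  proof (cases "adjacent G p b")
    case False
    thus ?thesis
      using that[OF same_degrees_refl[OF simple] pq(3) bd] assms(4) by (auto simp: full_to_def adjacent_sym)
  next
    case True
    obtain x where x: "x \<in> D" "\<not> adjacent G x b" using assms(3) by (auto simp: full_to_def adjacent_sym)
    have bx: "b \<noteq> x" using x assms(1) by auto
    have "x \<noteq> p" using True x by auto
    obtain z where z: "adjacent G x z" "\<not> adjacent G p z" "z \<noteq> p" "z \<noteq> b" "alternating G p b z x"
      using exchange[OF same_degrees_refl[OF simple] pq(1) x(1) True x(2) bx] by blast
    note adj = adjacent_switch[OF simple z(5)]
    obtain y where y: "y \<in> D" "\<not> adjacent G y d" using assms(4) by (auto simp: full_to_def adjacent_sym)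
    have "\<exists>y \<in> D. \<not> adjacent (switch G p b z x) y d"
    proof (cases "z = d")
      case True
      have "\<not> adjacent (switch G p b z x) x z"
        using \<open>x \<noteq> p\<close> bx x(1) assms True ne unfolding adj by (auto simp: doubleton_eq_iff)
      thus ?thesis using True x(1) by blast
    next
      case False
      thus ?thesis using y assms ne pq x by (intro bexI[of _ y]) (auto simp: adj doubleton_eq_iff)
    qed
    moreover have "adjacent (switch G p b z x) p q" "adjacent (switch G p b z x) b d"
      "\<not> adjacent (switch G p b z x) p b"
      using pq z x \<open>x \<noteq> p\<close> bd assms bx pq_ne ne by (auto simp: adj doubleton_eq_iff)
    ultimately show ?thesis using that same_degrees_switch[OF simple z(5)] by blast
  qed
  have sH: "simple_graph H" using H(1) by (simp add: same_degrees_def)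
  \<comment> \<open>then free \<open>q\<close> from \<open>d\<close>\<close>
  obtain L where L: "same_degrees G L" "adjacent L p q" "adjacent L b d" "\<not> adjacent L p b" "\<not> adjacent L q d"
  proof (cases "adjacent H q d")
    case False
    thus ?thesis using that H by blast
  next
    case True
    obtain y where y: "y \<in> D" "\<not> adjacent H y d" using H(5) by blast
    have dy: "d \<noteq> y" using y assms(2) by auto
    have "y \<noteq> q" using True y by auto
    obtain z where z: "adjacent H y z" "\<not> adjacent H q z" "z \<noteq> q" "z \<noteq> d" "alternating H q d z y"
      using exchange[OF H(1) pq(2) y(1) True y(2) dy] by blast
    note adj = adjacent_switch[OF sH z(5)]
    have "adjacent (switch H q d z y) p q" "adjacent (switch H q d z y) b d"
      "\<not> adjacent (switch H q d z y) p b" "\<not> adjacent (switch H q d z y) q d"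
      using pq z y \<open>y \<noteq> q\<close> H(2-4) assms dy pq_ne ne by (auto simp: adj doubleton_eq_iff)
    thus ?thesis using that same_degrees_trans[OF H(1) same_degrees_switch[OF sH z(5)]] by blast
  qed
  show False
    using uncrossed_edge[OF uncrossed_class[OF L(1)] pq(1,2) assms(1,2) pq_ne ne L(2,3)] L(4,5) by blast
qed

end

text \<open>Complementation exchanges full and empty vertices, so each of the statements above has a dual.\<close>

lemma (in mixed_class) full_co:
  "x \<in> verts G - D \<Longrightarrow> full_to (co G) D x \<longleftrightarrow> empty_to G D x"
  "x \<in> verts G - D \<Longrightarrow> empty_to (co G) D x \<longleftrightarrow> full_to G D x"
  using D_sub by (auto simp: full_to_def empty_to_def adjacent_co)

lemma (in mixed_class) full_adjacent_nonempty:
  assumes "x \<in> verts G - D" "f \<in> verts G - D" "x \<noteq> f" "full_to G D f" "\<not> empty_to G D x"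
  shows "adjacent G x f"
proof -
  interpret C: mixed_class "co G" D by (rule mixed_class_co)
  show ?thesis
    using C.empty_not_adjacent_mixed[of x f] assms full_co by (auto simp: adjacent_co)
qed

lemma (in mixed_class) mixed_unique:
  assumes "b \<in> verts G - D" "d \<in> verts G - D"
    "\<not> full_to G D b" "\<not> empty_to G D b" "\<not> full_to G D d" "\<not> empty_to G D d"
  shows "b = d"
proof (rule ccontr)
  interpret C: mixed_class "co G" D by (rule mixed_class_co)
  assume "b \<noteq> d"
  thus False
    using mixed_not_adjacent_mixed[of b d] C.mixed_not_adjacent_mixed[of b d] assms full_co
    by (auto simp: adjacent_co)
qed

section \<open>Split graphs and decompositions\<close>

text \<open>A composition seen from the composed graph: \<open>K\<close> and \<open>S\<close> are the two parts of the split factor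
  and \<open>C\<close> is the vertex set of the other factor. With \<open>K\<close> and \<open>S\<close> empty this is the trivial
  decomposition, which every graph has with \<open>C\<close> equal to its vertex set.\<close>

definition decomposes :: "'a ugraph \<Rightarrow> 'a set \<Rightarrow> 'a set \<Rightarrow> 'a set \<Rightarrow> bool" where
  "decomposes G K S C \<longleftrightarrow> verts G = K \<union> S \<union> C \<and> K \<inter> S = {} \<and> K \<inter> C = {} \<and> S \<inter> C = {} \<and>
     clique G K \<and> stable G S \<and>
     (\<forall>k \<in> K. \<forall>c \<in> C. adjacent G k c) \<and> (\<forall>s \<in> S. \<forall>c \<in> C. \<not> adjacent G s c)"

lemma decomposable_iff:
  assumes "simple_graph G"
  shows "decomposable G \<longleftrightarrow> (\<exists>K S C. decomposes G K S C \<and> K \<union> S \<noteq> {} \<and> C \<noteq> {})"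
proof
  assume "decomposable G"
  then obtain G1 K S G0 where *: "simple_graph G1" "simple_graph G0" "verts G1 \<noteq> {}" "verts G0 \<noteq> {}"
    "verts G1 \<inter> verts G0 = {}" "KS_partition G1 K S" "G = compose G1 K G0"
    unfolding decomposable_def by blast
  have adj: "adjacent G x y \<longleftrightarrow> adjacent G1 x y \<or> adjacent G0 x y \<or>
      x \<in> K \<and> y \<in> verts G0 \<or> y \<in> K \<and> x \<in> verts G0" for x y
    unfolding *(7) adjacent_def compose_def by (auto simp: doubleton_eq_iff)
  have nadj1: "\<not> adjacent G1 x y" if "x \<notin> verts G1 \<or> y \<notin> verts G1" for x y
    using adjacentD[OF *(1)] that by blast
  have nadj0: "\<not> adjacent G0 x y" if "x \<notin> verts G0 \<or> y \<notin> verts G0" for x y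
    using adjacentD[OF *(2)] that by blast
  have KS: "verts G1 = K \<union> S" "K \<inter> S = {}" "clique G1 K" "stable G1 S"
    using *(6) by (auto simp: KS_partition_def)
  have "verts G = K \<union> S \<union> verts G0" using KS *(7) by (simp add: compose_def)
  moreover have "clique G K" "stable G S"
  proof -
    show "clique G K" using KS \<open>verts G = _\<close> by (auto simp: clique_def adj)
    have "\<not> adjacent G x y" if "x \<in> S" "y \<in> S" for x y
      using that KS *(5) nadj0[of x y] unfolding adj stable_def by blast
    thus "stable G S" using \<open>verts G = _\<close> by (auto simp: stable_def)
  qed
  moreover have "\<not> adjacent G s c" if "s \<in> S" "c \<in> verts G0" for s c
    using that KS *(5) nadj0[of s c] nadj1[of s c] by (auto simp: adj)
  ultimately have "decomposes G K S (verts G0)"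
    using KS *(5) unfolding decomposes_def by (auto simp: adj)
  thus "\<exists>K S C. decomposes G K S C \<and> K \<union> S \<noteq> {} \<and> C \<noteq> {}"
    using *(3,4) KS(1) by blast
next
  assume "\<exists>K S C. decomposes G K S C \<and> K \<union> S \<noteq> {} \<and> C \<noteq> {}"
  then obtain K S C where d: "decomposes G K S C" and ne: "K \<union> S \<noteq> {}" "C \<noteq> {}" by blast
  let ?G1 = "induced G (K \<union> S)" and ?G0 = "induced G C"
  have sub: "K \<union> S \<subseteq> verts G" "C \<subseteq> verts G" using d by (auto simp: decomposes_def)
  have "edges G = edges (compose ?G1 K ?G0)"
  proof (intro equalityI subsetI)
    fix e assume e: "e \<in> edges G"
    then obtain x y where xy: "e = {x, y}" "adjacent G x y" by (rule edgesE[OF assms])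
    have "x \<in> K \<union> S \<union> C" "y \<in> K \<union> S \<union> C"
      using adjacentD[OF assms xy(2)] d by (auto simp: decomposes_def)
    moreover have "\<not> (x \<in> S \<and> y \<in> C)" "\<not> (y \<in> S \<and> x \<in> C)"
      using xy(2) d by (auto simp: decomposes_def adjacent_sym)
    ultimately have "x \<in> K \<union> S \<and> y \<in> K \<union> S \<or> x \<in> C \<and> y \<in> C \<or>
      x \<in> K \<and> y \<in> C \<or> y \<in> K \<and> x \<in> C"
      by blast
    thus "e \<in> edges (compose ?G1 K ?G0)"
      using e xy by (auto simp: compose_def induced_def)
  next
    fix e assume "e \<in> edges (compose ?G1 K ?G0)"
    hence "e \<in> edges G \<or> (\<exists>k h. e = {k, h} \<and> k \<in> K \<and> h \<in> C)"
      by (auto simp: compose_def induced_def)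
    thus "e \<in> edges G" using d by (auto simp: decomposes_def adjacent_def)
  qed
  hence G: "G = compose ?G1 K ?G0"
    using d by (cases G) (auto simp: compose_def decomposes_def)
  have "KS_partition ?G1 K S"
    using d by (auto simp: KS_partition_def decomposes_def clique_def stable_def adjacent_induced)
  moreover have "simple_graph ?G1" "simple_graph ?G0"
    using simple_induced[OF assms] sub by auto
  moreover have "verts ?G1 \<inter> verts ?G0 = {}" using d by (auto simp: decomposes_def)
  moreover have "verts ?G1 \<noteq> {}" "verts ?G0 \<noteq> {}" using ne by simp_all
  ultimately show "decomposable G"
    unfolding decomposable_def using G by blast
qed

lemma split_graphI:
  assumes "simple_graph G" "verts G = K \<union> S" "K \<inter> S = {}"
    "\<And>x y. x \<in> K \<Longrightarrow> y \<in> K \<Longrightarrow> x \<noteq> y \<Longrightarrow> adjacent G x y"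
    "\<And>x y. x \<in> S \<Longrightarrow> y \<in> S \<Longrightarrow> \<not> adjacent G x y"
  shows "split_graph G"
  unfolding split_graph_def KS_partition_def clique_def stable_def
  using assms by (intro conjI exI[of _ K] exI[of _ S]) auto

lemma decomposes_co:
  "decomposes G K S C \<Longrightarrow> decomposes (co G) S K C"
  unfolding decomposes_def clique_def stable_def
  by (auto simp: adjacent_co adjacent_sym)

lemma decomposable_co:
  assumes "simple_graph G"
  shows "decomposable (co G) \<longleftrightarrow> decomposable G"
proof -
  have "decomposable (co H)" if "decomposable H" "simple_graph H" for H :: "'a ugraph"
    using that decomposes_co unfolding decomposable_iff[OF that(2)] decomposable_iff[OF simple_co[OF that(2)]]
    by blast
  from this[of G] this[of "co G"] show ?thesis using assms simple_co co_co by metis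
qed

lemma split_co:
  assumes "simple_graph G"
  shows "split_graph (co G) \<longleftrightarrow> split_graph G"
proof -
  have "split_graph (co H)" if "split_graph H" for H :: "'a ugraph"
  proof -
    from that obtain K S where "simple_graph H" "KS_partition H K S" by (auto simp: split_graph_def)
    thus ?thesis
      by (intro split_graphI[of _ S K])
        (auto simp: simple_co KS_partition_def clique_def stable_def adjacent_co)
  qed
  from this[of G] this[of "co G"] show ?thesis using assms co_co by metis
qed

definition has_2K2 :: "'a ugraph \<Rightarrow> bool" where
  "has_2K2 G \<longleftrightarrow> (\<exists>a b c d. adjacent G a b \<and> adjacent G c d \<and> a \<noteq> c \<and> a \<noteq> d \<and> b \<noteq> c \<and> b \<noteq> d \<and>
     \<not> adjacent G a c \<and> \<not> adjacent G a d \<and> \<not> adjacent G b c \<and> \<not> adjacent G b d)"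

definition has_C4 :: "'a ugraph \<Rightarrow> bool" where
  "has_C4 G \<longleftrightarrow> (\<exists>a b c d. a \<noteq> c \<and> b \<noteq> d \<and> adjacent G a b \<and> adjacent G b c \<and> adjacent G c d \<and>
     adjacent G d a \<and> \<not> adjacent G a c \<and> \<not> adjacent G b d)"

definition is_C5 :: "'a ugraph \<Rightarrow> 'a \<Rightarrow> 'a \<Rightarrow> 'a \<Rightarrow> 'a \<Rightarrow> 'a \<Rightarrow> bool" where
  "is_C5 G a b c d e \<longleftrightarrow> distinct [a, b, c, d, e] \<and>
     adjacent G a b \<and> adjacent G b c \<and> adjacent G c d \<and> adjacent G d e \<and> adjacent G e a \<and>
     \<not> adjacent G a c \<and> \<not> adjacent G b d \<and> \<not> adjacent G c e \<and> \<not> adjacent G d a \<and> \<not> adjacent G e b"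

text \<open>The theorem of Foeldes and Hammer. Among the cliques of maximum size take \<open>K\<close> with the largest
  degree sum. If two vertices \<open>x\<close>, \<open>y\<close> outside \<open>K\<close> are adjacent, their sets of non-neighbours in
  \<open>K\<close> are nested (else there is an induced four-cycle) and meet in at most one vertex (else
  there is an induced pair of disjoint edges). So \<open>x\<close> misses a single vertex \<open>u\<close> of \<open>K\<close>, and \<open>y\<close>
  misses \<open>u\<close> and, by maximality of \<open>K\<close>, another vertex \<open>v\<close>. Replacing \<open>u\<close> by \<open>x\<close> yields a
  maximum clique again, so the degree of \<open>u\<close> is at least that of \<open>x\<close>, and \<open>u\<close> has a neighbour
  \<open>z\<close> that is not adjacent to \<open>x\<close>. The vertices \<open>v\<close>, \<open>x\<close>, \<open>y\<close>, \<open>z\<close>, \<open>u\<close> then carry one of the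
  three obstructions.\<close>

lemma nonsplit_obstruction:
  assumes simple: "simple_graph G" and nonsplit: "\<not> split_graph G"
  shows "has_2K2 G \<or> has_C4 G \<or> (\<exists>a b c d e. is_C5 G a b c d e)"
proof (rule ccontr)
  assume contra: "\<not> ?thesis"
  define V where "V = verts G"
  have fin: "finite V" using simple by (simp add: V_def finite_verts)
  have sym: "adjacent G x y \<Longrightarrow> adjacent G y x" for x y using adjacent_sym[of G] by blast
  have clique_le: "card K \<le> card V" if "clique G K" for K
    using that fin by (intro card_mono) (auto simp: clique_def V_def)
  obtain K0 where K0: "clique G K0" "\<And>L. clique G L \<Longrightarrow> card L \<le> card K0"
    using ex_has_greatest_nat[of "clique G" "{}" card "Suc (card V)"] clique_le
    by (metis clique_def empty_iff empty_subsetI le_imp_less_Suc)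
  define W where "W = (\<lambda>L. \<Sum>v\<in>L. degree G v)"
  have W_le: "W L \<le> (\<Sum>v\<in>V. degree G v)" if "clique G L" for L
    unfolding W_def using that fin by (intro sum_mono2) (auto simp: clique_def V_def)
  obtain K where K: "clique G K" "card K = card K0"
    "\<And>L. clique G L \<Longrightarrow> card L = card K0 \<Longrightarrow> W L \<le> W K"
    using ex_has_greatest_nat[of "\<lambda>L. clique G L \<and> card L = card K0" K0 W "Suc (\<Sum>v\<in>V. degree G v)"] W_le K0(1)
    by (metis le_imp_less_Suc)
  have max: "card L \<le> card K" if "clique G L" for L using K0(2)[OF that] K(2) by simp
  have KV: "K \<subseteq> V" and finK: "finite K"
    using K(1) fin by (auto simp: clique_def V_def intro: finite_subset)
  have Kadj: "adjacent G u v" if "u \<in> K" "v \<in> K" "u \<noteq> v" for u v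
    using K(1) that by (auto simp: clique_def)
  have "\<exists>x\<in>V - K. \<exists>y\<in>V - K. adjacent G x y"
  proof (rule ccontr)
    assume "\<not> ?thesis"
    hence "split_graph G"
      using Kadj KV by (intro split_graphI[OF simple, of K "V - K"]) (auto simp: V_def)
    thus False using nonsplit by blast
  qed
  then obtain x0 y0 where xy0: "x0 \<in> V - K" "y0 \<in> V - K" "adjacent G x0 y0" by blast
  have nonnb: "\<exists>v\<in>K. \<not> adjacent G x v" if "x \<in> V - K" for x
  proof (rule ccontr)
    assume "\<not> ?thesis"
    hence "clique G (insert x K)"
      using K(1) that sym by (auto simp: clique_def V_def)
    from max[OF this] show False using that finK by simp
  qed
  \<comment> \<open>the non-neighbourhoods in \<open>K\<close> of adjacent vertices outside \<open>K\<close> are nested\<close>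
  have nested: "\<not> (u \<in> K \<and> v \<in> K \<and> \<not> adjacent G x u \<and> adjacent G y u \<and> \<not> adjacent G y v \<and> adjacent G x v)"
    if "x \<in> V - K" "y \<in> V - K" "adjacent G x y" for x y u v
  proof
    assume *: "u \<in> K \<and> v \<in> K \<and> \<not> adjacent G x u \<and> adjacent G y u \<and> \<not> adjacent G y v \<and> adjacent G x v"
    hence "adjacent G u v" using Kadj by blast
    hence "has_C4 G" unfolding has_C4_def
      using * that sym by (intro exI[of _ x] exI[of _ y] exI[of _ u] exI[of _ v]) auto
    thus False using contra by blast
  qed
  have False if x: "x \<in> V - K" and y: "y \<in> V - K" and xy: "adjacent G x y"
    and sub: "\<And>v. v \<in> K \<Longrightarrow> \<not> adjacent G x v \<Longrightarrow> \<not> adjacent G y v" for x y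
  proof -
    obtain u where u: "u \<in> K" "\<not> adjacent G x u" using nonnb[OF x] by blast
    have yu: "\<not> adjacent G y u" using sub u by blast
    have uniq: "v = u" if "v \<in> K" "\<not> adjacent G x v" for v
    proof (rule ccontr)
      assume "v \<noteq> u"
      hence "has_2K2 G" unfolding has_2K2_def
        using that sub u x y xy yu Kadj[of v u]
        by (intro exI[of _ x] exI[of _ y] exI[of _ v] exI[of _ u]) auto
      thus False using contra by blast
    qed
    have xK: "adjacent G x v" if "v \<in> K - {u}" for v using uniq that by blast
    have "\<exists>v \<in> K. v \<noteq> u \<and> \<not> adjacent G y v"
    proof (rule ccontr)
      assume "\<not> ?thesis"
      hence yK: "adjacent G y v" if "v \<in> K - {u}" for v using that by blast
      have "clique G (insert x (insert y (K - {u})))"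
        using xK yK K(1) x y xy sym by (auto simp: clique_def V_def)
      from max[OF this] show False using u x y finK adjacentD(3)[OF simple xy] by simp
    qed
    then obtain v where v: "v \<in> K" "v \<noteq> u" "\<not> adjacent G y v" by blast
    have xv: "adjacent G x v" using xK v by blast
    have uv: "adjacent G u v" using Kadj u v by blast
    have "clique G (insert x (K - {u}))"
      using xK K(1) x sym by (auto simp: clique_def V_def)
    moreover have "card (insert x (K - {u})) = card K0"
      using u x finK card_Suc_Diff1[OF finK u(1)] K(2) by simp
    ultimately have "W (insert x (K - {u})) \<le> W K" using K(3) by blast
    moreover have "W (insert x (K - {u})) = degree G x + W (K - {u})"
      unfolding W_def using finK x by simp
    moreover have "W K = degree G u + W (K - {u})"
      unfolding W_def using finK u by (simp add: sum.remove)
    ultimately have "degree G x \<le> degree G u" by simp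
    \<comment> \<open>maximality of the degree sum yields a neighbour of \<open>u\<close> that is not one of \<open>x\<close>\<close>
    then obtain z where z: "adjacent G u z" "\<not> adjacent G x z" "z \<noteq> x" "z \<noteq> y"
      using exists_exchange[OF simple, of x u y] xy yu sym y u by blast
    have zu: "z \<noteq> u" using adjacentD(3)[OF simple z(1)] by blast
    have zK: "z \<notin> K" using z(2) xK zu by blast
    have yz: "adjacent G y z"
    proof (rule ccontr)
      assume "\<not> adjacent G y z"
      hence "has_2K2 G" unfolding has_2K2_def
        using xy z u yu x y by (intro exI[of _ x] exI[of _ y] exI[of _ u] exI[of _ z]) auto
      thus False using contra by blast
    qed
    show False
    proof (cases "adjacent G z v")
      case True
      hence "has_C4 G" unfolding has_C4_def
        using xy yz xv v z y sym
        by (intro exI[of _ x] exI[of _ y] exI[of _ z] exI[of _ v]) auto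
      thus False using contra by blast
    next
      case False
      hence "is_C5 G v x y z u" unfolding is_C5_def
        using xy yz xv uv v z y x u yu zu zK adjacentD(3)[OF simple xy]
        by (auto simp: adjacent_sym)
      thus False using contra by blast
    qed
  qed
  from this[OF xy0(1,2,3)] this[OF xy0(2,1) sym[OF xy0(3)]] nested[OF xy0(1,2,3)]
  show False by blast
qed

section \<open>Rigid graphs have at most one exceptional degree\<close>

text \<open>The unigraph property with respect to the realizations on the same vertex set. Unlike the degree
  sequence itself, this notion refers to no ambient vertex type and passes easily to complements
  and to the cores of decompositions.\<close>

definition rigid :: "'a ugraph \<Rightarrow> bool" where
  "rigid U \<longleftrightarrow> simple_graph U \<and> (\<forall>H. same_degrees U H \<longrightarrow> isomorphic U H)"

lemma rigid_co:
  assumes "rigid U"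
  shows "rigid (co U)"
  unfolding rigid_def
proof (intro conjI allI impI)
  have s: "simple_graph U" using assms by (simp add: rigid_def)
  thus "simple_graph (co U)" by (rule simple_co)
  fix H assume H: "same_degrees (co U) H"
  have "isomorphic U (co H)" using same_degrees_co[OF s H] assms by (simp add: rigid_def)
  hence "isomorphic (co U) (co (co H))" by (rule isomorphic_co)
  thus "isomorphic (co U) H" using H by (simp add: co_co same_degrees_def)
qed

lemma rigid_iso:
  assumes "rigid U" "same_degrees U H"
  obtains f where "graph_iso f U H" "\<And>v. v \<in> verts U \<Longrightarrow> f v \<in> verts U"
    "\<And>v. v \<in> verts U \<Longrightarrow> degree U (f v) = degree U v" "inj_on f (verts U)" "f ` verts U = verts U"
proof -
  obtain f where f: "graph_iso f U H"
    using assms by (auto simp: rigid_def isomorphic_iff)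
  have V: "verts H = verts U" using assms(2) by (simp add: same_degrees_def)
  have "f v \<in> verts U" if "v \<in> verts U" for v
    using f that V by (auto simp: graph_iso_def bij_betw_def)
  moreover from this have "degree U (f v) = degree U v" if "v \<in> verts U" for v
    using graph_iso_degree[OF f that] assms(2) that by (simp add: same_degrees_def)
  moreover have "inj_on f (verts U)" "f ` verts U = verts U"
    using f V by (auto simp: graph_iso_def bij_betw_def)
  ultimately show ?thesis using that[OF f] by blast
qed

lemma inj_on_image_eq_if_closed:
  assumes "finite A" "inj_on f A" "f ` A \<subseteq> A"
  shows "f ` A = A"
  using assms by (metis card_image card_subset_eq)

text \<open>An isomorphism between realizations preserves degrees, hence maps a union of degree classes onto
  itself.\<close>

lemma rigid_edge_count:
  assumes "rigid U" "same_degrees U H"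
  shows "edge_count H {v \<in> verts U. P (degree U v)} = edge_count U {v \<in> verts U. P (degree U v)}"
proof -
  let ?S = "{v \<in> verts U. P (degree U v)}"
  from rigid_iso[OF assms] obtain f where f: "graph_iso f U H" "\<And>v. v \<in> verts U \<Longrightarrow> f v \<in> verts U"
    "\<And>v. v \<in> verts U \<Longrightarrow> degree U (f v) = degree U v" "inj_on f (verts U)" "f ` verts U = verts U" by blast
  have s: "simple_graph U" "simple_graph H" using assms by (auto simp: rigid_def same_degrees_def)
  have "f ` ?S = ?S"
    using f(2-4) s(1) by (intro inj_on_image_eq_if_closed) (auto simp: finite_verts inj_on_def)
  thus ?thesis using graph_iso_edge_count[OF s f(1), of ?S] by simp
qed

text \<open>If both equations failed, the switch would change the number of edges inside one of three unions
  of degree classes: the class of \<open>a\<close>, the class of \<open>b\<close>, or both together.\<close>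

lemma rigid_alternating:
  assumes "rigid U" "alternating U a b c d"
  shows "degree U a = degree U d \<or> degree U b = degree U c"
proof (rule ccontr)
  assume no: "\<not> ?thesis"
  have s: "simple_graph U" using assms by (simp add: rigid_def)
  let ?a = "degree U a" and ?b = "degree U b" and ?c = "degree U c" and ?d = "degree U d"
  have V: "a \<in> verts U" "b \<in> verts U" "c \<in> verts U" "d \<in> verts U"
    using alternating_distinct(2)[OF s assms(2)] by auto
  have count: "of_bool (P ?a \<and> P ?b) + of_bool (P ?c \<and> P ?d) =
      (of_bool (P ?a \<and> P ?c) + of_bool (P ?b \<and> P ?d) :: nat)" for P
    using edge_count_switch[OF s assms(2), of "{v \<in> verts U. P (degree U v)}"]
      rigid_edge_count[OF assms(1) same_degrees_switch[OF s assms(2)], of P] V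
    by simp
  consider "?a = ?c" | "?b = ?d" "?a \<noteq> ?c" | "?a \<noteq> ?c" "?b \<noteq> ?d" by blast
  thus False
  proof cases
    case 1
    thus False using count[of "\<lambda>n. n = ?a"] no by auto
  next
    case 2
    thus False using count[of "\<lambda>n. n = ?b"] no by auto
  next
    case 3
    thus False using count[of "\<lambda>n. n = ?a \<or> n = ?b"] no by (auto split: if_splits)
  qed
qed

text \<open>The ten pairs of vertices of a five-cycle fall into five couples, each formed by an edge and the
  non-edge that joins the other neighbours of its ends. One equality per couple makes five equal
  pairs, too many for classes of size at most two.\<close>

lemma pentagon_three_equal:
  fixes a b c d e :: nat
  assumes "a = d \<or> b = c" "b = e \<or> c = d" "c = a \<or> d = e" "d = b \<or> e = a" "e = c \<or> a = b"
  shows "a = b \<and> b = c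
    \<or> a = b \<and> b = d
    \<or> a = b \<and> b = e
    \<or> a = c \<and> c = d
    \<or> a = c \<and> c = e
    \<or> a = d \<and> d = e
    \<or> b = c \<and> c = d
    \<or> b = c \<and> c = e
    \<or> b = d \<and> d = e
    \<or> c = d \<and> d = e"
  using assms by argo

text \<open>Each of the three obstructions to being split is full of alternating four-cycles; the resulting
  equations force three of its vertices to have equal degree, and among these three there are an
  edge and a non-edge.\<close>

lemma rigid_nonsplit_mixed_class:
  assumes "rigid U" "\<not> split_graph U"
  obtains k where "\<exists>p q. adjacent U p q \<and> degree U p = k \<and> degree U q = k"
    "\<exists>p\<in>verts U. \<exists>q\<in>verts U. p \<noteq> q \<and> \<not> adjacent U p q \<and> degree U p = k \<and> degree U q = k"
proof -
  have s: "simple_graph U" using assms by (simp add: rigid_def)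
  let ?g = "\<exists>p q r t. adjacent U p q \<and> \<not> adjacent U r t \<and> r \<noteq> t \<and> r \<in> verts U \<and> t \<in> verts U \<and>
     degree U p = degree U q \<and> degree U q = degree U r \<and> degree U r = degree U t"
  \<comment> \<open>the goal is abbreviated so that it stays opaque in the case distinctions\<close>
  define Q where "Q \<longleftrightarrow> ?g"
  note V = adjacentD[OF s]
  note alt = rigid_alternating[OF assms(1)]
  have triple: Q if "adjacent U x y" "\<not> adjacent U y z" "y \<noteq> z" "z \<in> verts U"
     "degree U x = degree U y" "degree U y = degree U z" for x y z
    unfolding Q_def using that V[of x y] by blast
  have sym: "adjacent U x y \<Longrightarrow> adjacent U y x" "\<not> adjacent U x y \<Longrightarrow> \<not> adjacent U y x" for x y
    using adjacent_sym[of U] by blast+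
  have "has_2K2 U \<or> has_C4 U \<or> (\<exists>a b c d e. is_C5 U a b c d e)"
    by (rule nonsplit_obstruction[OF s assms(2)])
  hence Q
  proof (elim disjE exE)
    assume "has_2K2 U"
    then obtain a b c d where *: "adjacent U a b" "adjacent U c d" "a \<noteq> c" "a \<noteq> d" "b \<noteq> c" "b \<noteq> d"
      "\<not> adjacent U a c" "\<not> adjacent U a d" "\<not> adjacent U b c" "\<not> adjacent U b d"
      unfolding has_2K2_def by blast
    have "alternating U a b c d" "alternating U a b d c"
      using * by (auto simp: alternating_def adjacent_sym)
    from alt[OF this(1)] alt[OF this(2)]
    consider "degree U a = degree U b" "degree U b = degree U c"
      | "degree U a = degree U b" "degree U b = degree U d"
      | "degree U c = degree U d" "degree U d = degree U a"
      | "degree U c = degree U d" "degree U d = degree U b" by fastforce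
    thus Q
    proof cases
      case 1
      show Q by (rule triple[of a b c]) (use 1 * V[OF *(1)] V[OF *(2)] in \<open>simp_all add: adjacent_sym\<close>)
    next
      case 2
      show Q by (rule triple[of a b d]) (use 2 * V[OF *(1)] V[OF *(2)] in \<open>simp_all add: adjacent_sym\<close>)
    next
      case 3
      show Q by (rule triple[of c d a]) (use 3 * V[OF *(1)] V[OF *(2)] in \<open>simp_all add: adjacent_sym\<close>)
    next
      case 4
      show Q by (rule triple[of c d b]) (use 4 * V[OF *(1)] V[OF *(2)] in \<open>simp_all add: adjacent_sym\<close>)
    qed
  next
    assume "has_C4 U"
    then obtain a b c d where *: "a \<noteq> c" "b \<noteq> d" "adjacent U a b" "adjacent U b c" "adjacent U c d"
      "adjacent U d a" "\<not> adjacent U a c" "\<not> adjacent U b d"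
      unfolding has_C4_def by blast
    have "alternating U a b c d" "alternating U b c d a"
      using * by (auto simp: alternating_def adjacent_sym)
    from alt[OF this(1)] alt[OF this(2)]
    consider "degree U a = degree U b" "degree U b = degree U c"
      | "degree U a = degree U b" "degree U b = degree U d"
      | "degree U c = degree U d" "degree U d = degree U a"
      | "degree U c = degree U d" "degree U d = degree U b" by fastforce
    thus Q
    proof cases
      case 1
      show Q by (rule triple[of b a c]) (use 1 * V[OF *(3)] V[OF *(5)] in \<open>simp_all add: adjacent_sym\<close>)
    next
      case 2
      show Q by (rule triple[of a b d]) (use 2 * V[OF *(3)] V[OF *(5)] in \<open>simp_all add: adjacent_sym\<close>)
    next
      case 3
      show Q by (rule triple[of d c a]) (use 3 * V[OF *(3)] V[OF *(5)] in \<open>simp_all add: adjacent_sym\<close>)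
    next
      case 4
      show Q by (rule triple[of c d b]) (use 4 * V[OF *(3)] V[OF *(5)] in \<open>simp_all add: adjacent_sym\<close>)
    qed
  next
    fix a b c d e assume "is_C5 U a b c d e"
    hence *: "adjacent U a b" "adjacent U b c" "adjacent U c d" "adjacent U d e" "adjacent U e a"
      "\<not> adjacent U a c" "\<not> adjacent U b d" "\<not> adjacent U c e" "\<not> adjacent U d a" "\<not> adjacent U e b"
      "a \<noteq> c" "b \<noteq> d" "c \<noteq> e" "d \<noteq> a" "e \<noteq> b"
      unfolding is_C5_def by auto
    have "alternating U a b c d" "alternating U b c d e" "alternating U c d e a"
      "alternating U d e a b" "alternating U e a b c"
      using * by (auto simp: alternating_def adjacent_sym)
    note eqs = this[THEN alt]
    consider "degree U a = degree U b" "degree U b = degree U c"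
      | "degree U a = degree U b" "degree U b = degree U d"
      | "degree U a = degree U b" "degree U b = degree U e"
      | "degree U a = degree U c" "degree U c = degree U d"
      | "degree U a = degree U c" "degree U c = degree U e"
      | "degree U a = degree U d" "degree U d = degree U e"
      | "degree U b = degree U c" "degree U c = degree U d"
      | "degree U b = degree U c" "degree U c = degree U e"
      | "degree U b = degree U d" "degree U d = degree U e"
      | "degree U c = degree U d" "degree U d = degree U e"
      using pentagon_three_equal[OF eqs] by blast
    thus Q
    proof cases
      case 1
      show Q by (rule triple[of b a c]) (use 1 * V[OF *(1)] V[OF *(2)] V[OF *(3)] V[OF *(4)] V[OF *(5)] in \<open>simp_all add: adjacent_sym\<close>)
    next
      case 2
      show Q by (rule triple[of a b d]) (use 2 * V[OF *(1)] V[OF *(2)] V[OF *(3)] V[OF *(4)] V[OF *(5)] in \<open>simp_all add: adjacent_sym\<close>)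
    next
      case 3
      show Q by (rule triple[of a b e]) (use 3 * V[OF *(1)] V[OF *(2)] V[OF *(3)] V[OF *(4)] V[OF *(5)] in \<open>simp_all add: adjacent_sym\<close>)
    next
      case 4
      show Q by (rule triple[of c d a]) (use 4 * V[OF *(1)] V[OF *(2)] V[OF *(3)] V[OF *(4)] V[OF *(5)] in \<open>simp_all add: adjacent_sym\<close>)
    next
      case 5
      show Q by (rule triple[of e a c]) (use 5 * V[OF *(1)] V[OF *(2)] V[OF *(3)] V[OF *(4)] V[OF *(5)] in \<open>simp_all add: adjacent_sym\<close>)
    next
      case 6
      show Q by (rule triple[of e d a]) (use 6 * V[OF *(1)] V[OF *(2)] V[OF *(3)] V[OF *(4)] V[OF *(5)] in \<open>simp_all add: adjacent_sym\<close>)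
    next
      case 7
      show Q by (rule triple[of c b d]) (use 7 * V[OF *(1)] V[OF *(2)] V[OF *(3)] V[OF *(4)] V[OF *(5)] in \<open>simp_all add: adjacent_sym\<close>)
    next
      case 8
      show Q by (rule triple[of b c e]) (use 8 * V[OF *(1)] V[OF *(2)] V[OF *(3)] V[OF *(4)] V[OF *(5)] in \<open>simp_all add: adjacent_sym\<close>)
    next
      case 9
      show Q by (rule triple[of d e b]) (use 9 * V[OF *(1)] V[OF *(2)] V[OF *(3)] V[OF *(4)] V[OF *(5)] in \<open>simp_all add: adjacent_sym\<close>)
    next
      case 10
      show Q by (rule triple[of d c e]) (use 10 * V[OF *(1)] V[OF *(2)] V[OF *(3)] V[OF *(4)] V[OF *(5)] in \<open>simp_all add: adjacent_sym\<close>)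
    qed
  qed
  thus ?thesis unfolding Q_def using that by metis
qed

lemma mixed_class_degree_class:
  assumes "rigid U" "D = {v \<in> verts U. degree U v = k}"
    "\<exists>p q. adjacent U p q \<and> degree U p = k \<and> degree U q = k"
    "\<exists>p\<in>verts U. \<exists>q\<in>verts U. p \<noteq> q \<and> \<not> adjacent U p q \<and> degree U p = k \<and> degree U q = k"
  shows "mixed_class U D"
proof unfold_locales
  show s: "simple_graph U" using assms by (simp add: rigid_def)
  show "uncrossable U D (verts U - D)"
    using rigid_edge_count[OF assms(1), of _ "\<lambda>n. n = k"] assms(2)
    by (intro uncrossable_if_edge_count_fixed) auto
  show "\<exists>p\<in>D. \<exists>q\<in>D. adjacent U p q"
    using assms(2,3) adjacentD[OF s] by blast
qed (use assms in auto)

text \<open>Take a degree class that is neither a clique nor stable. The vertices full and empty to it would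
  form the split factor of a decomposition, so there are none, and at most one vertex remains
  outside the class.\<close>

lemma rigid_one_exception:
  assumes "rigid U" "\<not> split_graph U" "\<not> decomposable U"
  obtains k where "\<And>v. v \<in> verts U \<Longrightarrow> degree U v = k"
  | k c where "c \<in> verts U" "degree U c \<noteq> k" "\<And>v. v \<in> verts U - {c} \<Longrightarrow> degree U v = k"
proof -
  have s: "simple_graph U" using assms by (simp add: rigid_def)
  obtain k where k: "\<exists>p q. adjacent U p q \<and> degree U p = k \<and> degree U q = k"
    "\<exists>p\<in>verts U. \<exists>q\<in>verts U. p \<noteq> q \<and> \<not> adjacent U p q \<and> degree U p = k \<and> degree U q = k"
    using rigid_nonsplit_mixed_class[OF assms(1,2)] by blast
  define D where "D = {v \<in> verts U. degree U v = k}"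
  interpret mixed_class U D
    by (rule mixed_class_degree_class[OF assms(1) D_def k])
  let ?R = "verts U - D"
  define K where "K = {x \<in> ?R. full_to U D x}"
  define S where "S = {x \<in> ?R. empty_to U D x}"
  have D_ne: "\<exists>x. x \<in> D" using has_edge by blast
  have KS: "K \<inter> S = {}" using D_ne by (auto simp: K_def S_def full_to_def empty_to_def)
  have "K \<union> S = {}"
  proof (rule ccontr)
    assume ne: "K \<union> S \<noteq> {}"
    have "decomposes U K S (verts U - K - S)"
      unfolding decomposes_def clique_def stable_def
    proof (intro conjI ballI impI)
      show "adjacent U x y" if "x \<in> K" "y \<in> K" "x \<noteq> y" for x y
        using full_adjacent_nonempty[of x y] that KS by (auto simp: K_def S_def)
      show "\<not> adjacent U x y" if "x \<in> S" "y \<in> S" for x y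
        using empty_not_adjacent_empty[of x y] that by (auto simp: S_def)
      show "adjacent U x y" if "x \<in> K" "y \<in> verts U - K - S" for x y
      proof (cases "y \<in> D")
        case True
        thus ?thesis using that(1) by (simp add: K_def full_to_def)
      next
        case False
        hence "y \<in> ?R" "\<not> empty_to U D y" using that(2) by (auto simp: S_def)
        moreover have "x \<in> ?R" "full_to U D x" "y \<noteq> x" using that by (auto simp: K_def)
        ultimately show ?thesis using full_adjacent_nonempty[of y x] adjacent_sym[of U x y] by blast
      qed
      show "\<not> adjacent U x y" if "x \<in> S" "y \<in> verts U - K - S" for x y
      proof (cases "y \<in> D")
        case True
        thus ?thesis using that(1) by (simp add: S_def empty_to_def)
      next
        case False
        hence "y \<in> ?R" "\<not> full_to U D y" using that(2) by (auto simp: K_def)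
        moreover have "x \<in> ?R" "empty_to U D x" using that by (auto simp: S_def)
        ultimately show ?thesis using empty_not_adjacent_mixed[of y x] adjacent_sym[of U x y] by blast
      qed
    qed (use KS in \<open>auto simp: K_def S_def\<close>)
    moreover have "verts U - K - S \<noteq> {}" using D_ne D_sub by (auto simp: K_def S_def)
    ultimately show False using assms(3) decomposable_iff[OF s] ne by blast
  qed
  hence uniq: "b = d" if "b \<in> ?R" "d \<in> ?R" for b d
    using mixed_unique[of b d] that by (auto simp: K_def S_def)
  show ?thesis
  proof (cases "?R = {}")
    case True
    thus ?thesis using that(1)[of k] by (auto simp: D_def)
  next
    case False
    then obtain c where "c \<in> ?R" by blast
    thus ?thesis using that(2)[of c k] uniq by (auto simp: D_def)
  qed
qed

text \<open>An isolated or a dominating vertex is a split factor by itself.\<close>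

lemma indecomposable_degree_bounds:
  assumes "simple_graph U" "\<not> decomposable U" "card (verts U) \<ge> 2" "v \<in> verts U"
  shows "degree U v \<ge> 1" "degree U v + 2 \<le> card (verts U)"
proof -
  have ge1: "degree H v \<ge> 1" if "simple_graph H" "\<not> decomposable H" "card (verts H) \<ge> 2" "v \<in> verts H"
    for H :: "'a ugraph"
  proof (rule ccontr)
    assume "\<not> degree H v \<ge> 1"
    hence "card (nbhd H v) = 0" by (simp add: degree_nbhd)
    hence "nbhd H v = {}" using finite_nbhd[OF that(1)] by simp
    hence no: "\<not> adjacent H v u" for u using that(1) by (auto simp: in_nbhd[symmetric])
    have "decomposes H {} {v} (verts H - {v})"
      using no that(4) by (auto simp: decomposes_def clique_def stable_def)
    moreover have "verts H - {v} \<noteq> {}"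
    proof
      assume "verts H - {v} = {}"
      hence "verts H \<subseteq> {v}" by blast
      thus False using that(3) card_mono[of "{v}" "verts H"] by simp
    qed
    ultimately show False using that(2) decomposable_iff[OF that(1)] by blast
  qed
  show "degree U v \<ge> 1" by (rule ge1[OF assms])
  have "degree (co U) v \<ge> 1"
    using ge1[OF simple_co[OF assms(1)]] assms decomposable_co[OF assms(1)] by simp
  thus "degree U v + 2 \<le> card (verts U)"
    using degree_co[OF assms(1,4)] by simp
qed

section \<open>Counting edges\<close>

lemma degree_eq_card_edges:
  assumes "simple_graph G"
  shows "card {e \<in> edges G. v \<in> e} = degree G v"
proof -
  have "{e \<in> edges G. v \<in> e} = (\<lambda>u. {v, u}) ` nbhd G v"
  proof (intro equalityI subsetI)
    fix e assume e: "e \<in> {e \<in> edges G. v \<in> e}"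
    hence "e \<in> edges G" by simp
    then obtain x y where xy: "e = {x, y}" "adjacent G x y" by (rule edgesE[OF assms])
    with e show "e \<in> (\<lambda>u. {v, u}) ` nbhd G v"
      using assms by (auto simp: in_nbhd adjacent_sym insert_commute)
  next
    fix e assume "e \<in> (\<lambda>u. {v, u}) ` nbhd G v"
    thus "e \<in> {e \<in> edges G. v \<in> e}" by (auto simp: nbhd_def adjacent_def)
  qed
  moreover have "inj_on (\<lambda>u. {v, u}) (nbhd G v)"
    by (auto simp: inj_on_def doubleton_eq_iff)
  ultimately show ?thesis by (simp add: card_image degree_nbhd)
qed

lemma handshake:
  assumes "simple_graph G"
  shows "(\<Sum>v\<in>verts G. degree G v) = 2 * card (edges G)"
proof -
  have "card {v \<in> verts G. v \<in> e} = 2" if "e \<in> edges G" for e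
  proof -
    have "e \<subseteq> verts G" "card e = 2" using assms that by (auto simp: simple_graph_def)
    moreover from this have "{v \<in> verts G. v \<in> e} = e" by blast
    ultimately show ?thesis by simp
  qed
  hence "(\<Sum>v\<in>verts G. card {e \<in> edges G. v \<in> e}) = 2 * card (edges G)"
    by (intro sum_multicount finite_verts finite_edges assms) auto
  thus ?thesis using degree_eq_card_edges[OF assms] by simp
qed

lemma double_count:
  assumes "simple_graph G" "A \<subseteq> verts G" "B \<subseteq> verts G"
    "\<And>a. a \<in> A \<Longrightarrow> card (nbhd G a \<inter> B) = p" "\<And>b. b \<in> B \<Longrightarrow> card (nbhd G b \<inter> A) = q"
  shows "card A * p = card B * q"
proof -
  have fin: "finite A" "finite B"
    using assms(1-3) finite_verts finite_subset by metis+
  have "{i \<in> A. adjacent G i j} = nbhd G j \<inter> A" for j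
    using assms(1) by (auto simp: in_nbhd adjacent_sym)
  hence "(\<Sum>a\<in>A. card {b \<in> B. adjacent G a b}) = q * card B"
    using assms(5) by (intro sum_multicount fin) auto
  moreover have "{b \<in> B. adjacent G a b} = nbhd G a \<inter> B" for a
    using assms(1) by (auto simp: in_nbhd)
  ultimately show ?thesis using assms(4) by (simp add: mult.commute)
qed

section \<open>Replacing an induced subgraph\<close>

definition splice :: "'a ugraph \<Rightarrow> 'a ugraph \<Rightarrow> 'a ugraph" where
  "splice G h = graph_of (verts G)
     (\<lambda>x y. if x \<in> verts h \<and> y \<in> verts h then adjacent h x y else adjacent G x y)"

lemma verts_splice [simp]: "verts (splice G h) = verts G"
  by (simp add: splice_def)

lemma simple_splice: "simple_graph G \<Longrightarrow> simple_graph (splice G h)"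
  by (simp add: splice_def simple_graph_of finite_verts)

lemma adjacent_splice:
  assumes "simple_graph G" "simple_graph h" "verts h \<subseteq> verts G"
  shows "adjacent (splice G h) x y \<longleftrightarrow>
    (if x \<in> verts h \<and> y \<in> verts h then adjacent h x y else adjacent G x y)"
  using assms(3) adjacentD[OF assms(1), of x y] adjacentD[OF assms(2), of x y]
  unfolding splice_def adjacent_graph_of by (auto simp: adjacent_sym)

lemma degree_induced:
  assumes "simple_graph G" "W \<subseteq> verts G" "v \<in> W"
  shows "degree (induced G W) v = card (nbhd G v \<inter> W)"
proof -
  have "nbhd (induced G W) v = nbhd G v \<inter> W"
    using assms by (auto simp: in_nbhd simple_induced adjacent_induced)
  thus ?thesis by (simp add: degree_nbhd)
qed

lemma induced_splice:
  assumes "simple_graph G" "simple_graph h" "verts h \<subseteq> verts G"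
  shows "induced (splice G h) (verts h) = h"
  by (rule simple_graph_eqI)
    (auto simp: simple_induced simple_splice assms adjacent_induced adjacent_splice[OF assms]
      dest: adjacentD[OF assms(2)])

lemma same_degrees_splice:
  assumes "simple_graph G" "W \<subseteq> verts G" "same_degrees (induced G W) h"
  shows "same_degrees G (splice G h)"
  unfolding same_degrees_def
proof (intro conjI ballI)
  have h: "simple_graph h" "verts h = W" using assms(3) by (auto simp: same_degrees_def)
  let ?H = "splice G h"
  have sH: "simple_graph ?H" by (simp add: simple_splice assms(1))
  note adj = adjacent_splice[OF assms(1) h(1), unfolded h(2), OF assms(2)]
  fix v assume v: "v \<in> verts G"
  show "degree ?H v = degree G v"
  proof (cases "v \<in> W")
    case True
    have "nbhd ?H v = nbhd h v \<union> (nbhd G v - W)"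
      using True adjacentD[OF h(1)] h(2)
      by (auto simp: in_nbhd[OF sH] in_nbhd[OF h(1)] in_nbhd[OF assms(1)] adj split: if_splits)
    moreover have "nbhd h v \<subseteq> W" using nbhd_subset[of h v] h(2) by simp
    moreover from this have "card (nbhd h v \<union> (nbhd G v - W)) = card (nbhd h v) + card (nbhd G v - W)"
      using finite_nbhd[OF h(1)] finite_nbhd[OF assms(1)] by (intro card_Un_disjoint) auto
    ultimately have "degree ?H v = degree h v + card (nbhd G v - W)"
      by (simp add: degree_nbhd)
    also have "degree h v = card (nbhd G v \<inter> W)"
      using assms(3) True degree_induced[OF assms(1,2) True] by (simp add: same_degrees_def)
    also have "\<dots> + card (nbhd G v - W) = degree G v"
      unfolding degree_nbhd by (rule card_Int_Diff[OF finite_nbhd[OF assms(1)], symmetric])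
    finally show ?thesis .
  next
    case False
    hence "nbhd ?H v = nbhd G v"
      by (auto simp: in_nbhd[OF sH] in_nbhd[OF assms(1)] adj)
    thus ?thesis by (simp add: degree_nbhd)
  qed
qed (simp_all add: simple_splice assms(1))

lemma edge_count_induced: "A \<subseteq> W \<Longrightarrow> edge_count (induced G W) A = edge_count G A"
  unfolding edge_count_def induced_def by (intro arg_cong[of _ _ card]) auto

text \<open>A realization of the degrees of an induced subgraph extends to a realization of the degrees of
  the whole graph. If every isomorphism that arises in this way fixes \<open>A\<close> setwise, the number of
  edges inside \<open>A\<close> is an invariant of the induced subgraph as well.\<close>

lemma uncrossable_induced:
  assumes "rigid U" "W \<subseteq> verts U" "A \<subseteq> W"
    and fixed: "\<And>H f. same_degrees U H \<Longrightarrow> graph_iso f U H \<Longrightarrow>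
      (\<And>v. v \<in> verts U \<Longrightarrow> f v \<in> verts U) \<Longrightarrow>
      (\<And>v. v \<in> verts U \<Longrightarrow> degree U (f v) = degree U v) \<Longrightarrow>
      (\<And>x y. x \<in> verts U - W \<Longrightarrow> adjacent H x y \<longleftrightarrow> adjacent U x y) \<Longrightarrow> f ` A = A"
  shows "uncrossable (induced U W) A (W - A)"
proof (rule uncrossable_if_edge_count_fixed)
  fix h assume h: "same_degrees (induced U W) h"
  have s: "simple_graph U" using assms(1) by (simp add: rigid_def)
  from h have sh: "simple_graph h" "verts h = W" by (auto simp: same_degrees_def)
  note adj = adjacent_splice[OF s sh(1), unfolded sh(2), OF assms(2)]
  let ?H = "splice U h"
  have H: "same_degrees U ?H" by (rule same_degrees_splice[OF s assms(2) h])
  obtain f where f: "graph_iso f U ?H" "\<And>v. v \<in> verts U \<Longrightarrow> f v \<in> verts U"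
    "\<And>v. v \<in> verts U \<Longrightarrow> degree U (f v) = degree U v" "inj_on f (verts U)" "f ` verts U = verts U"
    by (rule rigid_iso[OF assms(1) H], rule that)
  have "f ` A = A" by (rule fixed[OF H f(1-3)]) (auto simp: adj)
  hence "edge_count ?H A = edge_count U A"
    using graph_iso_edge_count[OF s simple_splice[OF s] f(1), of A] assms(2,3) by auto
  moreover have "edge_count ?H A = edge_count h A"
    using edge_count_induced[of A W ?H] induced_splice[OF s sh(1)] sh(2) assms(2,3) by simp
  ultimately show "edge_count h A = edge_count (induced U W) A"
    using edge_count_induced[OF assms(3), of U] by simp
qed auto

section \<open>One exceptional degree\<close>

text \<open>A full vertex and an empty one of equal degree cannot coexist, because the former is adjacent to
  \<open>D\<close> and to the other full vertices, the latter to full vertices only. In the absence of empty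
  vertices a full vertex is dominating, and in the absence of full ones an empty vertex is
  isolated. Hence only the single mixed vertex is left.\<close>

lemma (in mixed_class) complement_singleton:
  assumes "\<And>v. v \<in> verts G - D \<Longrightarrow> degree G v = k" "k \<ge> 1" "k + 2 \<le> card (verts G)" "verts G - D \<noteq> {}"
  obtains y where "verts G - D = {y}"
proof -
  let ?R = "verts G - D"
  define F where "F = {x \<in> ?R. full_to G D x}"
  have fin: "finite (verts G)" "finite D" "finite F"
    using simple D_sub by (auto simp: F_def finite_verts intro: finite_subset)
  obtain p q where pq: "p \<in> D" "q \<in> D" "p \<noteq> q" using has_nonedge by blast
  have card_D: "card D \<ge> 2"
    using card_mono[OF fin(2), of "{p, q}"] pq by simp
  have full_deg: "card D + card F - 1 \<le> k" if f: "f \<in> F" for f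
  proof -
    have "card (D \<union> (F - {f})) \<le> degree G f"
    proof (rule degree_ge_card[OF simple])
      fix u assume u: "u \<in> D \<union> (F - {f})"
      show "adjacent G f u"
      proof (cases "u \<in> D")
        case True
        thus ?thesis using f by (auto simp: F_def full_to_def)
      next
        case False
        hence "u \<in> F" "u \<noteq> f" using u by auto
        moreover have "\<not> empty_to G D f" using f pq by (auto simp: F_def full_to_def empty_to_def)
        ultimately show ?thesis using full_adjacent_nonempty[of f u] f by (auto simp: F_def)
      qed
    qed
    also have "card (D \<union> (F - {f})) = card D + (card F - 1)"
      using fin f by (subst card_Un_disjoint) (auto simp: F_def)
    finally show ?thesis using assms(1)[of f] f fin card_gt_0_iff[of F] by (auto simp: F_def)
  qed
  have empty_deg: "k \<le> card F" if e: "e \<in> ?R" "empty_to G D e" for e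
  proof -
    have "degree G e \<le> card F"
    proof (rule degree_le_card[OF fin(3)])
      fix u assume u: "u \<in> verts G" "adjacent G e u"
      hence "u \<in> ?R" using e by (auto simp: empty_to_def)
      thus "u \<in> F" using empty_not_adjacent_mixed[of u e] e u adjacent_sym[of G e u] by (auto simp: F_def)
    qed
    thus ?thesis using assms(1) e by simp
  qed
  have noF: "F = {}"
  proof (rule ccontr)
    assume "F \<noteq> {}"
    then obtain f where f: "f \<in> F" by blast
    have no_empty: "\<not> empty_to G D e" if "e \<in> ?R" for e
      using full_deg[OF f] empty_deg[OF that] card_D by linarith
    have "card (verts G - {f}) \<le> degree G f"
    proof (rule degree_ge_card[OF simple])
      fix u assume u: "u \<in> verts G - {f}"
      show "adjacent G f u"
        using full_adjacent_nonempty[of u f] no_empty[of u] u f adjacent_sym[of G f u]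
        by (cases "u \<in> D") (auto simp: F_def full_to_def)
    qed
    moreover have "f \<in> verts G" "degree G f = k" using f assms(1) by (auto simp: F_def)
    ultimately show False using assms(3) fin by simp
  qed
  hence "\<not> empty_to G D e" if "e \<in> ?R" for e
    using empty_deg[OF that] assms(2) by auto
  hence "b = d" if "b \<in> ?R" "d \<in> ?R" for b d
    using mixed_unique[of b d] that noF by (auto simp: F_def)
  thus ?thesis using that assms(4) by blast
qed

lemma clique_or_stable_or_mixed:
  obtains "\<exists>p\<in>A. \<exists>q\<in>A. adjacent G p q" "\<exists>p\<in>A. \<exists>q\<in>A. p \<noteq> q \<and> \<not> adjacent G p q"
  | "\<And>p q. p \<in> A \<Longrightarrow> q \<in> A \<Longrightarrow> p \<noteq> q \<Longrightarrow> adjacent G p q"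
  | "\<And>p q. p \<in> A \<Longrightarrow> q \<in> A \<Longrightarrow> \<not> adjacent G p q"
  by blast

lemma sum_degree_one_exception:
  assumes "finite V" "c \<in> V" "\<And>v. v \<in> V - {c} \<Longrightarrow> d v = k"
  shows "(\<Sum>v\<in>V. d v) = d c + (card V - 1) * (k :: nat)"
  using assms by (simp add: sum.remove)

lemma card_nbhd_Diff1:
  assumes "simple_graph G"
  shows "card (nbhd G v - {x}) = degree G v - of_bool (adjacent G v x)"
  using assms by (simp add: degree_nbhd card_Diff_singleton_if in_nbhd)

lemma two_elements:
  assumes "card X \<ge> 2"
  obtains x y where "x \<in> X" "y \<in> X" "x \<noteq> y"
proof -
  obtain Y where "Y \<subseteq> X" "card Y = 2" using obtain_subset_with_card_n[OF assms] by blast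
  thus ?thesis using that by (auto simp: card_2_iff)
qed

text \<open>A rigid graph in which exactly one vertex \<open>c\<close> has a degree other than \<open>k\<close>. As every isomorphism
  fixes \<open>c\<close>, it fixes the neighbourhood \<open>A\<close> of \<open>c\<close>, so \<open>A\<close> and its complement \<open>B\<close> in the
  remaining graph are again free of crossings. There, the vertices of \<open>A\<close> have degree \<open>k - 1\<close>
  and those of \<open>B\<close> have degree \<open>k\<close>, and the analysis of mixed classes applies a second time.\<close>

locale exceptional_vertex =
  fixes U :: "'a ugraph" and c :: 'a and k :: nat
  assumes rig: "rigid U"
    and c_in: "c \<in> verts U"
    and c_deg: "degree U c \<noteq> k"
    and other_deg: "\<And>v. v \<in> verts U - {c} \<Longrightarrow> degree U v = k"
    and k_ge: "2 \<le> k" and k_le: "k + 3 \<le> card (verts U)"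
    and c_ge: "1 \<le> degree U c" and c_le: "degree U c + 2 \<le> card (verts U)"
begin

lemma simple: "simple_graph U"
  using rig by (simp add: rigid_def)

lemma exceptional_vertex_co: "exceptional_vertex (co U) c (card (verts U) - 1 - k)"
proof unfold_locales
  show "rigid (co U)" using rig by (rule rigid_co)
  show "degree (co U) c \<noteq> card (verts U) - 1 - k"
    using degree_co[OF simple c_in] c_deg k_le c_le by linarith
  show "degree (co U) v = card (verts U) - 1 - k" if "v \<in> verts (co U) - {c}" for v
    using degree_co[OF simple, of v] other_deg[of v] that by simp
  show "1 \<le> degree (co U) c" "degree (co U) c + 2 \<le> card (verts (co U))"
    using degree_co[OF simple c_in] c_ge c_le by auto
qed (use c_in k_ge k_le in auto)

definition A where "A = nbhd U c"
definition B where "B = verts U - {c} - A"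

lemma A_sub: "A \<subseteq> verts U - {c}"
  using adjacentD[OF simple] adjacent_irrefl[OF simple] by (auto simp: A_def in_nbhd simple)

lemma in_A: "v \<in> A \<longleftrightarrow> adjacent U v c"
  by (simp add: A_def in_nbhd simple adjacent_sym)

lemma fin: "finite (verts U)" "finite A" "finite B"
  by (simp_all add: A_def B_def finite_verts finite_nbhd simple)

lemma card_A: "card A = degree U c"
  by (simp add: A_def degree_nbhd)

lemma card_B: "card B + card A + 1 = card (verts U)"
  using card_Diff_subset[OF fin(2) A_sub] card_mono[OF _ A_sub] fin c_in card_gt_0_iff[of "verts U"]
  by (auto simp: B_def)

lemma iso_fixes_c:
  assumes "graph_iso f U H" "\<And>v. v \<in> verts U \<Longrightarrow> f v \<in> verts U"
    "\<And>v. v \<in> verts U \<Longrightarrow> degree U (f v) = degree U v"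
  shows "f c = c"
  using assms(2,3)[OF c_in] c_deg other_deg[of "f c"] by auto

lemma uncrossable_A: "uncrossable (induced U (verts U - {c})) A B"
  unfolding B_def
proof (rule uncrossable_induced[OF rig _ A_sub])
  fix H f
  assume *: "same_degrees U H" "graph_iso f U H" "\<And>v. v \<in> verts U \<Longrightarrow> f v \<in> verts U"
    "\<And>v. v \<in> verts U \<Longrightarrow> degree U (f v) = degree U v"
    "\<And>x y. x \<in> verts U - (verts U - {c}) \<Longrightarrow> adjacent H x y = adjacent U x y"
  have "f ` nbhd U c = nbhd H (f c)" using graph_iso_nbhd[OF *(2) c_in] by simp
  also have "f c = c" by (rule iso_fixes_c[OF *(2-4)])
  also have "nbhd H c = nbhd U c" using *(1,5) c_in by (auto simp: nbhd_def same_degrees_def)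
  finally show "f ` A = A" by (simp add: A_def)
qed auto

lemma degree_H: "v \<in> verts U - {c} \<Longrightarrow>
    degree (induced U (verts U - {c})) v = k - of_bool (v \<in> A)"
proof -
  assume v: "v \<in> verts U - {c}"
  have "nbhd U v \<inter> (verts U - {c}) = nbhd U v - {c}" using nbhd_subset[of U v] by blast
  thus ?thesis
    using degree_induced[OF simple _ v] card_nbhd_Diff1[OF simple, of v c] other_deg[OF v]
    by (auto simp: in_A)
qed

lemma simple_H: "simple_graph (induced U (verts U - {c}))"
  by (rule simple_induced[OF simple]) auto

text \<open>An isomorphism now fixes \<open>x\<close> as well, so the argument can be repeated a third time, on the
  neighbours \<open>A1\<close> and the non-neighbours \<open>A0\<close> of \<open>x\<close> in \<open>A\<close>. For \<open>k\<close> at least three every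
  combination of clique, stable and mixed leads to a contradiction: by parity of the degree sum,
  by comparing degrees, or by counting the edges between \<open>A1\<close> and \<open>A0\<close>.\<close>

lemma unique_nonneighbour:
  assumes "B = {x}"
  shows "k = 2"
proof (rule ccontr)
  assume "k \<noteq> 2"
  hence k3: "k \<ge> 3" using k_ge by simp
  have "x \<in> B" using assms by simp
  hence x: "x \<in> verts U" "x \<noteq> c" "x \<notin> A" by (auto simp: B_def)
  hence xc: "\<not> adjacent U x c" "\<not> adjacent U c x" using in_A adjacent_sym[of U] by blast+
  have "A = verts U - {c} - B" using A_sub by (auto simp: B_def)
  hence A: "A = verts U - {c, x}" using assms by auto
  define A1 where "A1 = nbhd U x"
  define A0 where "A0 = A - A1"
  have A1: "A1 \<subseteq> A"
  proof
    fix v assume "v \<in> A1"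
    hence "adjacent U x v" by (simp add: A1_def in_nbhd simple)
    thus "v \<in> A" using xc adjacentD[OF simple, of x v] unfolding A by auto
  qed
  have in_A1: "v \<in> A1 \<longleftrightarrow> adjacent U v x" for v by (simp add: A1_def in_nbhd simple adjacent_sym)
  have cA1: "card A1 = k" using other_deg[of x] x by (simp add: A1_def degree_nbhd)
  have n: "card (verts U) = card A + 2" using card_B assms by simp
  have finA: "finite A1" "finite A0" using fin(2) A1 by (auto simp: A0_def intro: finite_subset)
  have cA0: "card A0 + k = card A" using A1 finA cA1 card_mono[OF fin(2) A1] by (simp add: A0_def card_Diff_subset)
  define g where "g = induced U A"
  have sg: "simple_graph g" unfolding g_def by (rule simple_induced[OF simple]) (use A in auto)
  have Vg: "verts g = A" by (simp add: g_def)
  have deg_g: "degree g v = k - 1 - of_bool (v \<in> A1)" if "v \<in> A" for v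
  proof -
    have eq: "nbhd U v \<inter> A = nbhd U v - {c} - {x}" using nbhd_subset[of U v] A by blast
    have v: "v \<in> verts U - {c}" "A \<subseteq> verts U" using that A by auto
    have "adjacent U v c" using that by (simp add: in_A)
    hence 1: "card (nbhd U v - {c}) = k - 1"
      using card_nbhd_Diff1[OF simple, of v c] other_deg[OF v(1)] by simp
    have "x \<in> nbhd U v - {c} \<longleftrightarrow> v \<in> A1" using x(2) by (simp add: in_nbhd simple in_A1)
    hence "card (nbhd U v - {c} - {x}) = k - 1 - of_bool (v \<in> A1)"
      using 1 by (simp add: card_Diff_singleton_if)
    thus ?thesis using degree_induced[OF simple v(2) that] eq by (simp add: g_def)
  qed
  have deg1: "degree g v = k - 2" if "v \<in> A1" for v using deg_g[of v] that A1 by auto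
  have deg0: "degree g v = k - 1" if "v \<in> A0" for v using deg_g[of v] that by (auto simp: A0_def)
  have Vg1: "verts g - A1 = A0" and Vg0: "verts g - A0 = A1" using Vg A1 by (auto simp: A0_def)
  have sub: "A1 \<subseteq> verts g" "A0 \<subseteq> verts g" using Vg A1 by (auto simp: A0_def)
  have uncr: "uncrossable g A1 A0"
    unfolding g_def A0_def
  proof (rule uncrossable_induced[OF rig _ A1])
    show "A \<subseteq> verts U" using A by blast
    fix H f
    assume *: "same_degrees U H" "graph_iso f U H" "\<And>v. v \<in> verts U \<Longrightarrow> f v \<in> verts U"
      "\<And>v. v \<in> verts U \<Longrightarrow> degree U (f v) = degree U v"
      "\<And>x y. x \<in> verts U - A \<Longrightarrow> adjacent H x y = adjacent U x y"
    have fc: "f c = c" by (rule iso_fixes_c[OF *(2-4)])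
    \<comment> \<open>\<open>x\<close> is the only vertex other than \<open>c\<close> not adjacent to \<open>c\<close>\<close>
    have "\<not> adjacent H (f c) (f x)" using *(2) x(1) xc c_in by (auto simp: graph_iso_def)
    hence "\<not> adjacent U c (f x)" using *(5)[of c] c_in A fc by auto
    moreover have "f x \<noteq> c"
      using *(2) x c_in fc unfolding graph_iso_def bij_betw_def inj_on_def by metis
    ultimately have "f x \<in> B" using *(3)[OF x(1)] by (auto simp: B_def A_def in_nbhd simple)
    hence fx: "f x = x" using assms by simp
    have "f ` nbhd U x = nbhd H x" using graph_iso_nbhd[OF *(2) x(1)] fx by simp
    also have "\<dots> = nbhd U x" using *(1) *(5)[of x] x A by (auto simp: nbhd_def same_degrees_def)
    finally show "f ` A1 = A1" by (simp add: A1_def)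
  qed
  have nb: "nbhd g v \<subseteq> A1 \<union> A0" for v using nbhd_subset[of g v] Vg by (auto simp: A0_def)
  show False
  proof (rule clique_or_stable_or_mixed[of A1 g])
    assume mixed: "\<exists>p\<in>A1. \<exists>q\<in>A1. adjacent g p q" "\<exists>p\<in>A1. \<exists>q\<in>A1. p \<noteq> q \<and> \<not> adjacent g p q"
    interpret M: mixed_class g A1
      by unfold_locales (use sg sub deg1 uncr mixed Vg1 in \<open>simp_all only: refl\<close>)
    obtain y where "verts g - A1 = {y}"
    proof (rule M.complement_singleton[of "k - 1"])
      show "degree g v = k - 1" if "v \<in> verts g - A1" for v using deg0 that Vg1 by simp
      have "A0 \<noteq> {}" using cA0 k_le n by auto
      thus "verts g - A1 \<noteq> {}" using Vg by (simp add: A0_def)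
    qed (use k3 k_le n Vg that in auto)
    hence "card A = k + 1" using cA0 Vg by (simp add: A0_def)
    hence "(\<Sum>v\<in>verts U. degree U v) = k + 1 + (k + 2) * k"
      using sum_degree_one_exception[OF fin(1) c_in other_deg] n card_A by simp
    hence "2 * card (edges U) = k * (k + 3) + 1" using handshake[OF simple] by (simp add: algebra_simps)
    moreover have "even (k * (k + 3))" by auto
    ultimately show False by presburger
  next
    assume clique: "\<And>p q. p \<in> A1 \<Longrightarrow> q \<in> A1 \<Longrightarrow> p \<noteq> q \<Longrightarrow> adjacent g p q"
    obtain a where a: "a \<in> A1" using cA1 k3 by fastforce
    have "card (A1 - {a}) \<le> degree g a"
      by (rule degree_ge_card[OF sg]) (use clique a in auto)
    thus False using deg_g[of a] a A1 cA1 finA k3 by auto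
  next
    assume stable: "\<And>p q. p \<in> A1 \<Longrightarrow> q \<in> A1 \<Longrightarrow> \<not> adjacent g p q"
    have nb1: "nbhd g a \<subseteq> A0" if "a \<in> A1" for a
      using nb[of a] stable that by (auto simp: in_nbhd sg)
    have d1: "card (nbhd g a \<inter> A0) = k - 2" if "a \<in> A1" for a
      using nb1[OF that] deg_g[of a] that A1 by (auto simp: degree_nbhd Int_absorb2)
    show False
    proof (rule clique_or_stable_or_mixed[of A0 g])
      assume mixed: "\<exists>p\<in>A0. \<exists>q\<in>A0. adjacent g p q" "\<exists>p\<in>A0. \<exists>q\<in>A0. p \<noteq> q \<and> \<not> adjacent g p q"
      interpret M: mixed_class g A0
        by unfold_locales (use sg sub deg0 uncr uncrossable_sym[of g A1 A0] mixed Vg0 in \<open>simp_all only: refl\<close>)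
      obtain y where "verts g - A0 = {y}"
      proof (rule M.complement_singleton[of "k - 2"])
        show "degree g v = k - 2" if "v \<in> verts g - A0" for v
          using deg1 that Vg0 by simp
        show "verts g - A0 \<noteq> {}" using Vg0 cA1 k3 by auto
      qed (use k3 k_le n Vg that in auto)
      hence "card A1 = 1" using Vg0 by simp
      thus False using cA1 k3 by simp
    next
      assume clique: "\<And>p q. p \<in> A0 \<Longrightarrow> q \<in> A0 \<Longrightarrow> p \<noteq> q \<Longrightarrow> adjacent g p q"
      have d0: "card (nbhd g x \<inter> A1) = k - card A0 \<and> card A0 \<le> k" if "x \<in> A0" for x
      proof -
        have "A0 - {x} \<subseteq> nbhd g x" 
        proof
          fix y assume "y \<in> A0 - {x}"
          hence "y \<in> A0" "x \<noteq> y" by auto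
          thus "y \<in> nbhd g x" using clique[OF that, of y] by (simp add: in_nbhd sg)
        qed
        moreover have "x \<notin> nbhd g x" by (simp add: in_nbhd sg adjacent_irrefl)
        ultimately have "nbhd g x = (A0 - {x}) \<union> (nbhd g x \<inter> A1)" using nb[of x] by blast
        moreover have "card ((A0 - {x}) \<union> (nbhd g x \<inter> A1)) = card (A0 - {x}) + card (nbhd g x \<inter> A1)"
          using finA by (intro card_Un_disjoint) (auto simp: A0_def)
        ultimately have "degree g x = card A0 - 1 + card (nbhd g x \<inter> A1)"
          using that finA by (simp add: degree_nbhd)
        moreover have "degree g x = k - 1" using deg_g[of x] that by (simp add: A0_def)
        moreover have "card A0 > 0" using that finA card_gt_0_iff by blast
        ultimately show ?thesis using k3 by linarith
      qed
      have "A0 \<noteq> {}" using cA0 k_le n by auto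
      then obtain x where "x \<in> A0" by blast
      hence le: "card A0 \<le> k" using d0 by blast
      have "card A1 * (k - 2) = card A0 * (k - card A0)"
        by (rule double_count[OF sg]) (use d0 d1 A1 Vg in \<open>auto simp: A0_def\<close>)
      hence eq: "k * (k - 2) = card A0 * (k - card A0)" by (simp add: cA1)
      have "0 \<le> (2 * int (card A0) - int k)\<^sup>2" by simp
      hence "4 * (int (card A0) * (int k - int (card A0))) \<le> int k * int k"
        by (simp add: power2_eq_square algebra_simps)
      moreover have "int k * (int k - 2) = int (card A0) * (int k - int (card A0))"
        using eq le k3 by (metis (no_types) of_nat_diff of_nat_mult of_nat_numeral k_ge)
      ultimately have "int k * (4 * (int k - 2)) \<le> int k * int k" by (simp add: algebra_simps)
      hence "4 * (int k - 2) \<le> int k" using k3 by (simp add: mult_le_cancel_left)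
      thus False using k3 by simp
    next
      assume stable0: "\<And>p q. p \<in> A0 \<Longrightarrow> q \<in> A0 \<Longrightarrow> \<not> adjacent g p q"
      have u: "uncrossed g A1 A0" using uncr same_degrees_refl[OF sg] by (simp add: uncrossable_def)
      have same: "b = d" if "a \<in> A1" "a' \<in> A1" "a \<noteq> a'" "b \<in> nbhd g a" "d \<in> nbhd g a'" for a a' b d
      proof (rule ccontr)
        assume "b \<noteq> d"
        have "b \<in> A0" "d \<in> A0" using that nb1 by auto
        from uncrossed_nonedge[OF u that(1,2) this that(3) \<open>b \<noteq> d\<close> stable[OF that(1,2)] stable0[OF this]]
        show False using that by (auto simp: in_nbhd sg)
      qed
      have ne: "nbhd g a \<noteq> {}" if "a \<in> A1" for a using d1[OF that] k3 by auto
      obtain a1 a2 where a12: "a1 \<in> A1" "a2 \<in> A1" "a1 \<noteq> a2"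
        using two_elements[of A1] cA1 k_ge by metis
      obtain x1 where x1: "x1 \<in> nbhd g a1" using ne a12 by blast
      have "adjacent g x1 a" if a: "a \<in> A1" for a
      proof (cases "a = a1")
        case True thus ?thesis using x1 by (simp add: in_nbhd sg adjacent_sym)
      next
        case False
        obtain d where "d \<in> nbhd g a" using ne[OF a] by blast
        thus ?thesis using same[OF a12(1) a _ x1] False by (auto simp: in_nbhd sg adjacent_sym)
      qed
      hence "card A1 \<le> degree g x1" by (intro degree_ge_card[OF sg]) auto
      moreover have "degree g x1 = k - 1" using deg_g[of x1] nb1[OF a12(1)] x1 by (auto simp: A0_def)
      ultimately show False using cA1 k3 by simp
    qed
  qed
qed

text \<open>The degree conditions leave a single vertex outside the mixed class \<open>A\<close>.\<close>

lemma mixed_neighbourhood: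
  assumes "\<exists>p\<in>A. \<exists>q\<in>A. adjacent U p q" "\<exists>p\<in>A. \<exists>q\<in>A. p \<noteq> q \<and> \<not> adjacent U p q"
  shows "k = 2 \<and> degree U c + 2 = card (verts U)"
proof -
  let ?H = "induced U (verts U - {c})"
  have eq: "verts ?H - A = B" by (simp add: B_def)
  have mixed: "\<exists>p\<in>A. \<exists>q\<in>A. adjacent ?H p q" "\<exists>p\<in>A. \<exists>q\<in>A. p \<noteq> q \<and> \<not> adjacent ?H p q"
    using assms A_sub by (fastforce simp: adjacent_induced)+
  have sub: "A \<subseteq> verts ?H" using A_sub by simp
  have degA: "degree ?H v = k - 1" if "v \<in> A" for v using degree_H[of v] that A_sub by auto
  interpret M: mixed_class ?H A
    by unfold_locales (use simple_H sub degA uncrossable_A mixed eq in \<open>simp_all only: refl\<close>)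
  obtain x where "verts ?H - A = {x}"
  proof (rule M.complement_singleton[of k])
    show "degree ?H v = k" if "v \<in> verts ?H - A" for v using degree_H[of v] that by auto
    have "card B \<noteq> 0" using card_B card_A c_le by linarith
    thus "verts ?H - A \<noteq> {}" using eq by auto
    show "k + 2 \<le> card (verts ?H)" using k_le c_in fin by simp
  qed (use k_ge that in auto)
  hence B: "B = {x}" using eq by simp
  show ?thesis using unique_nonneighbour[OF B] card_B card_A B by simp
qed

lemma mixed_non_neighbourhood:
  assumes "\<exists>p\<in>B. \<exists>q\<in>B. adjacent U p q" "\<exists>p\<in>B. \<exists>q\<in>B. p \<noteq> q \<and> \<not> adjacent U p q"
  shows "k + 3 = card (verts U) \<and> degree U c = 1"
proof -
  interpret C: exceptional_vertex "co U" c "card (verts U) - 1 - k" by (rule exceptional_vertex_co)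
  have CA: "C.A = B"
    unfolding C.A_def B_def A_def using c_in adjacentD[OF simple]
    by (auto simp: in_nbhd simple simple_co adjacent_co)
  have Bsub: "B \<subseteq> verts U" by (auto simp: B_def)
  have "card (verts U) - 1 - k = 2 \<and> degree (co U) c + 2 = card (verts (co U))"
  proof (rule C.mixed_neighbourhood)
    show "\<exists>p\<in>C.A. \<exists>q\<in>C.A. adjacent (co U) p q"
      using assms(2) Bsub unfolding CA adjacent_co by blast
    show "\<exists>p\<in>C.A. \<exists>q\<in>C.A. p \<noteq> q \<and> \<not> adjacent (co U) p q"
      using assms(1) adjacentD(3)[OF simple] unfolding CA adjacent_co by blast
  qed
  thus ?thesis using degree_co[OF simple c_in] k_le c_le c_ge by auto
qed

text \<open>If \<open>A\<close> is a clique and \<open>B\<close> is stable, adding \<open>c\<close> to \<open>A\<close> shows that the graph is split. If both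
  are cliques, the non-edges between them contain no two disjoint ones, and if both are stable,
  the same holds for the edges; the prescribed degrees exclude this. If \<open>A\<close> is stable and \<open>B\<close> is
  a clique, counting the edges between them leaves only the five-cycle, where \<open>c\<close> has degree
  \<open>k\<close>.\<close>

lemma homogeneous_impossible:
  assumes nonsplit: "\<not> split_graph U"
    and A_hom: "(\<forall>p\<in>A. \<forall>q\<in>A. p \<noteq> q \<longrightarrow> adjacent U p q) \<or> (\<forall>p\<in>A. \<forall>q\<in>A. \<not> adjacent U p q)"
    and B_hom: "(\<forall>p\<in>B. \<forall>q\<in>B. p \<noteq> q \<longrightarrow> adjacent U p q) \<or> (\<forall>p\<in>B. \<forall>q\<in>B. \<not> adjacent U p q)"
  shows False
proof -
  let ?H = "induced U (verts U - {c})"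
  have u: "uncrossed ?H A B" using uncrossable_A same_degrees_refl[OF simple_H] by (simp add: uncrossable_def)
  have sub: "A \<subseteq> verts U - {c}" "B \<subseteq> verts U - {c}" "A \<inter> B = {}"
    using A_sub by (auto simp: B_def)
  have V: "verts U = insert c (A \<union> B)" using A_sub c_in by (auto simp: B_def)
  have cAB: "c \<notin> A" "c \<notin> B" using sub by auto
  have edge: "adjacent U a b \<or> adjacent U a' b'"
    if "a \<in> A" "a' \<in> A" "b \<in> B" "b' \<in> B" "a \<noteq> a'" "b \<noteq> b'" "adjacent U a a'" "adjacent U b b'" for a a' b b'
    using uncrossed_edge[OF u that(1-6)] that sub by (auto simp: adjacent_induced)
  have nonedge: "\<not> (adjacent U a b \<and> adjacent U a' b')"
    if "a \<in> A" "a' \<in> A" "b \<in> B" "b' \<in> B" "a \<noteq> a'" "b \<noteq> b'" "\<not> adjacent U a a'" "\<not> adjacent U b b'" for a a' b b'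
    using uncrossed_nonedge[OF u that(1-6)] that sub by (auto simp: adjacent_induced)
  have A_pos: "card A \<ge> 1" using card_A c_ge by simp
  have B_pos: "card B \<ge> 1" using card_B card_A c_le by linarith
  \<comment> \<open>the degrees of \<open>U - c\<close>, split according to the ends in \<open>A\<close> and \<open>B\<close>\<close>
  have part: "card (nbhd U v \<inter> A) + card (nbhd U v \<inter> B) = k - of_bool (v \<in> A)"
    if "v \<in> A \<union> B" for v
  proof -
    have v: "v \<in> verts U - {c}" using that sub by blast
    have "nbhd U v \<inter> (verts U - {c}) = (nbhd U v \<inter> A) \<union> (nbhd U v \<inter> B)" using V cAB by blast
    moreover have "card ((nbhd U v \<inter> A) \<union> (nbhd U v \<inter> B)) = card (nbhd U v \<inter> A) + card (nbhd U v \<inter> B)"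
      using fin sub by (intro card_Un_disjoint) auto
    ultimately show ?thesis using degree_H[OF v] degree_induced[OF simple _ v] by auto
  qed
  have clique_part: "card (nbhd U v \<inter> X) = card X - 1"
    if "\<forall>p\<in>X. \<forall>q\<in>X. p \<noteq> q \<longrightarrow> adjacent U p q" "v \<in> X" "finite X" for v X
  proof -
    have "nbhd U v \<inter> X = X - {v}"
      using that adjacent_irrefl[OF simple] by (auto simp: in_nbhd simple)
    thus ?thesis using that by simp
  qed
  have stable_part: "card (nbhd U v \<inter> X) = 0"
    if "\<forall>p\<in>X. \<forall>q\<in>X. \<not> adjacent U p q" "v \<in> X" for v X
  proof -
    have "nbhd U v \<inter> X = {}" using that by (auto simp: in_nbhd simple)
    thus ?thesis by simp
  qed
  have le_card: "card (nbhd U v \<inter> X) \<le> card X" if "finite X" for v X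
    using that by (simp add: card_mono)
  from A_hom B_hom show False
  proof (elim disjE)
    assume *: "\<forall>p\<in>A. \<forall>q\<in>A. p \<noteq> q \<longrightarrow> adjacent U p q" "\<forall>p\<in>B. \<forall>q\<in>B. \<not> adjacent U p q"
    have "split_graph U"
    proof (rule split_graphI[OF simple])
      show "verts U = insert c A \<union> B" "insert c A \<inter> B = {}" using V cAB sub by auto
      show "adjacent U x y" if "x \<in> insert c A" "y \<in> insert c A" "x \<noteq> y" for x y
        using that * in_A adjacent_sym[of U x y] by blast
    qed (use * in blast)
    thus False using nonsplit by blast
  next
    assume *: "\<forall>p\<in>A. \<forall>q\<in>A. p \<noteq> q \<longrightarrow> adjacent U p q" "\<forall>p\<in>B. \<forall>q\<in>B. p \<noteq> q \<longrightarrow> adjacent U p q"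
    have nonB: "card (B - nbhd U a) \<ge> 2" if "a \<in> A" for a
    proof -
      have "card (nbhd U a \<inter> B) + (card A - 1) = k - 1"
        using part[of a] clique_part[OF *(1) that fin(2)] that by simp
      moreover have "card (B - nbhd U a) = card B - card (nbhd U a \<inter> B)"
        using fin(3) by (simp add: card_Diff_subset_Int Int_commute)
      ultimately show ?thesis using card_B k_le k_ge A_pos by linarith
    qed
    have nonA: "\<exists>a\<in>A. \<not> adjacent U a b" if "b \<in> B" for b
    proof (rule ccontr)
      assume "\<not> ?thesis"
      hence "nbhd U b \<inter> A = A" by (auto simp: in_nbhd simple adjacent_sym)
      hence "card A + (card B - 1) = k"
        using part[of b] clique_part[OF *(2) that fin(3)] that sub by auto
      thus False using card_B k_le by linarith
    qed
    obtain a where a: "a \<in> A" using A_pos by fastforce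
    have A_single: "a' = a" if a': "a' \<in> A" for a'
    proof (rule ccontr)
      assume ne: "a' \<noteq> a"
      obtain b1 b2 where b: "b1 \<in> B - nbhd U a'" "b2 \<in> B - nbhd U a'" "b1 \<noteq> b2"
        using two_elements[OF nonB[OF a']] by metis
      obtain b3 b4 where "b3 \<in> B - nbhd U a" "b4 \<in> B - nbhd U a" "b3 \<noteq> b4"
        using two_elements[OF nonB[OF a]] by metis
      then obtain b' where b': "b' \<in> B - nbhd U a" "b' \<noteq> b1" by metis
      show False
        using edge[of a a' b' b1] a a' ne b b' * by (auto simp: in_nbhd simple)
    qed
    have "nbhd U a \<inter> B = {}"
    proof -
      have "\<not> adjacent U a y" if y: "y \<in> B" for y
      proof -
        obtain a' where "a' \<in> A" "\<not> adjacent U a' y" using nonA[OF y] by blast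
        thus ?thesis using A_single[of a'] by simp
      qed
      thus ?thesis by (auto simp: in_nbhd simple)
    qed
    moreover have "A = {a}" using a A_single by blast
    ultimately show False
      using part[of a] clique_part[OF *(1) a fin(2)] a k_ge by simp
  next
    assume *: "\<forall>p\<in>A. \<forall>q\<in>A. \<not> adjacent U p q" "\<forall>p\<in>B. \<forall>q\<in>B. p \<noteq> q \<longrightarrow> adjacent U p q"
    define q where "q = k + 1 - card B"
    have dA: "card (nbhd U a \<inter> B) = k - 1" if "a \<in> A" for a
      using part[of a] stable_part[OF *(1) that] that by simp
    have dB: "card (nbhd U b \<inter> A) = q \<and> card B \<le> k + 1" if "b \<in> B" for b
    proof -
      have "b \<notin> A" using that sub(3) by blast
      hence "card (nbhd U b \<inter> A) + (card B - 1) = k"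
        using part[of b] clique_part[OF *(2) that fin(3)] that by simp
      thus ?thesis using B_pos unfolding q_def by linarith
    qed
    obtain a where a: "a \<in> A" using A_pos by fastforce
    obtain b where b: "b \<in> B" using B_pos by fastforce
    have count: "card A * (k - 1) = card B * q"
      by (rule double_count[OF simple]) (use dA dB sub in auto)
    have "k - 1 \<le> card B" using dA[OF a] le_card[OF fin(3), of a] by simp
    moreover have "card B \<le> k + 1" using dB[OF b] by blast
    ultimately consider "card B = k + 1" "q = 0" | "card B = k" "q = 1" | "card B + 1 = k" "q = 2"
      unfolding q_def by linarith
    thus False
    proof cases
      case 1
      thus False using count A_pos k_ge by simp
    next
      case 2
      hence eq: "card A * (k - 1) = k" using count by simp
      have "card A \<noteq> 1" using eq k_ge by auto
      hence "2 \<le> card A" using A_pos by simp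
      hence "2 * (k - 1) \<le> card A * (k - 1)" by (rule mult_right_mono) simp
      hence "2 * (k - 1) \<le> k" unfolding eq .
      hence "k = 2" using k_ge by linarith
      thus False using eq card_A c_deg by simp
    next
      case 3
      hence "k - 1 = card B" by simp
      hence "card A * card B = card B * 2" using count 3(2) by metis
      hence "card A = 2" using B_pos by auto
      thus False using 3 card_B k_le by simp
    qed
  next
    assume *: "\<forall>p\<in>A. \<forall>q\<in>A. \<not> adjacent U p q" "\<forall>p\<in>B. \<forall>q\<in>B. \<not> adjacent U p q"
    have dA: "card (nbhd U a \<inter> B) = k - 1" if "a \<in> A" for a
      using part[of a] stable_part[OF *(1) that] that by simp
    have dB: "card (nbhd U b \<inter> A) = k" if "b \<in> B" for b
      using part[of b] stable_part[OF *(2) that] that sub by auto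
    obtain b where b: "b \<in> B" using B_pos by fastforce
    have B_single: "b' = b" if b': "b' \<in> B" for b'
    proof (rule ccontr)
      assume ne: "b' \<noteq> b"
      obtain a1 a2 where a: "a1 \<in> nbhd U b' \<inter> A" "a2 \<in> nbhd U b' \<inter> A" "a1 \<noteq> a2"
        using two_elements[of "nbhd U b' \<inter> A"] dB[OF b'] k_ge by metis
      obtain a3 a4 where "a3 \<in> nbhd U b \<inter> A" "a4 \<in> nbhd U b \<inter> A" "a3 \<noteq> a4"
        using two_elements[of "nbhd U b \<inter> A"] dB[OF b] k_ge by metis
      then obtain a' where a': "a' \<in> nbhd U b \<inter> A" "a' \<noteq> a1" by metis
      show False
        using nonedge[of a' a1 b b'] a a' b b' ne * by (auto simp: in_nbhd simple adjacent_sym)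
    qed
    hence B1: "B = {b}" using b by blast
    have adj: "adjacent U a b" and k2: "k = 2" if "a \<in> A" for a
    proof -
      have "k - 1 \<le> 1" using dA[OF that] le_card[OF fin(3), of a] B1 by simp
      thus "k = 2" using k_ge by simp
      hence "card (nbhd U a \<inter> {b}) = 1" using dA[OF that] B1 by simp
      hence "nbhd U a \<inter> {b} \<noteq> {}" by (metis card.empty zero_neq_one)
      thus "adjacent U a b" by (auto simp: in_nbhd simple)
    qed
    have "nbhd U b \<inter> A = A" using adj by (auto simp: in_nbhd simple adjacent_sym)
    thus False using dB[OF b] card_A c_deg by simp
  qed
qed

theorem exceptional_degrees:
  assumes "\<not> split_graph U"
  shows "k = 2 \<and> degree U c + 2 = card (verts U) \<or> k + 3 = card (verts U) \<and> degree U c = 1"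
  using mixed_neighbourhood mixed_non_neighbourhood homogeneous_impossible[OF assms] by blast

end

section \<open>Triangles\<close>

text \<open>The number of triangles is the invariant that takes over when all degrees agree.\<close>

definition triangles :: "'a ugraph \<Rightarrow> 'a set set" where
  "triangles G = {T. T \<subseteq> verts G \<and> card T = 3 \<and> (\<forall>x\<in>T. \<forall>y\<in>T. x \<noteq> y \<longrightarrow> adjacent G x y)}"

definition codegree :: "'a ugraph \<Rightarrow> 'a \<Rightarrow> 'a \<Rightarrow> nat" where
  "codegree G x y = card (nbhd G x \<inter> nbhd G y)"

lemma finite_triangles: "simple_graph G \<Longrightarrow> finite (triangles G)"
  by (rule finite_subset[of _ "Pow (verts G)"]) (auto simp: triangles_def finite_verts)

lemma triangle_with_edge:
  assumes "T \<in> triangles G" "x \<in> T" "y \<in> T" "x \<noteq> y" "simple_graph G"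
  obtains z where "T = {x, y, z}" "z \<in> nbhd G x \<inter> nbhd G y"
proof -
  have "card T = 3" using assms by (simp add: triangles_def)
  hence "finite T" by (metis card.infinite zero_neq_numeral)
  hence "card (T - {x, y}) = 1" using \<open>card T = 3\<close> assms(2-4) by (simp add: card_Diff_subset)
  then obtain z where z: "T - {x, y} = {z}" by (auto simp: card_1_singleton_iff)
  hence T: "T = {x, y, z}" "z \<noteq> x" "z \<noteq> y" using assms(2,3) by auto
  hence "adjacent G x z" "adjacent G y z" using assms(1) by (auto simp: triangles_def)
  thus ?thesis using that[OF T(1)] assms(5) by (simp add: in_nbhd)
qed

text \<open>A triangle that does not survive the switch contains \<open>ab\<close> or \<open>cd\<close>, and none contains both, as
  these edges have four different ends.\<close>

lemma card_destroyed_triangles: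
  assumes "simple_graph G" "alternating G a b c d"
  shows "card (triangles G - triangles (switch G a b c d)) = codegree G a b + codegree G c d"
proof -
  let ?H = "switch G a b c d"
  let ?f = "\<lambda>w. {a, b, w}" and ?g = "\<lambda>w. {c, d, w}"
  let ?X = "nbhd G a \<inter> nbhd G b" and ?Y = "nbhd G c \<inter> nbhd G d"
  have dist: "a \<noteq> b" "a \<noteq> c" "a \<noteq> d" "b \<noteq> c" "b \<noteq> d" "c \<noteq> d"
    using alternating_distinct(1)[OF assms] by auto
  have e: "adjacent G a b" "adjacent G c d" using assms(2) by (auto simp: alternating_def)
  have nH: "\<not> adjacent ?H a b" "\<not> adjacent ?H c d"
    using dist by (auto simp: adjacent_switch[OF assms] doubleton_eq_iff)
  have tri: "{x, y, w} \<in> triangles G" if "adjacent G x y" "w \<in> nbhd G x \<inter> nbhd G y" for x y w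
  proof -
    have "adjacent G x w" "adjacent G y w" using that(2) by (auto simp: in_nbhd assms(1))
    thus ?thesis using that(1) adjacentD[OF assms(1)] adjacent_sym[of G] by (auto simp: triangles_def)
  qed
  have "triangles G - triangles ?H = ?f ` ?X \<union> ?g ` ?Y"
  proof (intro equalityI subsetI)
    fix T assume T: "T \<in> triangles G - triangles ?H"
    then obtain x y where xy: "x \<in> T" "y \<in> T" "x \<noteq> y" "\<not> adjacent ?H x y"
      by (auto simp: triangles_def)
    have "adjacent G x y" using T xy by (auto simp: triangles_def)
    hence "{x, y} = {a, b} \<or> {x, y} = {c, d}" using xy(4) by (auto simp: adjacent_switch[OF assms])
    hence "a \<in> T \<and> b \<in> T \<or> c \<in> T \<and> d \<in> T" using xy(1,2) by (auto simp: doubleton_eq_iff)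
    moreover have "T \<in> triangles G" using T by simp
    ultimately show "T \<in> ?f ` ?X \<union> ?g ` ?Y"
    proof (elim disjE conjE)
      assume "a \<in> T" "b \<in> T"
      then obtain z where "T = {a, b, z}" "z \<in> ?X"
        using triangle_with_edge[OF \<open>T \<in> triangles G\<close> _ _ dist(1) assms(1)] by blast
      thus ?thesis by blast
    next
      assume "c \<in> T" "d \<in> T"
      then obtain z where "T = {c, d, z}" "z \<in> ?Y"
        using triangle_with_edge[OF \<open>T \<in> triangles G\<close> _ _ dist(6) assms(1)] by blast
      thus ?thesis by blast
    qed
  next
    fix T assume "T \<in> ?f ` ?X \<union> ?g ` ?Y"
    then consider w where "T = {a, b, w}" "w \<in> ?X" | w where "T = {c, d, w}" "w \<in> ?Y" by blast
    thus "T \<in> triangles G - triangles ?H"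
    proof cases
      case 1
      have "T \<notin> triangles ?H" using 1(1) nH(1) dist(1) unfolding triangles_def by blast
      thus ?thesis using tri[OF e(1) 1(2)] 1(1) by simp
    next
      case 2
      have "T \<notin> triangles ?H" using 2(1) nH(2) dist(6) unfolding triangles_def by blast
      thus ?thesis using tri[OF e(2) 2(2)] 2(1) by simp
    qed
  qed
  moreover have "?f ` ?X \<inter> ?g ` ?Y = {}"
  proof -
    have "{a, b, v} \<noteq> {c, d, w}" for v w
    proof
      assume "{a, b, v} = {c, d, w}"
      hence "a \<in> {c, d, w}" "b \<in> {c, d, w}" by blast+
      thus False using dist by simp
    qed
    thus ?thesis by blast
  qed
  moreover have inj: "inj_on (\<lambda>w. {x, y, w}) (nbhd G x \<inter> nbhd G y)" for x y
  proof (rule inj_onI)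
    fix v w assume v: "v \<in> nbhd G x \<inter> nbhd G y" and eq: "{x, y, v} = {x, y, w}"
    have "v \<noteq> x" "v \<noteq> y" using v adjacent_irrefl[OF assms(1)] by (auto simp: in_nbhd assms(1))
    moreover have "v \<in> {x, y, w}" using eq by blast
    ultimately show "v = w" by simp
  qed
  moreover have "card (?f ` ?X) = card ?X" "card (?g ` ?Y) = card ?Y"
    by (rule card_image[OF inj])+
  ultimately show ?thesis
    unfolding codegree_def using finite_nbhd[OF assms(1)] by (simp add: card_Un_disjoint)
qed

lemma codegree_switch:
  assumes "simple_graph G" "alternating G a b c d"
  shows "codegree (switch G a b c d) a c + of_bool (adjacent G b c) + of_bool (adjacent G a d)
    = codegree G a c"
proof -
  let ?X = "nbhd G a \<inter> nbhd G c"
  have dist: "a \<noteq> b" "a \<noteq> c" "a \<noteq> d" "b \<noteq> c" "b \<noteq> d" "c \<noteq> d"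
    using alternating_distinct(1)[OF assms] by auto
  have fin: "finite ?X" by (simp add: finite_nbhd assms(1))
  have "nbhd (switch G a b c d) a \<inter> nbhd (switch G a b c d) c = ?X - {b} - {d}"
    using dist adjacent_irrefl[OF assms(1)]
    by (auto simp: in_nbhd assms(1) simple_switch adjacent_switch[OF assms] doubleton_eq_iff)
  moreover have "b \<in> ?X \<longleftrightarrow> adjacent G b c" "d \<in> ?X \<longleftrightarrow> adjacent G a d"
    using assms(2) by (auto simp: in_nbhd assms(1) alternating_def adjacent_sym)
  moreover have "card (?X - {b}) + of_bool (b \<in> ?X) = card ?X"
    using fin card_Suc_Diff1[OF fin, of b] by (cases "b \<in> ?X") auto
  moreover have "card (?X - {b} - {d}) + of_bool (d \<in> ?X) = card (?X - {b})"
    using fin card_Suc_Diff1[of "?X - {b}" d] dist by (cases "d \<in> ?X") auto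
  ultimately show ?thesis unfolding codegree_def by simp
qed

lemma card_triangles_le:
  assumes iso: "graph_iso f G H" and fin: "finite (verts H)"
  shows "card (triangles G) \<le> card (triangles H)"
proof (rule card_inj_on_le)
  from iso have inj: "inj_on f (verts G)" and im: "f ` verts G = verts H"
    by (auto simp: graph_iso_def bij_betw_def)
  show "inj_on ((`) f) (triangles G)"
    by (rule inj_on_subset[OF inj_on_image_Pow[OF inj]]) (auto simp: triangles_def)
  show "(`) f ` triangles G \<subseteq> triangles H"
  proof
    fix S assume "S \<in> (`) f ` triangles G"
    then obtain T where T: "S = f ` T" "T \<in> triangles G" by blast
    hence sub: "T \<subseteq> verts G" and c3: "card T = 3" by (auto simp: triangles_def)
    have "card S = 3" using card_image[OF inj_on_subset[OF inj sub]] T(1) c3 by simp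
    moreover have "adjacent H u v" if "u \<in> S" "v \<in> S" "u \<noteq> v" for u v
    proof -
      obtain x y where xy: "x \<in> T" "y \<in> T" "u = f x" "v = f y" using \<open>u \<in> S\<close> \<open>v \<in> S\<close> T(1) by blast
      hence "adjacent G x y" using T(2) that(3) by (auto simp: triangles_def)
      thus ?thesis using xy sub iso by (auto simp: graph_iso_def)
    qed
    moreover have "S \<subseteq> verts H" using T(1) sub im by blast
    ultimately show "S \<in> triangles H" by (simp add: triangles_def)
  qed
  show "finite (triangles H)"
    by (rule finite_subset[of _ "Pow (verts H)"]) (auto simp: triangles_def fin)
qed

lemma rigid_card_triangles:
  assumes "rigid U" "same_degrees U H"
  shows "card (triangles H) = card (triangles U)"
proof -
  obtain f where f: "graph_iso f U H" using assms by (auto simp: rigid_def isomorphic_iff)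
  have "finite (verts H)" "finite (verts U)"
    using assms by (auto simp: rigid_def same_degrees_def finite_verts)
  thus ?thesis using card_triangles_le[OF f] card_triangles_le[OF graph_iso_inv[OF f]] by simp
qed

text \<open>The triangles created by the switch are those destroyed by its inverse; both numbers agree. The
  last summand accounts for the common neighbours of \<open>a\<close> and \<open>c\<close>, and of \<open>b\<close> and \<open>d\<close>, among the
  four vertices themselves.\<close>

lemma rigid_codegrees:
  assumes "rigid U" "same_degrees U H" "alternating H a b c d"
  shows "codegree H a c + codegree H b d =
    codegree H a b + codegree H c d + 2 * (of_bool (adjacent H a d) + of_bool (adjacent H b c))"
proof -
  let ?L = "switch H a b c d"
  have s: "simple_graph H" using assms(2) by (simp add: same_degrees_def)
  note sL = simple_switch[OF s] and alt' = alternating_switch[OF s assms(3)]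
  have L: "same_degrees U ?L" using same_degrees_trans[OF assms(2) same_degrees_switch[OF s assms(3)]] .
  have "card (triangles H) = card (triangles ?L)"
    using rigid_card_triangles[OF assms(1)] assms(2) L by simp
  hence "card (triangles H - triangles ?L) = card (triangles ?L - triangles H)"
    using card_Diff_subset_Int[of "triangles H" "triangles ?L"] card_Diff_subset_Int[of "triangles ?L" "triangles H"]
      finite_triangles[OF s] finite_triangles[OF sL] by (simp add: Int_commute)
  hence "codegree H a b + codegree H c d = codegree ?L a c + codegree ?L b d"
    using card_destroyed_triangles[OF s assms(3)] card_destroyed_triangles[OF sL alt']
    by (simp add: switch_switch[OF s assms(3)])
  moreover have "codegree ?L a c + of_bool (adjacent H b c) + of_bool (adjacent H a d) = codegree H a c"
    by (rule codegree_switch[OF s assms(3)])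
  moreover have "codegree ?L b d + of_bool (adjacent H b c) + of_bool (adjacent H a d) = codegree H b d"
  proof -
    have alt2: "alternating H b a d c" using assms(3) by (auto simp: alternating_def adjacent_sym)
    have "switch H b a d c = ?L"
      unfolding switch_def by (auto simp: insert_commute intro!: arg_cong[of _ _ "graph_of (verts H)"])
    thus ?thesis using codegree_switch[OF s alt2] adjacent_sym[of H] by simp
  qed
  ultimately show ?thesis by simp
qed

section \<open>Regular rigid graphs\<close>

text \<open>As long as \<open>a\<close> and \<open>d\<close> have a common neighbour \<open>x\<close>, their neighbourhoods together miss some
  vertex \<open>y\<close>, because the graph has more than \<open>2 * k\<close> vertices, and \<open>d\<close> can trade \<open>x\<close> for \<open>y\<close> by
  a switch.\<close>

lemma exists_disjoint_neighbours:
  assumes "simple_graph U" "\<And>v. v \<in> verts U \<Longrightarrow> degree U v = k" "2 \<le> k" "2 * k + 1 \<le> card (verts U)"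
  obtains H a d where "same_degrees U H" "adjacent H a d" "nbhd H a \<inter> nbhd H d = {}"
proof -
  have "\<exists>H a d. same_degrees U H \<and> adjacent H a d \<and> nbhd H a \<inter> nbhd H d = {}"
    if "same_degrees U H" "adjacent H a d" for H a d
    using that
  proof (induction "codegree H a d" arbitrary: H a d rule: less_induct)
    case less
    note H = less.prems(1) and ad = less.prems(2)
    have s: "simple_graph H" and V: "verts H = verts U" using H by (auto simp: same_degrees_def)
    have deg: "card (nbhd H v) = k" if "v \<in> verts U" for v
      using H assms(2) that by (auto simp: same_degrees_def degree_nbhd)
    note finN = finite_nbhd[OF s]
    have aV: "a \<in> verts U" "d \<in> verts U" "a \<noteq> d" using adjacentD[OF s ad] V by auto
    show ?case
    proof (cases "nbhd H a \<inter> nbhd H d = {}")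
      case True
      thus ?thesis using less.prems by blast
    next
      case False
      then obtain x where x: "adjacent H a x" "adjacent H d x" by (auto simp: in_nbhd s)
      have xV: "x \<in> verts U" "x \<noteq> a" "x \<noteq> d" using adjacentD[OF s x(1)] adjacentD[OF s x(2)] V by auto
      \<comment> \<open>a vertex \<open>y\<close> outside both neighbourhoods, by counting\<close>
      have "card (nbhd H a \<union> (nbhd H d - {x})) < card (verts U)"
      proof -
        have "card (nbhd H a \<union> (nbhd H d - {x})) \<le> k + (k - 1)"
          using card_Un_le[of "nbhd H a" "nbhd H d - {x}"] deg[OF aV(1)] deg[OF aV(2)] x
          by (simp add: in_nbhd s)
        thus ?thesis using assms(3,4) by simp
      qed
      hence "\<not> verts U \<subseteq> nbhd H a \<union> (nbhd H d - {x})"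
        using finN card_mono by (metis finite_Diff finite_UnI linorder_not_less)
      then obtain y where y': "y \<in> verts U" "y \<notin> nbhd H a \<union> (nbhd H d - {x})" by blast
      have "x \<in> nbhd H a" using x by (simp add: in_nbhd s)
      with y' have y: "y \<in> verts U" "y \<notin> nbhd H a" "y \<notin> nbhd H d" by auto
      have ya: "y \<noteq> a" "y \<noteq> d" using y ad by (auto simp: in_nbhd s adjacent_sym)
      have "degree H x \<le> degree H y" using deg xV y by (simp add: degree_nbhd)
      moreover have "adjacent H x d" "\<not> adjacent H y d" "d \<noteq> y"
        using x y ya by (auto simp: in_nbhd s adjacent_sym)
      ultimately obtain z where z: "adjacent H y z" "\<not> adjacent H x z" "z \<noteq> x" "z \<noteq> d"
        using exists_exchange[OF s] by blast
      have za: "z \<noteq> a" using z x by (auto simp: adjacent_sym)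
      have alt: "alternating H d x y z"
        using x y z ya by (auto simp: alternating_def in_nbhd s)
      let ?L = "switch H d x y z"
      have L: "same_degrees U ?L" using same_degrees_trans[OF H same_degrees_switch[OF s alt]] .
      note adj = adjacent_switch[OF s alt]
      have adL: "adjacent ?L a d" using ad aV xV ya za by (auto simp: adj doubleton_eq_iff)
      have "nbhd ?L a = nbhd H a"
        using aV xV ya za by (auto simp: in_nbhd simple_switch s adj doubleton_eq_iff)
      moreover have "nbhd ?L d = insert y (nbhd H d - {x})"
        using aV xV ya z by (auto simp: in_nbhd simple_switch s adj doubleton_eq_iff)
      ultimately have "nbhd ?L a \<inter> nbhd ?L d = nbhd H a \<inter> nbhd H d - {x}" using y by auto
      moreover have "x \<in> nbhd H a \<inter> nbhd H d" using x by (simp add: in_nbhd s)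
      ultimately have "codegree ?L a d < codegree H a d"
        unfolding codegree_def using finN by (metis card_Diff1_less finite_Int)
      from less.hyps[OF this L adL] show ?thesis .
    qed
  qed
  moreover have "\<exists>a d. adjacent U a d"
  proof -
    have "verts U \<noteq> {}" using assms(4) by auto
    then obtain v where v: "v \<in> verts U" by blast
    hence "card (nbhd U v) = k" using assms(2)[OF v] by (simp add: degree_nbhd)
    hence "nbhd U v \<noteq> {}" using assms(3) by auto
    thus ?thesis by (auto simp: nbhd_def)
  qed
  ultimately show ?thesis using that same_degrees_refl[OF assms(1)] by blast
qed

text \<open>The degree is at most half of the number of other vertices, which holds for a regular graph or
  for its complement. On six or more vertices the number of triangles can then be varied by
  switches, so these assumptions are contradictory.\<close>

locale sparse_regular =
  fixes U :: "'a ugraph" and k :: nat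
  assumes rig: "rigid U"
    and deg: "\<And>v. v \<in> verts U \<Longrightarrow> degree U v = k"
    and k_ge: "2 \<le> k" and sparse: "2 * k + 1 \<le> card (verts U)" and n6: "6 \<le> card (verts U)"
begin

lemma simple: "simple_graph U"
  using rig by (simp add: rigid_def)

lemma same_degreesD:
  assumes "same_degrees U H"
  shows "simple_graph H" "verts H = verts U" "v \<in> verts U \<Longrightarrow> card (nbhd H v) = k"
  using assms deg by (auto simp: same_degrees_def degree_nbhd)

text \<open>\<open>a\<close> and \<open>d\<close> are adjacent and have no common neighbour, and \<open>W\<close> is the set of their further
  neighbours. The edges from \<open>{a, d}\<close> to \<open>W\<close> can be redistributed freely, as long as \<open>a\<close> and \<open>d\<close>
  get equally many; this does not touch the rest of the graph.\<close>

definition hub :: "'a ugraph \<Rightarrow> 'a \<Rightarrow> 'a \<Rightarrow> 'a set \<Rightarrow> bool" where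
  "hub H a d W \<longleftrightarrow> same_degrees U H \<and> adjacent H a d \<and> nbhd H a \<inter> nbhd H d = {} \<and>
     nbhd H a \<union> nbhd H d = insert a (insert d W) \<and> a \<notin> W \<and> d \<notin> W"

lemma hubD:
  assumes "hub H a d W"
  shows "same_degrees U H" "simple_graph H" "verts H = verts U" "adjacent H a d" "a \<noteq> d"
    "a \<in> verts U" "d \<in> verts U" "W \<subseteq> verts U" "a \<notin> W" "d \<notin> W" "finite W" "card W = 2 * k - 2"
    "w \<in> W \<Longrightarrow> adjacent H w a \<longleftrightarrow> \<not> adjacent H w d"
    "w \<in> W \<Longrightarrow> w \<in> verts U \<and> card (nbhd H w - {a, d}) = k - 1"
    "x \<notin> W \<Longrightarrow> x \<noteq> a \<Longrightarrow> x \<noteq> d \<Longrightarrow> \<not> adjacent H x a \<and> \<not> adjacent H x d"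
proof -
  show H: "same_degrees U H" and ad: "adjacent H a d" and "a \<notin> W" "d \<notin> W"
    using assms by (auto simp: hub_def)
  show s: "simple_graph H" and V: "verts H = verts U" using same_degreesD[OF H] by auto
  show ne: "a \<noteq> d" and aV: "a \<in> verts U" "d \<in> verts U" using adjacentD[OF s ad] V by auto
  have un: "nbhd H a \<union> nbhd H d = insert a (insert d W)" and disj: "nbhd H a \<inter> nbhd H d = {}"
    using assms by (auto simp: hub_def)
  show WV: "W \<subseteq> verts U" using un nbhd_subset[of H] V by blast
  thus finW: "finite W" using simple finite_verts finite_subset by metis
  have "card (nbhd H a \<union> nbhd H d) = k + k"
    using disj same_degreesD(3)[OF H] aV finite_nbhd[OF s] by (simp add: card_Un_disjoint)
  hence "card W + 2 = 2 * k" using un ne \<open>a \<notin> W\<close> \<open>d \<notin> W\<close> finW by simp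
  thus "card W = 2 * k - 2" by simp
  have nba: "adjacent H w a \<longleftrightarrow> w \<in> nbhd H a" "adjacent H w d \<longleftrightarrow> w \<in> nbhd H d" for w
    by (auto simp: in_nbhd s adjacent_sym)
  show iff: "adjacent H w a \<longleftrightarrow> \<not> adjacent H w d" if "w \<in> W" for w
    unfolding nba using that un disj by blast
  show "w \<in> verts U \<and> card (nbhd H w - {a, d}) = k - 1" if w: "w \<in> W" for w
  proof
    show wV: "w \<in> verts U" using w WV by blast
    have "nbhd H w - {a, d} = nbhd H w - {if adjacent H w a then a else d}"
      using iff[OF w] by (auto simp: in_nbhd s)
    moreover have "(if adjacent H w a then a else d) \<in> nbhd H w"
      using iff[OF w] by (auto simp: in_nbhd s)
    ultimately show "card (nbhd H w - {a, d}) = k - 1"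
      using same_degreesD(3)[OF H wV] finite_nbhd[OF s, of w] by simp
  qed
  show "\<not> adjacent H x a \<and> \<not> adjacent H x d" if "x \<notin> W" "x \<noteq> a" "x \<noteq> d" for x
    unfolding nba using un that by blast
qed

lemma hub_switch:
  assumes "hub H a d W" "alternating H p q r t" "{p, q, r, t} \<inter> {a, d} = {}"
  shows "hub (switch H p q r t) a d W"
proof -
  note h = hubD[OF assms(1)]
  note adj = adjacent_switch[OF h(2) assms(2)]
  have nb: "nbhd (switch H p q r t) v = nbhd H v" if "v = a \<or> v = d" for v
    using that assms(3) h(5)
    by (auto simp: in_nbhd h(2) simple_switch adj doubleton_eq_iff)
  have "adjacent (switch H p q r t) a d"
    using h(4) assms(3) by (auto simp: adj doubleton_eq_iff)
  thus ?thesis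
    using assms(1) nb same_degrees_trans[OF h(1) same_degrees_switch[OF h(2) assms(2)]]
    by (simp add: hub_def)
qed

text \<open>Every neighbour \<open>x\<close> of \<open>a\<close> and every neighbour \<open>y\<close> of \<open>d\<close> in \<open>W\<close> give an alternating four-cycle
  \<open>a x d y\<close>. In the four resulting equations between codegrees everything cancels but the
  adjacencies inside \<open>W\<close>.\<close>

lemma hub_cross:
  assumes "hub H a d W" "{b, b', c, c'} \<subseteq> W"
    "adjacent H a b" "adjacent H a b'" "adjacent H c d" "adjacent H c' d"
  shows "(of_bool (adjacent H b c) + of_bool (adjacent H b' c') :: nat) =
    of_bool (adjacent H b c') + of_bool (adjacent H b' c)"
proof -
  note h = hubD[OF assms(1)]
  have eq: "codegree H a y + codegree H x d =
      codegree H a x + codegree H y d + 2 * (1 + of_bool (adjacent H x y))"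
    if "x \<in> W" "y \<in> W" "adjacent H a x" "adjacent H y d" for x y
  proof -
    have "\<not> adjacent H a y" "\<not> adjacent H x d" "a \<noteq> y" "x \<noteq> d"
      using that h(13)[of x] h(13)[of y] h(9,10) by (auto simp: adjacent_sym)
    hence "alternating H a x y d" using that by (simp add: alternating_def)
    from rigid_codegrees[OF rig h(1) this] show ?thesis using h(4) by simp
  qed
  show ?thesis
    using eq[of b c] eq[of b' c'] eq[of b c'] eq[of b' c] assms by auto
qed

lemma hub_redistribute:
  assumes "hub H a d W" "P \<subseteq> W" "card P = k - 1"
  obtains L where "hub L a d W" "\<And>x y. x \<in> W \<Longrightarrow> y \<in> W \<Longrightarrow> adjacent L x y \<longleftrightarrow> adjacent H x y"
    "\<And>x. x \<in> W \<Longrightarrow> adjacent L a x \<longleftrightarrow> x \<in> P"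
proof -
  note h = hubD[OF assms(1)]
  define L where "L = graph_of (verts U) (\<lambda>x y.
     x \<notin> {a, d} \<and> y \<notin> {a, d} \<and> adjacent H x y \<or> x = a \<and> y \<in> insert d P \<or> x = d \<and> y \<in> W - P)"
  have sL: "simple_graph L" and VL: "verts L = verts U"
    unfolding L_def using simple by (auto simp: simple_graph_of finite_verts)
  have far: "adjacent L x y \<longleftrightarrow> adjacent H x y" if "x \<notin> {a, d}" "y \<notin> {a, d}" for x y
    using that adjacentD[OF h(2), of x y] h(3) unfolding L_def adjacent_graph_of
    by (auto simp: adjacent_sym)
  have La: "adjacent L a y \<longleftrightarrow> y \<in> insert d P" for y
    using assms(2) h(5-10) unfolding L_def adjacent_graph_of by auto
  have Ld: "adjacent L d y \<longleftrightarrow> y \<in> insert a (W - P)" for y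
    using assms(2) h(5-10) unfolding L_def adjacent_graph_of by auto
  have finP: "finite P" using assms(2) h(11) finite_subset by blast
  have nbLa: "nbhd L a = insert d P" and nbLd: "nbhd L d = insert a (W - P)"
    using La Ld by (auto simp: in_nbhd sL)
  have "same_degrees U L"
    unfolding same_degrees_def
  proof (intro conjI ballI)
    fix v assume v: "v \<in> verts U"
    have "card (nbhd L v) = k"
    proof -
      consider "v = a" | "v = d" | "v \<in> W" | "v \<notin> W" "v \<noteq> a" "v \<noteq> d" by blast
      thus ?thesis
      proof cases
        case 1
        have "d \<notin> P" using assms(2) h(10) by blast
        thus ?thesis using 1 nbLa finP assms(3) k_ge by simp
      next
        case 2
        have "card (W - P) = k - 1" using assms(2,3) finP h(12) k_ge by (simp add: card_Diff_subset)
        moreover have "a \<notin> W - P" using h(9) by blast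
        ultimately show ?thesis using 2 nbLd h(11) k_ge by simp
      next
        case 3
        hence ne: "v \<noteq> a" "v \<noteq> d" using h(9,10) by auto
        let ?e = "if v \<in> P then a else d"
        have "adjacent L v a \<longleftrightarrow> v \<in> P" "adjacent L v d \<longleftrightarrow> v \<notin> P"
          using La[of v] Ld[of v] ne 3 by (auto simp: adjacent_sym)
        hence "u \<in> nbhd L v \<longleftrightarrow> u \<in> insert ?e (nbhd H v - {a, d})" for u
          using far[of v u] ne by (cases "u = a"; cases "u = d") (auto simp: in_nbhd sL h(2))
        hence "nbhd L v = insert ?e (nbhd H v - {a, d})" by blast
        thus ?thesis using h(14)[OF 3] finite_nbhd[OF h(2)] k_ge by auto
      next
        case 4
        have "\<not> adjacent L v a" "\<not> adjacent L v d"
          using La[of v] Ld[of v] 4 assms(2) by (auto simp: adjacent_sym)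
        hence "u \<in> nbhd L v \<longleftrightarrow> u \<in> nbhd H v" for u
          using far[of v u] 4 h(15)[OF 4] by (cases "u = a"; cases "u = d") (auto simp: in_nbhd sL h(2))
        hence "nbhd L v = nbhd H v" by blast
        thus ?thesis using same_degreesD(3)[OF h(1) v] by simp
      qed
    qed
    thus "degree L v = degree U v" using deg[OF v] by (simp add: degree_nbhd)
  qed (simp_all add: sL VL)
  hence "hub L a d W"
    unfolding hub_def using La[of d] nbLa nbLd assms(2) h(5,9,10) by auto
  moreover have "adjacent L x y \<longleftrightarrow> adjacent H x y" if "x \<in> W" "y \<in> W" for x y
  proof (rule far)
    show "x \<notin> {a, d}" "y \<notin> {a, d}" using that h(9,10) by auto
  qed
  moreover have "adjacent L a x \<longleftrightarrow> x \<in> P" if "x \<in> W" for x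
    using La that h(10) by auto
  ultimately show ?thesis using that by blast
qed

text \<open>By redistribution, \<open>p\<close> and \<open>s\<close> become neighbours of \<open>a\<close>, and \<open>q\<close> and \<open>r\<close> neighbours of \<open>d\<close>. For
  this, \<open>a\<close> needs at least two neighbours in \<open>W\<close>. So all three perfect matchings on four
  vertices of \<open>W\<close> contain the same number of edges of the graph.\<close>

lemma hub_four_points:
  assumes "hub H a d W" "k \<ge> 3" "distinct [p, q, r, s]" "{p, q, r, s} \<subseteq> W"
  shows "(of_bool (adjacent H p q) + of_bool (adjacent H r s) :: nat) =
    of_bool (adjacent H p r) + of_bool (adjacent H q s)"
proof -
  note h = hubD[OF assms(1)]
  have "card {p, s} \<le> k - 1" "k - 1 \<le> card (W - {q, r})"
    using assms(2-4) h(11,12) by (auto simp: card_Diff_subset)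
  then obtain P where P: "{p, s} \<subseteq> P" "P \<subseteq> W - {q, r}" "card P = k - 1"
    using exists_subset_between[of "{p, s}" "k - 1" "W - {q, r}"] assms(3,4) h(11) by auto
  obtain L where L: "hub L a d W" "\<And>x y. x \<in> W \<Longrightarrow> y \<in> W \<Longrightarrow> adjacent L x y \<longleftrightarrow> adjacent H x y"
    "\<And>x. x \<in> W \<Longrightarrow> adjacent L a x \<longleftrightarrow> x \<in> P"
    using hub_redistribute[OF assms(1), of P] P by (metis Diff_subset subset_trans)
  note l = hubD[OF L(1)]
  have W: "p \<in> W" "q \<in> W" "r \<in> W" "s \<in> W" using assms(4) by auto
  have "adjacent L a p" "adjacent L a s" using L(3) W P(1) by auto
  moreover have "adjacent L q d" "adjacent L r d"
    using L(3)[of q] L(3)[of r] W P(2) l(13)[of q] l(13)[of r] by (auto simp: adjacent_sym)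
  ultimately have "(of_bool (adjacent L p q) + of_bool (adjacent L s r) :: nat) =
      of_bool (adjacent L p r) + of_bool (adjacent L s q)"
    using hub_cross[OF L(1), of p s q r] W by auto
  thus ?thesis using L(2) W by (simp add: adjacent_sym)
qed

lemma hub_outside:
  assumes "hub H a d W"
  obtains x where "x \<in> verts U" "x \<notin> W" "x \<noteq> a" "x \<noteq> d"
proof -
  note h = hubD[OF assms]
  have "card (insert a (insert d W)) < card (verts U)"
    using h(5,9-12) sparse k_ge by simp
  hence "\<not> verts U \<subseteq> insert a (insert d W)"
    using h(11) card_mono[of "insert a (insert d W)" "verts U"] by auto
  thus ?thesis using that by blast
qed

text \<open>By the four-point condition an edge \<open>bc\<close> of \<open>W\<close> forces \<open>c\<close> to be adjacent to nearly all of \<open>W\<close>,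
  which the degree allows only for \<open>k = 3\<close>; then \<open>W\<close> carries a triangle \<open>bcq\<close> and an isolated
  vertex \<open>p\<close>. Opening the triangle with a remote edge destroys the four-point condition.\<close>

lemma hub_no_edge:
  assumes hub: "hub H a d W" and k3: "k \<ge> 3" and bc: "b \<in> W" "c \<in> W" "adjacent H b c"
  shows False
proof -
  note h = hubD[OF hub]
  note four = hub_four_points[OF hub k3]
  have bc_ne: "b \<noteq> c" using adjacentD(3)[OF h(2) bc(3)] .
  have degW: "card (nbhd H w \<inter> X) \<le> k - 1" if "w \<in> W" "X \<subseteq> W" for w X
  proof -
    have "nbhd H w \<inter> X \<subseteq> nbhd H w - {a, d}" using that h(9,10) by auto
    hence "card (nbhd H w \<inter> X) \<le> card (nbhd H w - {a, d})"
      using finite_nbhd[OF h(2)] by (intro card_mono) auto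
    thus ?thesis using h(14)[OF that(1)] by simp
  qed
  have "\<not> W - {b} \<subseteq> nbhd H b"
  proof
    assume "W - {b} \<subseteq> nbhd H b"
    hence "nbhd H b \<inter> (W - {b}) = W - {b}" by blast
    hence "card (W - {b}) \<le> k - 1" using degW[OF bc(1), of "W - {b}"] by auto
    thus False using h(11,12) bc(1) k3 by simp
  qed
  then obtain p where "p \<in> W - {b}" "p \<notin> nbhd H b" by blast
  hence p: "p \<in> W" "p \<noteq> b" "\<not> adjacent H b p" by (auto simp: in_nbhd h(2))
  have pc: "p \<noteq> c" using p bc(3) by auto
  have cq: "adjacent H c q \<and> \<not> adjacent H p q" if "q \<in> W - {b, c, p}" for q
    using four[of b c p q] that p bc bc_ne pc by (auto simp: of_bool_def split: if_splits)
  have "W - {c, p} \<subseteq> nbhd H c"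
  proof
    fix q assume "q \<in> W - {c, p}"
    thus "q \<in> nbhd H c"
      using cq[of q] bc(3) by (cases "q = b") (simp_all add: in_nbhd h(2) adjacent_sym)
  qed
  hence "nbhd H c \<inter> (W - {c, p}) = W - {c, p}" by blast
  hence "card (W - {c, p}) \<le> k - 1" using degW[OF bc(2), of "W - {c, p}"] by auto
  hence k: "k = 3" using h(11,12) bc(2) p(1) pc k3 by (simp add: card_Diff_subset)
  hence "card (W - {b, c, p}) = 1" using h(11,12) bc(1,2) p(1,2) pc bc_ne by (simp add: card_Diff_subset)
  then obtain q where "W - {b, c, p} = {q}" by (auto simp: card_1_singleton_iff)
  hence q: "q \<in> W - {b, c, p}" and W: "W = {b, c, p, q}" using bc p by auto
  note cq = cq[OF q]
  have dist: "distinct [b, c, p, q]" using q bc_ne p pc by auto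
  have exact: "nbhd H w - {a, d} = {u, v}"
    if "w \<in> W" "u \<in> W" "v \<in> W" "u \<noteq> v" "adjacent H w u" "adjacent H w v" for w u v
  proof -
    have "{u, v} \<subseteq> nbhd H w - {a, d}" using that h(9,10) by (auto simp: in_nbhd h(2))
    moreover have "card (nbhd H w - {a, d}) = card {u, v}" using h(14)[OF that(1)] k that(4) by simp
    ultimately show ?thesis using finite_nbhd[OF h(2), of w] by (intro card_subset_eq[symmetric]) auto
  qed
  have nc: "nbhd H c - {a, d} = {b, q}"
    using exact[of c b q] cq bc dist W by (auto simp: adjacent_sym)
  hence cp: "\<not> adjacent H c p" using dist p h(9,10) by (auto simp: in_nbhd h(2) set_eq_iff)
  have bq: "adjacent H b q"
    using four[of b c q p] cp bc(3) dist W cq by (auto simp: of_bool_def split: if_splits)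
  have nb: "nbhd H b - {a, d} = {c, q}" using exact[of b c q] bq bc dist W by auto
  have nq: "nbhd H q - {a, d} = {b, c}"
    using exact[of q b c] bq cq dist W by (auto simp: adjacent_sym)
  \<comment> \<open>an edge \<open>xy\<close> far away from the triangle \<open>bcq\<close>\<close>
  obtain x where x: "x \<in> verts U" "x \<notin> W" "x \<noteq> a" "x \<noteq> d" using hub_outside[OF hub] by blast
  have far: "\<not> adjacent H w z" if "w \<in> {b, c, q}" "z \<notin> W" "z \<noteq> a" "z \<noteq> d" for w z
  proof
    assume "adjacent H w z"
    hence "z \<in> nbhd H w - {a, d}" using that by (auto simp: in_nbhd h(2))
    thus False using that nb nc nq W by auto
  qed
  have "\<not> nbhd H x \<subseteq> {p}"
  proof
    assume "nbhd H x \<subseteq> {p}"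
    hence "card (nbhd H x) \<le> 1" using card_mono[of "{p}" "nbhd H x"] by simp
    thus False using same_degreesD(3)[OF h(1) x(1)] k by simp
  qed
  then obtain y where "y \<in> nbhd H x" "y \<noteq> p" by blast
  hence y: "adjacent H x y" "y \<noteq> p" by (auto simp: in_nbhd h(2))
  have yX: "y \<notin> W" "y \<noteq> a" "y \<noteq> d"
    using far[of y x] y x h(15)[of x] W by (auto simp: adjacent_sym)
  have xy: "x \<noteq> y" using adjacentD(3)[OF h(2) y(1)] .
  have alt: "alternating H b c x y"
    using bc far[of b x] far[of c y] x y yX by (auto simp: alternating_def)
  have hub': "hub (switch H b c x y) a d W"
    using hub_switch[OF hub alt] bc x yX h(9,10) by auto
  have "(of_bool (adjacent (switch H b c x y) b c) + of_bool (adjacent (switch H b c x y) p q) :: nat) =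
    of_bool (adjacent (switch H b c x y) b p) + of_bool (adjacent (switch H b c x y) c q)"
    using hub_four_points[OF hub' k3 dist] W by simp
  moreover have "x \<noteq> b" "x \<noteq> c" "x \<noteq> p" "x \<noteq> q" "y \<noteq> b" "y \<noteq> c" "y \<noteq> p" "y \<noteq> q"
    using x(2) yX(1) unfolding W by simp_all
  ultimately show False
    using dist p(3) cq by (auto simp: adjacent_switch[OF h(2) alt] doubleton_eq_iff)
qed

text \<open>Otherwise a switch would create the edge \<open>bc\<close> inside \<open>W\<close>.\<close>

lemma hub_clique_outside:
  assumes hub: "hub H a d W" and k3: "k \<ge> 3" and bc: "b \<in> W" "c \<in> W" "b \<noteq> c"
    and x: "x \<in> nbhd H b - {a, d}" and y: "y \<in> nbhd H c - {a, d}" and ne: "x \<noteq> y"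
  shows "adjacent H x y"
proof (rule ccontr)
  assume nadj: "\<not> adjacent H x y"
  note h = hubD[OF hub]
  have stable: "\<not> adjacent H u v" if "u \<in> W" "v \<in> W" for u v
    using hub_no_edge[OF hub k3 that] by blast
  have xy: "adjacent H b x" "adjacent H c y" using x y by (auto simp: in_nbhd h(2))
  have out: "x \<notin> W" "y \<notin> W" using stable xy bc by blast+
  have alt: "alternating H b x c y"
    using xy nadj ne bc stable by (auto simp: alternating_def)
  have hub': "hub (switch H b x c y) a d W"
    using hub_switch[OF hub alt] bc x y h(9,10) by auto
  have "adjacent (switch H b x c y) b c"
    by (auto simp: adjacent_switch[OF h(2) alt])
  thus False using hub_no_edge[OF hub' k3 bc(1,2)] by blast
qed

text \<open>\<open>W\<close> is stable, so each of its vertices has \<open>k - 1\<close> neighbours away from the hub. By the previous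
  lemma, neighbours of different vertices of \<open>W\<close> are equal or adjacent. A vertex \<open>x\<close> that is a
  neighbour of \<open>w1\<close> but not of \<open>w2\<close> has its \<open>k\<close> neighbours used up by \<open>w1\<close> and the neighbours of
  \<open>w2\<close>. Hence the neighbours of a third vertex \<open>w3\<close> are among those of \<open>w2\<close>, and two vertices of
  \<open>W\<close> with equal neighbourhoods leave no room for a third one.\<close>

lemma hub_impossible:
  assumes hub: "hub H a d W" and k3: "k \<ge> 3"
  shows False
proof -
  note h = hubD[OF hub]
  define N where "N = (\<lambda>w. nbhd H w - {a, d})"
  have finN: "finite (N w)" for w by (simp add: N_def finite_nbhd h(2))
  have cN: "card (N w) = k - 1" if "w \<in> W" for w using h(14)[OF that] by (simp add: N_def)
  have stable: "\<not> adjacent H u v" if "u \<in> W" "v \<in> W" for u v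
    using hub_no_edge[OF hub k3 that] by blast
  have NW: "x \<notin> W" "x \<in> verts U" "adjacent H x w" if "x \<in> N w" "w \<in> W" for x w
    using that stable adjacentD[OF h(2)] h(3) by (auto simp: N_def in_nbhd h(2) adjacent_sym)
  have adj: "adjacent H x y" if "b \<in> W" "c \<in> W" "b \<noteq> c" "x \<in> N b" "y \<in> N c" "x \<noteq> y" for b c x y
    using hub_clique_outside[OF hub k3 that(1-3)] that by (simp add: N_def)
  have full: "nbhd H x = S" if "x \<in> verts U" "card S = k" "\<And>u. u \<in> S \<Longrightarrow> adjacent H x u" "finite S" for x S
    using that same_degreesD(3)[OF h(1)] finite_nbhd[OF h(2)]
    by (intro card_subset_eq[symmetric]) (auto simp: in_nbhd h(2))
  \<comment> \<open>two vertices of \<open>W\<close> cannot have the same outer neighbourhood\<close>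
  have differ: "N w \<noteq> N w'" if w: "w \<in> W" "w' \<in> W" "w'' \<in> W" "w \<noteq> w'" "w'' \<noteq> w" "w'' \<noteq> w'" for w w' w''
  proof
    assume eq: "N w = N w'"
    have nb: "nbhd H x = (N w - {x}) \<union> {w, w'}" if x: "x \<in> N w" for x
    proof (rule full)
      show "x \<in> verts U" using NW x w by blast
      have "w \<notin> N w" "w' \<notin> N w" using NW(1) w by auto
      thus "card ((N w - {x}) \<union> {w, w'}) = k"
        using x finN[of w] cN[OF w(1)] w(4) k3 by simp
      show "adjacent H x u" if "u \<in> (N w - {x}) \<union> {w, w'}" for u
        using that adj[OF w(1,2,4), of x u] NW(3)[OF x w(1)] NW(3)[of x w'] x eq w by auto
    qed (use finN in simp)
    have "N w'' \<noteq> {}" using cN[OF w(3)] k3 by auto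
    then obtain y where y: "y \<in> N w''" by blast
    have yw: "y \<notin> {w, w', w''}" using NW(1)[OF y w(3)] w by auto
    have "y \<notin> N w"
    proof
      assume "y \<in> N w"
      hence "w'' \<in> (N w - {y}) \<union> {w, w'}"
        using nb NW(3)[OF y w(3)] by (auto simp: in_nbhd[OF h(2), symmetric])
      thus False using w NW(1)[of w'' w] by auto
    qed
    moreover have "N w \<noteq> {}" using cN[OF w(1)] k3 by auto
    then obtain x where x: "x \<in> N w" by blast
    ultimately have "adjacent H x y" using adj[OF w(1,3) _ x y] w by auto
    hence "y \<in> (N w - {x}) \<union> {w, w'}" using nb[OF x] by (auto simp: in_nbhd[OF h(2), symmetric])
    thus False using \<open>y \<notin> N w\<close> yw by auto
  qed
  have "3 \<le> card W" using h(12) k3 by simp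
  then obtain T where "T \<subseteq> W" "card T = 3" using obtain_subset_with_card_n by metis
  then obtain w1 w2 w3 where w: "w1 \<in> W" "w2 \<in> W" "w3 \<in> W" "w1 \<noteq> w2" "w2 \<noteq> w3" "w1 \<noteq> w3"
    by (auto simp: card_3_iff)
  have "\<not> N w1 \<subseteq> N w2"
    using differ[of w1 w2 w3] w card_subset_eq[OF finN, of "N w1" w2] cN by auto
  then obtain x where x: "x \<in> N w1" "x \<notin> N w2" by blast
  have nbx: "nbhd H x = insert w1 (N w2)"
  proof (rule full)
    show "x \<in> verts U" using NW x w by blast
    have "w1 \<notin> N w2" using NW(1)[of w1 w2] w by auto
    thus "card (insert w1 (N w2)) = k" using finN cN[OF w(2)] k3 by simp
    show "adjacent H x u" if "u \<in> insert w1 (N w2)" for u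
      using that NW(3)[OF x(1) w(1)] adj[OF w(1,2,4) x(1), of u] x by auto
  qed (use finN in simp)
  have "N w3 \<subseteq> N w2"
  proof
    fix y assume y: "y \<in> N w3"
    have "w3 \<notin> nbhd H x" using nbx w NW(1)[of w3 w2] by auto
    hence "x \<noteq> y" using NW(3)[OF y w(3)] by (auto simp: in_nbhd h(2))
    hence "y \<in> nbhd H x" using adj[OF w(1,3,6) x(1) y] by (simp add: in_nbhd h(2))
    moreover have "y \<noteq> w1" using NW(1)[OF y w(3)] w by auto
    ultimately show "y \<in> N w2" using nbx by auto
  qed
  hence "N w3 = N w2" using card_subset_eq[OF finN] cN w by metis
  thus False using differ[of w3 w2 w1] w by auto
qed

end

context sparse_regular
begin

text \<open>The path \<open>x b a d c y\<close> is so long that the switch replacing \<open>ab\<close> and \<open>cy\<close> by \<open>ac\<close> and \<open>by\<close>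
  closes the triangle \<open>a d c\<close> without destroying another triangle.\<close>

lemma long_path_impossible:
  assumes H: "same_degrees U H" and k2: "k = 2"
    and N: "nbhd H a = {d, b}" "nbhd H d = {a, c}" "nbhd H b = {a, x}" "nbhd H c = {d, y}"
    and dist: "distinct [a, b, c, d, x, y]"
  shows False
proof -
  have s: "simple_graph H" using same_degreesD[OF H] by blast
  have adj: "adjacent H u v \<longleftrightarrow> v \<in> nbhd H u" for u v by (simp add: in_nbhd s)
  have alt: "alternating H a b c y"
    using dist by (auto simp: alternating_def adj N)
  have "d \<in> nbhd H a \<inter> nbhd H c" using N by simp
  hence "codegree H a c \<ge> 1"
    unfolding codegree_def using finite_nbhd[OF s]
    by (metis One_nat_def Suc_leI card_gt_0_iff empty_iff finite_Int)
  moreover have "codegree H a b = 0" using dist by (simp add: codegree_def N)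
  moreover have "nbhd H c \<inter> nbhd H y = {}"
  proof -
    have "d \<notin> nbhd H y" using N(2) dist by (auto simp: adj[symmetric] adjacent_sym)
    moreover have "y \<notin> nbhd H y" by (simp add: in_nbhd s adjacent_irrefl)
    ultimately show ?thesis by (simp add: N(4))
  qed
  hence "codegree H c y = 0" by (simp add: codegree_def)
  moreover have "\<not> adjacent H a y" "\<not> adjacent H b c" using dist by (auto simp: adj N)
  ultimately show False using rigid_codegrees[OF rig H alt] by simp
qed

lemma impossible: False
proof -
  obtain H a d where H: "same_degrees U H" "adjacent H a d" "nbhd H a \<inter> nbhd H d = {}"
    using exists_disjoint_neighbours[OF simple deg k_ge sparse] by blast
  have s: "simple_graph H" and V: "verts H = verts U" using same_degreesD[OF H(1)] by auto
  have adj: "adjacent H u v \<longleftrightarrow> v \<in> nbhd H u" for u v by (simp add: in_nbhd s)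
  have nsym: "v \<in> nbhd H u \<longleftrightarrow> u \<in> nbhd H v" for u v unfolding adj[symmetric] by (rule adjacent_sym)
  have ad: "d \<in> nbhd H a" "a \<in> nbhd H d" using H(2) nsym adj by auto
  have "hub H a d (nbhd H a \<union> nbhd H d - {a, d})"
    unfolding hub_def using H ad by auto
  hence k2: "k = 2" using hub_impossible k_ge by fastforce
  have deg2: "card (nbhd H v) = 2" if "v \<in> verts U" for v using same_degreesD(3)[OF H(1) that] k2 by simp
  have pair: "\<exists>w. w \<noteq> u \<and> nbhd H v = {u, w}" if "v \<in> verts U" "u \<in> nbhd H v" for u v
    using deg2[OF that(1)] that(2) by (auto simp: card_2_iff)
  have inV: "v \<in> verts U" if "v \<in> nbhd H u" for u v using nbhd_subset[of H u] that V by blast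
  have irr: "v \<notin> nbhd H v" for v by (simp add: in_nbhd s adjacent_irrefl)
  obtain b where b: "b \<noteq> d" "nbhd H a = {d, b}" using pair[OF inV[OF ad(2)] ad(1)] by blast
  obtain c where c: "c \<noteq> a" "nbhd H d = {a, c}" using pair[OF inV[OF ad(1)] ad(2)] by blast
  have bV: "b \<in> verts U" "a \<in> nbhd H b" using b inV[of b a] nsym[of b a] by auto
  have cV: "c \<in> verts U" "d \<in> nbhd H c" using c inV[of c d] nsym[of c d] by auto
  obtain x where x: "x \<noteq> a" "nbhd H b = {a, x}" using pair[OF bV] by blast
  obtain y where y: "y \<noteq> d" "nbhd H c = {d, y}" using pair[OF cV] by blast
  have bc: "b \<noteq> c" "a \<noteq> d" "b \<noteq> a" "c \<noteq> d" using H(3) b c irr[of a] irr[of d] by auto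
  have xb: "x \<noteq> b" "x \<noteq> d" and yc: "y \<noteq> c" "y \<noteq> a"
    using irr[of b] irr[of c] x y nsym[of d b] nsym[of a c] b c bc by auto
  have outside: "\<exists>z\<in>verts U. z \<notin> set xs" if "length xs < 6" for xs
  proof -
    have "card (set xs) < card (verts U)" using card_length[of xs] that n6 by linarith
    hence "\<not> verts U \<subseteq> set xs" using card_mono[of "set xs" "verts U"] by auto
    thus ?thesis by blast
  qed
  show False
  proof (cases "x = c")
    case True
    \<comment> \<open>a four-cycle, opened by a switch with a remote edge\<close>
    have "b \<in> nbhd H c" using nsym[of b c] x(2) True by simp
    hence "y = b" using y(2) b(1) by simp
    hence xc: "nbhd H b = {a, c}" "nbhd H c = {d, b}" using x(2) y(2) True by simp_all
    obtain z where z: "z \<in> verts U" "z \<notin> {a, b, c, d}"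
      using outside[of "[a, b, c, d]"] by auto
    have "nbhd H z \<noteq> {}" using deg2[OF z(1)] by auto
    then obtain w where w: "w \<in> nbhd H z" by blast
    have wX: "w \<notin> {a, b, c, d}" "z \<noteq> w"
      using z w nsym[of w z] xc b(2) c(2) irr[of z] by auto
    have alt: "alternating H b c z w"
      using z w wX xc by (auto simp: alternating_def adj)
    let ?L = "switch H b c z w"
    have L: "same_degrees U ?L" using same_degrees_trans[OF H(1) same_degrees_switch[OF s alt]] .
    have nL: "nbhd ?L a = {d, b}" "nbhd ?L d = {a, c}" "nbhd ?L b = {a, z}" "nbhd ?L c = {d, w}"
      unfolding nbhd_switch[OF s alt] using b c xc z wX bc by auto
    show False
      by (rule long_path_impossible[OF L k2 nL]) (use z wX bc b c in auto)
  next
    case xc: False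
    have yb: "y \<noteq> b"
    proof
      assume "y = b"
      hence "c \<in> nbhd H b" using nsym[of c b] y(2) by simp
      thus False using x(2) c(1) xc by simp
    qed
    show False
    proof (cases "x = y")
      case False
      show False
        by (rule long_path_impossible[OF H(1) k2 b(2) c(2) x(2) y(2)])
          (use xc yb bc xb yc x y b c False in auto)
    next
      case True
      \<comment> \<open>a five-cycle, opened in the same way\<close>
      have nx: "nbhd H x = {b, c}"
      proof -
        have "b \<in> nbhd H x" "c \<in> nbhd H x" using x y True nsym[of x b] nsym[of x c] by auto
        moreover have "x \<in> verts U" using inV[of x b] x by simp
        ultimately show ?thesis using pair[of x b] bc by auto
      qed
      obtain z where z: "z \<in> verts U" "z \<notin> {a, b, c, d, x}"
        using outside[of "[a, b, c, d, x]"] by auto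
      have "nbhd H z \<noteq> {}" using deg2[OF z(1)] by auto
      then obtain w where w: "w \<in> nbhd H z" by blast
      have wX: "w \<notin> {a, b, c, d, x}" "z \<noteq> w"
        using z w nsym[of w z] x y nx True b(2) c(2) irr[of z] by auto
      have alt: "alternating H b x z w"
        using z w wX x nx by (auto simp: alternating_def adj)
      let ?L = "switch H b x z w"
      have L: "same_degrees U ?L" using same_degrees_trans[OF H(1) same_degrees_switch[OF s alt]] .
      have nL: "nbhd ?L a = {d, b}" "nbhd ?L d = {a, c}" "nbhd ?L b = {a, z}" "nbhd ?L c = {d, x}"
        unfolding nbhd_switch[OF s alt] using b c x y xc xb yc yb True z wX bc by auto
      show False
        by (rule long_path_impossible[OF L k2 nL]) (use z wX bc b c x xb xc in auto)
    qed
  qed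
qed

end

section \<open>Classification of the rigid indecomposable nonsplit graphs\<close>

lemma nonsplit_card:
  assumes "simple_graph G" "\<not> split_graph G"
  shows "card (verts G) \<ge> 4"
proof -
  note V = adjacentD[OF assms(1)]
  have "\<exists>a b c d. distinct [a, b, c, d] \<and> {a, b, c, d} \<subseteq> verts G"
    using nonsplit_obstruction[OF assms]
  proof (elim disjE exE)
    assume "has_2K2 G"
    then obtain a b c d where *: "adjacent G a b" "adjacent G c d" "a \<noteq> c" "a \<noteq> d" "b \<noteq> c" "b \<noteq> d"
      unfolding has_2K2_def by blast
    thus ?thesis using V[OF *(1)] V[OF *(2)]
      by (intro exI[of _ a] exI[of _ b] exI[of _ c] exI[of _ d]) simp
  next
    assume "has_C4 G"
    then obtain a b c d where *: "a \<noteq> c" "b \<noteq> d" "adjacent G a b" "adjacent G b c"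
      "adjacent G c d" "adjacent G d a"
      unfolding has_C4_def by blast
    thus ?thesis using V[OF *(3)] V[OF *(4)] V[OF *(5)] V[OF *(6)]
      by (intro exI[of _ a] exI[of _ b] exI[of _ c] exI[of _ d]) auto
  next
    fix a b c d e assume "is_C5 G a b c d e"
    hence *: "distinct [a, b, c, d]" "adjacent G a b" "adjacent G c d" by (auto simp: is_C5_def)
    thus ?thesis using V[OF *(2)] V[OF *(3)]
      by (intro exI[of _ a] exI[of _ b] exI[of _ c] exI[of _ d]) simp
  qed
  then obtain a b c d where *: "distinct [a, b, c, d]" "{a, b, c, d} \<subseteq> verts G" by blast
  show ?thesis
    using card_mono[OF finite_verts[OF assms(1)] *(2)] *(1) by simp
qed

text \<open>The nonsplit part of the classification of unigraphs: a star and a matching, a four-cycle and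
  triangles sharing a vertex, the complements of these, and the five-cycle. Only the degrees are
  recorded.\<close>

theorem rigid_classification:
  assumes "rigid U" "\<not> split_graph U" "\<not> decomposable U"
  defines "n \<equiv> card (verts U)"
  shows "(\<exists>c\<in>verts U. \<forall>v\<in>verts U - {c}. degree U v = 1) \<or>
    (\<exists>c\<in>verts U. \<forall>v\<in>verts U - {c}. degree U v + 2 = n) \<or>
    (\<exists>c\<in>verts U. degree U c + 2 = n \<and> (\<forall>v\<in>verts U - {c}. degree U v = 2)) \<or>
    (\<exists>c\<in>verts U. degree U c = 1 \<and> (\<forall>v\<in>verts U - {c}. degree U v + 3 = n)) \<or>
    n = 5 \<and> (\<forall>v\<in>verts U. degree U v = 2)" (is ?goal)
proof -
  have s: "simple_graph U" using assms by (simp add: rigid_def)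
  have n4: "n \<ge> 4" unfolding n_def by (rule nonsplit_card[OF s assms(2)])
  have bounds: "1 \<le> degree U v" "degree U v + 2 \<le> n" if "v \<in> verts U" for v
    using indecomposable_degree_bounds[OF s assms(3) _ that] n4 by (auto simp: n_def)
  obtain v0 where v0: "v0 \<in> verts U" using n4 by (fastforce simp: n_def)
  from rigid_one_exception[OF assms(1-3)] show ?goal
  proof cases
    case (1 k)
    have kb: "1 \<le> k" "k + 2 \<le> n" using bounds[OF v0] 1[OF v0] by auto
    show ?goal
    proof (cases "k = 1 \<or> k + 2 = n")
      case True
      thus ?goal using 1 v0 by auto
    next
      case False
      hence k: "2 \<le> k" "k + 3 \<le> n" using kb by auto
      have "n < 6"
      proof (rule ccontr)
        assume "\<not> n < 6"
        hence n6: "6 \<le> n" by simp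
        show False
        proof (cases "2 * k + 1 \<le> n")
          case True
          interpret sparse_regular U k
            by unfold_locales (use assms(1) 1 k True n6 in \<open>auto simp: n_def\<close>)
          show False by (rule impossible)
        next
          case False
          interpret sparse_regular "co U" "n - 1 - k"
            by unfold_locales
              (use rigid_co[OF assms(1)] 1 k False n6 degree_co[OF s] in \<open>auto simp: n_def\<close>)
          show False by (rule impossible)
        qed
      qed
      hence "n = 5" "k = 2" using k by auto
      thus ?goal using 1 by auto
    qed
  next
    case (2 k c)
    have "card (verts U - {c}) \<noteq> 0" using n4 2(1) finite_verts[OF s] by (simp add: n_def)
    hence "verts U - {c} \<noteq> {}" by (metis card.empty)
    then obtain v where v: "v \<in> verts U - {c}" by blast
    have kb: "1 \<le> k" "k + 2 \<le> n" using bounds[of v] 2(3)[OF v] v by auto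
    show ?goal
    proof (cases "k = 1 \<or> k + 2 = n")
      case True
      have all: "\<forall>v\<in>verts U - {c}. degree U v = k" using 2(3) by blast
      from True show ?goal
      proof
        assume "k = 1"
        thus ?goal using all 2(1) by blast
      next
        assume "k + 2 = n"
        hence "\<forall>v\<in>verts U - {c}. degree U v + 2 = n" using all by simp
        thus ?goal using 2(1) by blast
      qed
    next
      case False
      interpret exceptional_vertex U c k
        by unfold_locales (use assms(1) 2 kb False bounds in \<open>auto simp: n_def\<close>)
      have all: "\<forall>v\<in>verts U - {c}. degree U v = k" using 2(3) by blast
      from exceptional_degrees[OF assms(2)] show ?goal
      proof
        assume "k = 2 \<and> degree U c + 2 = card (verts U)"
        thus ?goal using all 2(1) unfolding n_def by blast
      next
        assume "k + 3 = card (verts U) \<and> degree U c = 1"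
        hence "degree U c = 1" "\<forall>v\<in>verts U - {c}. degree U v + 3 = n" using all by (simp_all add: n_def)
        thus ?goal using 2(1) by blast
      qed
    qed
  qed
qed

section \<open>Induced subgraphs of unigraphs\<close>

lemma isomorphic_split:
  assumes "isomorphic G H" "simple_graph H" "split_graph G"
  shows "split_graph H"
proof -
  obtain f where f: "graph_iso f G H" using assms(1) by (auto simp: isomorphic_iff)
  obtain K S where KS: "verts G = K \<union> S" "K \<inter> S = {}" "clique G K" "stable G S"
    using assms(3) by (auto simp: split_graph_def KS_partition_def)
  have inj: "inj_on f (verts G)" and im: "f ` verts G = verts H"
    using f by (auto simp: graph_iso_def bij_betw_def)
  have adj: "adjacent H (f x) (f y) \<longleftrightarrow> adjacent G x y" if "x \<in> verts G" "y \<in> verts G" for x y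
    using f that by (auto simp: graph_iso_def)
  show ?thesis
  proof (rule split_graphI[OF assms(2)])
    show "verts H = f ` K \<union> f ` S" using im KS(1) by blast
    show "f ` K \<inter> f ` S = {}" using inj KS(1,2) inj_on_image_Int[of f "verts G" K S] by auto
    show "adjacent H x y" if xy: "x \<in> f ` K" "y \<in> f ` K" "x \<noteq> y" for x y
    proof -
      obtain u v where "x = f u" "y = f v" "u \<in> K" "v \<in> K" using xy by blast
      thus ?thesis using adj[of u v] KS xy(3) by (auto simp: clique_def)
    qed
    show "\<not> adjacent H x y" if xy: "x \<in> f ` S" "y \<in> f ` S" for x y
    proof -
      obtain u v where "x = f u" "y = f v" "u \<in> S" "v \<in> S" using xy by blast
      thus ?thesis using adj[of u v] KS by (auto simp: stable_def)
    qed
  qed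
qed

lemma isomorphic_decomposable:
  assumes "isomorphic G H" "simple_graph G" "simple_graph H" "decomposable G"
  shows "decomposable H"
proof -
  obtain f where f: "graph_iso f G H" using assms(1) by (auto simp: isomorphic_iff)
  obtain K S C where d: "decomposes G K S C" and ne: "K \<union> S \<noteq> {}" "C \<noteq> {}"
    using assms(4) decomposable_iff[OF assms(2)] by blast
  have inj: "inj_on f (verts G)" and im: "f ` verts G = verts H"
    using f by (auto simp: graph_iso_def bij_betw_def)
  have adj: "adjacent H (f x) (f y) \<longleftrightarrow> adjacent G x y" if "x \<in> verts G" "y \<in> verts G" for x y
    using f that by (auto simp: graph_iso_def)
  have sub: "K \<subseteq> verts G" "S \<subseteq> verts G" "C \<subseteq> verts G" using d by (auto simp: decomposes_def)
  have disj: "f ` X \<inter> f ` Y = {}" if "X \<subseteq> verts G" "Y \<subseteq> verts G" "X \<inter> Y = {}" for X Y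
    using inj_on_image_Int[OF inj that(1,2)] that(3) by simp
  have "decomposes H (f ` K) (f ` S) (f ` C)"
    unfolding decomposes_def clique_def stable_def
  proof (intro conjI ballI impI)
    show "verts H = f ` K \<union> f ` S \<union> f ` C" using im d by (auto simp: decomposes_def)
    show "f ` K \<inter> f ` S = {}" "f ` K \<inter> f ` C = {}" "f ` S \<inter> f ` C = {}"
      using disj sub d by (auto simp: decomposes_def)
    show "f ` K \<subseteq> verts H" "f ` S \<subseteq> verts H" using im sub by auto
    show "adjacent H x y" if xy: "x \<in> f ` K" "y \<in> f ` K" "x \<noteq> y" for x y
    proof -
      obtain u v where "x = f u" "y = f v" "u \<in> K" "v \<in> K" using xy by blast
      thus ?thesis using adj[of u v] d sub xy(3) by (auto simp: decomposes_def clique_def)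
    qed
    show "\<not> adjacent H x y" if xy: "x \<in> f ` S" "y \<in> f ` S" for x y
    proof -
      obtain u v where "x = f u" "y = f v" "u \<in> S" "v \<in> S" using xy by blast
      thus ?thesis using adj[of u v] d sub by (auto simp: decomposes_def stable_def)
    qed
    show "adjacent H x y" if xy: "x \<in> f ` K" "y \<in> f ` C" for x y
    proof -
      obtain u v where "x = f u" "y = f v" "u \<in> K" "v \<in> C" using xy by blast
      thus ?thesis using adj[of u v] d sub by (auto simp: decomposes_def)
    qed
    show "\<not> adjacent H x y" if xy: "x \<in> f ` S" "y \<in> f ` C" for x y
    proof -
      obtain u v where "x = f u" "y = f v" "u \<in> S" "v \<in> C" using xy by blast
      thus ?thesis using adj[of u v] d sub by (auto simp: decomposes_def)
    qed
  qed
  thus ?thesis using ne decomposable_iff[OF assms(3)] by blast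
qed

lemma split_induced:
  assumes "split_graph G" "W \<subseteq> verts G"
  shows "split_graph (induced G W)"
proof -
  obtain K S where KS: "simple_graph G" "verts G = K \<union> S" "K \<inter> S = {}" "clique G K" "stable G S"
    using assms(1) by (auto simp: split_graph_def KS_partition_def)
  show ?thesis
  proof (rule split_graphI[OF simple_induced[OF KS(1) assms(2)]])
    show "verts (induced G W) = (K \<inter> W) \<union> (S \<inter> W)" "(K \<inter> W) \<inter> (S \<inter> W) = {}"
      using KS assms(2) by auto
  qed (use KS in \<open>auto simp: adjacent_induced clique_def stable_def\<close>)
qed

text \<open>A decomposition induces one of every induced subgraph, which therefore is trivial if the
  subgraph is indecomposable. The subgraph does not lie in the split factor, so it lies in the
  core.\<close>

lemma core_absorbs:
  assumes "simple_graph H" "decomposes H K S C" "Z \<subseteq> verts H"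
    "\<not> split_graph (induced H Z)" "\<not> decomposable (induced H Z)"
  shows "Z \<subseteq> C"
proof -
  have s: "simple_graph (induced H Z)" by (rule simple_induced[OF assms(1,3)])
  have d: "decomposes (induced H Z) (K \<inter> Z) (S \<inter> Z) (C \<inter> Z)"
    using assms(2,3) by (auto simp: decomposes_def clique_def stable_def adjacent_induced)
  have "C \<inter> Z \<noteq> {}"
  proof
    assume "C \<inter> Z = {}"
    hence "split_graph (induced H Z)"
      using d by (intro split_graphI[OF s, of "K \<inter> Z" "S \<inter> Z"])
        (auto simp: decomposes_def clique_def stable_def)
    thus False using assms(4) by blast
  qed
  hence "K \<inter> Z \<union> S \<inter> Z = {}" using d assms(5) decomposable_iff[OF s] by blast
  thus ?thesis using assms(2,3) by (auto simp: decomposes_def)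
qed

lemma graph_iso_induced:
  assumes "graph_iso f G H" "Z \<subseteq> verts G"
  shows "graph_iso f (induced G Z) (induced H (f ` Z))"
  using assms unfolding graph_iso_def bij_betw_def
  by (auto simp: adjacent_induced intro: inj_on_subset)

lemma decomposes_trans:
  assumes "decomposes U K S C" "decomposes (induced U C) K' S' C'"
  shows "decomposes U (K \<union> K') (S \<union> S') C'"
proof -
  have C: "C = K' \<union> S' \<union> C'" using assms(2) by (simp add: decomposes_def)
  have 1: "adjacent U x y" if "x \<in> K" "y \<in> C" for x y using assms(1) that by (simp add: decomposes_def)
  have 2: "\<not> adjacent U x y" if "x \<in> S" "y \<in> C" for x y using assms(1) that by (simp add: decomposes_def)
  show ?thesis
    unfolding decomposes_def clique_def stable_def
  proof (intro conjI ballI impI)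
    show "adjacent U x y" if "x \<in> K \<union> K'" "y \<in> K \<union> K'" "x \<noteq> y" for x y
      using that assms 1[of x y] 1[of y x] C adjacent_sym[of U x y]
      by (auto simp: decomposes_def clique_def adjacent_induced)
    show "\<not> adjacent U x y" if "x \<in> S \<union> S'" "y \<in> S \<union> S'" for x y
      using that assms 2[of x y] 2[of y x] C adjacent_sym[of U x y]
      by (auto simp: decomposes_def stable_def adjacent_induced)
    show "adjacent U x y" if "x \<in> K \<union> K'" "y \<in> C'" for x y
      using that assms 1[of x y] C by (auto simp: decomposes_def adjacent_induced)
    show "\<not> adjacent U x y" if "x \<in> S \<union> S'" "y \<in> C'" for x y
      using that assms 2[of x y] C by (auto simp: decomposes_def adjacent_induced)
  qed (use assms C in \<open>auto simp: decomposes_def\<close>)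
qed

text \<open>A realization of the degrees of the core extends to one of the whole graph, and the extension
  decomposes with the same core set \<open>C\<close>. The isomorphism maps \<open>C\<close> to a nonsplit indecomposable
  subgraph, which is absorbed by \<open>C\<close> and hence, by cardinality, equal to it.\<close>

lemma rigid_core:
  assumes "rigid U" "decomposes U K S C"
    "\<not> split_graph (induced U C)" "\<not> decomposable (induced U C)"
  shows "rigid (induced U C)"
  unfolding rigid_def
proof (intro conjI allI impI)
  have s: "simple_graph U" using assms(1) by (simp add: rigid_def)
  have C: "C \<subseteq> verts U" using assms(2) by (auto simp: decomposes_def)
  have finC: "finite C" using C s finite_verts finite_subset by metis
  show sC: "simple_graph (induced U C)" by (rule simple_induced[OF s C])
  fix h assume h: "same_degrees (induced U C) h"
  hence sh: "simple_graph h" "verts h = C" by (auto simp: same_degrees_def)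
  let ?H = "splice U h"
  have sH: "simple_graph ?H" by (rule simple_splice[OF s])
  have H: "same_degrees U ?H" by (rule same_degrees_splice[OF s C h])
  have adj: "adjacent ?H x y \<longleftrightarrow> adjacent U x y" if "x \<notin> C \<or> y \<notin> C" for x y
    using adjacent_splice[OF s sh(1)] sh(2) C that by auto
  have KSC: "verts U = K \<union> S \<union> C" "K \<inter> S = {}" "K \<inter> C = {}" "S \<inter> C = {}"
    using assms(2) by (auto simp: decomposes_def)
  have dH: "decomposes ?H K S C"
    unfolding decomposes_def clique_def stable_def
  proof (intro conjI ballI impI)
    show "adjacent ?H x y" if "x \<in> K" "y \<in> K" "x \<noteq> y" for x y
      using adj[of x y] that KSC assms(2) by (auto simp: decomposes_def clique_def)
    show "\<not> adjacent ?H x y" if "x \<in> S" "y \<in> S" for x y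
      using adj[of x y] that KSC assms(2) by (auto simp: decomposes_def stable_def)
    show "adjacent ?H x y" if "x \<in> K" "y \<in> C" for x y
      using adj[of x y] that KSC assms(2) by (auto simp: decomposes_def)
    show "\<not> adjacent ?H x y" if "x \<in> S" "y \<in> C" for x y
      using adj[of x y] that KSC assms(2) by (auto simp: decomposes_def)
  qed (use KSC in auto)
  obtain f where f: "graph_iso f U ?H" using assms(1) H by (auto simp: rigid_def isomorphic_iff)
  have inj: "inj_on f (verts U)" and im: "f ` verts U = verts ?H"
    using f by (auto simp: graph_iso_def bij_betw_def)
  have fC: "f ` C \<subseteq> verts ?H" using C im by blast
  have iso: "graph_iso f (induced U C) (induced ?H (f ` C))" by (rule graph_iso_induced[OF f C])
  hence iso': "isomorphic (induced ?H (f ` C)) (induced U C)"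
    using isomorphic_iff isomorphic_sym by blast
  have sf: "simple_graph (induced ?H (f ` C))" by (rule simple_induced[OF sH fC])
  have "f ` C \<subseteq> C"
    by (rule core_absorbs[OF sH dH fC])
      (use isomorphic_split[OF iso' sC] isomorphic_decomposable[OF iso' sf sC] assms(3,4) in blast)+
  hence "f ` C = C" using inj_on_image_eq_if_closed[OF finC inj_on_subset[OF inj C]] by blast
  hence "graph_iso f (induced U C) h"
    using iso induced_splice[OF s sh(1)] sh(2) C by simp
  thus "isomorphic (induced U C) h" by (auto simp: isomorphic_iff)
qed

lemma degree_seq_eq_mset:
  "degree_seq G = degree_seq H \<longleftrightarrow>
    image_mset (degree G) (mset_set (verts G)) = image_mset (degree H) (mset_set (verts H))"
  unfolding degree_seq_def by (metis mset_sorted_list_of_multiset rev_rev_ident)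

lemma same_degrees_degree_seq:
  assumes "simple_graph U" "same_degrees U H"
  shows "degree_seq H = degree_seq U"
proof -
  have "image_mset (degree H) (mset_set (verts U)) = image_mset (degree U) (mset_set (verts U))"
    using assms by (intro image_mset_cong) (auto simp: same_degrees_def finite_verts)
  thus ?thesis using assms(2) by (simp add: degree_seq_eq_mset same_degrees_def)
qed

lemma unigraph_rigid: "unigraph U \<Longrightarrow> rigid U"
  unfolding unigraph_def rigid_def
  using same_degrees_degree_seq[of U] unfolding same_degrees_def by blast

text \<open>The smallest core that contains \<open>W\<close> is indecomposable, because a decomposition of the core would
  refine the given one, and its core would still absorb \<open>W\<close>.\<close>

lemma exists_indecomposable_core:
  assumes "rigid U" "W \<subseteq> verts U" "\<not> split_graph (induced U W)" "\<not> decomposable (induced U W)"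
  obtains C where "W \<subseteq> C" "C \<subseteq> verts U" "rigid (induced U C)" "\<not> split_graph (induced U C)"
    "\<not> decomposable (induced U C)"
proof -
  have s: "simple_graph U" using assms(1) by (simp add: rigid_def)
  define good where "good = (\<lambda>C. W \<subseteq> C \<and> (\<exists>K S. decomposes U K S C))"
  have "good (verts U)"
    unfolding good_def using assms(2)
    by (intro conjI exI[of _ "{}"]) (auto simp: decomposes_def clique_def stable_def)
  then obtain C where C: "good C" "\<forall>C'. good C' \<longrightarrow> card C \<le> card C'"
    using ex_has_least_nat[of good "verts U" card] by auto
  obtain K S where d: "decomposes U K S C" and WC: "W \<subseteq> C" using C(1) by (auto simp: good_def)
  have CU: "C \<subseteq> verts U" using d by (auto simp: decomposes_def)
  have finC: "finite C" using CU s finite_verts finite_subset by metis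
  have sC: "simple_graph (induced U C)" by (rule simple_induced[OF s CU])
  have nonsplit: "\<not> split_graph (induced U C)"
    using split_induced[of "induced U C" W] assms(3) WC by (auto simp: induced_induced)
  have indec: "\<not> decomposable (induced U C)"
  proof
    assume "decomposable (induced U C)"
    then obtain K' S' C' where d': "decomposes (induced U C) K' S' C'" "K' \<union> S' \<noteq> {}"
      using decomposable_iff[OF sC] by blast
    have "W \<subseteq> C'"
      by (rule core_absorbs[OF sC d'(1)]) (use WC assms(3,4) in \<open>auto simp: induced_induced\<close>)
    hence "good C'" using decomposes_trans[OF d d'(1)] by (auto simp: good_def)
    moreover have "C' \<subset> C" using d' unfolding decomposes_def verts_induced by blast
    ultimately show False using C(2) psubset_card_mono[OF finC \<open>C' \<subset> C\<close>] by (simp add: leD)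
  qed
  show ?thesis
    by (rule that[OF WC CU rigid_core[OF assms(1) d nonsplit indec] nonsplit indec])
qed

section \<open>The degree conditions and their inheritance\<close>

text \<open>The degree conditions of the theorem for a single graph, in terms of its vertices. The third and
  the fourth alternative describe the induced subgraphs of the corresponding unigraphs, where
  some degrees may have dropped (in the complement, respectively).\<close>

definition hcu_degrees :: "'a ugraph \<Rightarrow> bool" where
  "hcu_degrees G \<longleftrightarrow> (let V = verts G; n = card V; d = degree G in
     (\<exists>c\<in>V. \<forall>v\<in>V - {c}. d v = 1) \<or>
     (\<exists>c\<in>V. \<forall>v\<in>V - {c}. d v + 2 = n) \<or>
     (\<exists>c\<in>V. d c + 2 = n \<and> (\<forall>v\<in>V - {c}. d v \<le> 2) \<and> (\<exists>v\<in>V - {c}. d v = 2)) \<or>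
     (\<exists>c\<in>V. d c = 1 \<and> (\<forall>v\<in>V - {c}. n \<le> d v + 3) \<and> (\<exists>v\<in>V - {c}. d v + 3 = n)) \<or>
     n = 5 \<and> (\<forall>v\<in>V. d v = 2))"

lemma hcu_degreesI:
  "c \<in> verts G \<Longrightarrow> \<forall>v\<in>verts G - {c}. degree G v = 1 \<Longrightarrow> hcu_degrees G"
  "c \<in> verts G \<Longrightarrow> \<forall>v\<in>verts G - {c}. degree G v + 2 = card (verts G) \<Longrightarrow> hcu_degrees G"
  "c \<in> verts G \<Longrightarrow> degree G c + 2 = card (verts G) \<Longrightarrow> \<forall>v\<in>verts G - {c}. degree G v \<le> 2 \<Longrightarrow>
     \<exists>v\<in>verts G - {c}. degree G v = 2 \<Longrightarrow> hcu_degrees G"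
  "c \<in> verts G \<Longrightarrow> degree G c = 1 \<Longrightarrow> \<forall>v\<in>verts G - {c}. card (verts G) \<le> degree G v + 3 \<Longrightarrow>
     \<exists>v\<in>verts G - {c}. degree G v + 3 = card (verts G) \<Longrightarrow> hcu_degrees G"
  "card (verts G) = 5 \<Longrightarrow> \<forall>v\<in>verts G. degree G v = 2 \<Longrightarrow> hcu_degrees G"
  unfolding hcu_degrees_def Let_def by blast+

text \<open>The first two and the next two alternatives are complementary to each other; the five-cycle is
  self-complementary.\<close>

lemma hcu_degreesE:
  assumes "hcu_degrees G"
  obtains (one) c where "c \<in> verts G" "\<forall>v\<in>verts G - {c}. degree G v = 1"
  | (co_one) c where "c \<in> verts G" "\<forall>v\<in>verts G - {c}. degree G v + 2 = card (verts G)"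
  | (two) c where "c \<in> verts G" "degree G c + 2 = card (verts G)" "\<forall>v\<in>verts G - {c}. degree G v \<le> 2"
      "\<exists>v\<in>verts G - {c}. degree G v = 2"
  | (co_two) c where "c \<in> verts G" "degree G c = 1" "\<forall>v\<in>verts G - {c}. card (verts G) \<le> degree G v + 3"
      "\<exists>v\<in>verts G - {c}. degree G v + 3 = card (verts G)"
  | (pentagon) "card (verts G) = 5" "\<forall>v\<in>verts G. degree G v = 2"
  using assms unfolding hcu_degrees_def Let_def by blast

lemma hcu_degrees_co:
  assumes s: "simple_graph G" and n: "3 \<le> card (verts G)" and G: "hcu_degrees G"
  shows "hcu_degrees (co G)"
  using G
proof (cases rule: hcu_degreesE)
  case (one c)
  thus ?thesis using degree_co[OF s] n by (intro hcu_degreesI(2)[of c]) auto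
next
  case (co_one c)
  have "degree (co G) v = 1" if v: "v \<in> verts G - {c}" for v
  proof -
    have "degree G v + 2 = card (verts G)" using co_one(2) v by blast
    thus ?thesis using degree_co[OF s, of v] v by simp
  qed
  thus ?thesis using co_one(1) by (intro hcu_degreesI(1)[of c]) auto
next
  case (two c)
  obtain v where v: "v \<in> verts G - {c}" "degree G v = 2" using two(4) by blast
  show ?thesis
  proof (rule hcu_degreesI(4)[of c])
    show "degree (co G) c = 1" using degree_co[OF s two(1)] two(2) by simp
    show "\<forall>v\<in>verts (co G) - {c}. card (verts (co G)) \<le> degree (co G) v + 3"
    proof
      fix v assume v: "v \<in> verts (co G) - {c}"
      hence "degree G v \<le> 2" "v \<in> verts G" using two(3) by auto
      thus "card (verts (co G)) \<le> degree (co G) v + 3" using degree_co[OF s, of v] n by simp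
    qed
    show "\<exists>v\<in>verts (co G) - {c}. degree (co G) v + 3 = card (verts (co G))"
      using v degree_co[OF s, of v] n by (intro bexI[of _ v]) auto
  qed (use two in simp)
next
  case (co_two c)
  obtain v where v: "v \<in> verts G - {c}" "degree G v + 3 = card (verts G)" using co_two(4) by blast
  show ?thesis
  proof (rule hcu_degreesI(3)[of c])
    show "degree (co G) c + 2 = card (verts (co G))" using degree_co[OF s co_two(1)] co_two(2) n by simp
    show "\<forall>v\<in>verts (co G) - {c}. degree (co G) v \<le> 2"
    proof
      fix v assume v: "v \<in> verts (co G) - {c}"
      hence "card (verts G) \<le> degree G v + 3" "v \<in> verts G" using co_two(3) by auto
      thus "degree (co G) v \<le> 2" using degree_co[OF s, of v] n by simp
    qed
    show "\<exists>v\<in>verts (co G) - {c}. degree (co G) v = 2"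
      using v degree_co[OF s, of v] n by (intro bexI[of _ v]) auto
  qed (use co_two in simp)
next
  case pentagon
  thus ?thesis using degree_co[OF s] by (intro hcu_degreesI(5)) auto
qed

lemma degree_induced_le:
  assumes "simple_graph U" "W \<subseteq> verts U" "v \<in> W"
  shows "degree (induced U W) v \<le> degree U v"
  using degree_induced[OF assms] card_mono[OF finite_nbhd[OF assms(1)], of "nbhd U v \<inter> W" v]
  by (simp add: degree_nbhd)

lemma induced_near_matching:
  assumes s: "simple_graph U" and W: "W \<subseteq> verts U" "W \<noteq> {}"
    and bnd: "\<And>v. v \<in> W \<Longrightarrow> 1 \<le> degree (induced U W) v"
    and le: "\<And>v. v \<in> W - {c} \<Longrightarrow> degree (induced U W) v \<le> 1"
  shows "hcu_degrees (induced U W)"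
proof -
  have all: "degree (induced U W) v = 1" if "v \<in> W - {c}" for v
    using bnd[of v] le[OF that] that by simp
  show ?thesis
  proof (cases "c \<in> W")
    case True
    thus ?thesis using all by (intro hcu_degreesI(1)[of c]) auto
  next
    case False
    obtain c' where "c' \<in> W" using W(2) by blast
    thus ?thesis using all False by (intro hcu_degreesI(1)[of c']) auto
  qed
qed

text \<open>Let \<open>w\<close> be the only non-neighbour of \<open>c\<close>. If \<open>c\<close> is missing in the subgraph, every vertex except
  \<open>w\<close> has lost a neighbour. If \<open>c\<close> is present, it still has at most one non-neighbour, and
  exactly one since it does not dominate.\<close>

lemma induced_degree_two_type:
  assumes s: "simple_graph U" and c: "c \<in> verts U" "degree U c + 2 = card (verts U)"
    "\<forall>v\<in>verts U - {c}. degree U v = 2"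
    and W: "W \<subseteq> verts U" "W \<noteq> {}"
    and bnd: "\<And>v. v \<in> W \<Longrightarrow> 1 \<le> degree (induced U W) v"
      "\<And>v. v \<in> W \<Longrightarrow> degree (induced U W) v + 2 \<le> card W"
  shows "hcu_degrees (induced U W)"
proof -
  let ?G = "induced U W"
  have finU: "finite (verts U)" by (rule finite_verts[OF s])
  have finW: "finite W" using W finU finite_subset by blast
  have "card (verts U - {c} - nbhd U c) = 1"
  proof -
    have "nbhd U c \<subseteq> verts U - {c}"
      using adjacentD[OF s] adjacent_irrefl[OF s] by (auto simp: in_nbhd s)
    thus ?thesis using c(1,2) finU finite_nbhd[OF s, of c] by (simp add: card_Diff_subset degree_nbhd)
  qed
  then obtain w where w: "verts U - {c} - nbhd U c = {w}" by (auto simp: card_1_singleton_iff)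
  show ?thesis
  proof (cases "c \<in> W")
    case False
    show ?thesis
    proof (rule induced_near_matching[OF s W bnd(1), of w])
      fix v assume v: "v \<in> W - {w}"
      hence "v \<in> nbhd U c" using w W False by auto
      hence "c \<in> nbhd U v" by (simp add: in_nbhd s adjacent_sym)
      moreover have "v \<in> verts U - {c}" using v W(1) False by blast
      hence "degree U v = 2" using c(3) by blast
      ultimately have "card (nbhd U v - {c}) = 1" by (simp add: degree_nbhd)
      moreover have "nbhd U v \<inter> W \<subseteq> nbhd U v - {c}" using False by blast
      ultimately have "card (nbhd U v \<inter> W) \<le> 1"
        using card_mono[of "nbhd U v - {c}" "nbhd U v \<inter> W"] finite_nbhd[OF s] by simp
      thus "degree ?G v \<le> 1" using degree_induced[OF s W(1)] v by simp
    qed auto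
  next
    case True
    have le2: "degree ?G v \<le> 2" if "v \<in> W - {c}" for v
      using degree_induced_le[OF s W(1), of v] c(3) that W by auto
    show ?thesis
    proof (cases "\<exists>v\<in>W - {c}. degree ?G v = 2")
      case two: True
      have "W - {c, w} \<subseteq> nbhd U c \<inter> W" using w W by auto
      hence "card (W - {c, w}) \<le> degree ?G c"
        using degree_induced[OF s W(1) True] finW by (simp add: card_mono)
      moreover have "card W \<le> card (W - {c, w}) + card {c, w}"
        using card_Diff_subset_Int[of W "{c, w}"] finW card_mono[of "{c, w}" "W \<inter> {c, w}"] by simp
      moreover have "card {c, w} \<le> 2" by (simp add: card_insert_if)
      ultimately have "degree ?G c + 2 = card W" using bnd(2)[OF True] by linarith
      thus ?thesis using True le2 two by (intro hcu_degreesI(3)[of c]) auto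
    next
      case False
      show ?thesis
      proof (rule induced_near_matching[OF s W bnd(1), of c])
        fix v assume v: "v \<in> W - {c}"
        thus "degree ?G v \<le> 1" using le2[OF v] False by (metis One_nat_def le_SucE numeral_2_eq_2)
      qed auto
    qed
  qed
qed

text \<open>A 2-regular graph on five vertices contains neither of the two obstructions on four vertices, so
  a nonsplit induced subgraph is an induced five-cycle and uses all vertices.\<close>

lemma induced_pentagon:
  assumes s: "simple_graph U" and n: "card (verts U) = 5" and deg: "\<And>v. v \<in> verts U \<Longrightarrow> degree U v = 2"
    and W: "W \<subseteq> verts U" and nonsplit: "\<not> split_graph (induced U W)"
  shows "hcu_degrees (induced U W)"
proof -
  let ?G = "induced U W"
  have sG: "simple_graph ?G" by (rule simple_induced[OF s W])
  have adj: "adjacent U x y" "x \<in> W" "y \<in> W" if "adjacent ?G x y" for x y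
    using that by (auto simp: adjacent_induced)
  have finU: "finite (verts U)" by (rule finite_verts[OF s])
  have nb: "nbhd U v = {x, y}" if "adjacent U v x" "adjacent U v y" "x \<noteq> y" for v x y
  proof -
    have "v \<in> verts U" using adjacentD(1)[OF s that(1)] .
    hence "card (nbhd U v) = card {x, y}" using deg that(3) by (simp add: degree_nbhd)
    moreover have "{x, y} \<subseteq> nbhd U v" using that by (simp add: in_nbhd s)
    ultimately show ?thesis using card_subset_eq[OF finite_nbhd[OF s, of v]] by metis
  qed
  have fifth: "\<exists>e. verts U = {a, b, c, d, e} \<and> e \<notin> {a, b, c, d}"
    if "distinct [a, b, c, d]" "{a, b, c, d} \<subseteq> verts U" for a b c d
  proof -
    have "card (verts U - {a, b, c, d}) = 1" using that n by (simp add: card_Diff_subset)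
    then obtain e where "verts U - {a, b, c, d} = {e}" by (auto simp: card_1_singleton_iff)
    thus ?thesis using that(2) by (intro exI[of _ e]) blast
  qed
  have no2K2: "\<not> has_2K2 ?G"
  proof
    assume "has_2K2 ?G"
    then obtain a b c d where *: "adjacent ?G a b" "adjacent ?G c d" "a \<noteq> c" "a \<noteq> d" "b \<noteq> c" "b \<noteq> d"
      "\<not> adjacent ?G a c" "\<not> adjacent ?G a d" "\<not> adjacent ?G b c" "\<not> adjacent ?G b d"
      unfolding has_2K2_def by blast
    have e: "adjacent U a b" "adjacent U c d" "\<not> adjacent U a c" "\<not> adjacent U a d"
      "\<not> adjacent U b c" "\<not> adjacent U b d"
      using * adj[OF *(1)] adj[OF *(2)] by (auto simp: adjacent_induced)
    note V = adjacentD[OF s e(1)] adjacentD[OF s e(2)]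
    obtain z where z: "verts U = {a, b, c, d, z}" using fifth[of a b c d] *(3-6) V by auto
    have third: "adjacent U v z" if "v \<in> verts U" "nbhd U v \<subseteq> {u, z}" for v u
    proof (rule ccontr)
      assume "\<not> adjacent U v z"
      hence "nbhd U v \<subseteq> {u}" using that(2) by (auto simp: in_nbhd s)
      hence "card (nbhd U v) \<le> 1" using card_mono[of "{u}" "nbhd U v"] by simp
      thus False using deg[OF that(1)] by (simp add: degree_nbhd)
    qed
    have nz: "nbhd U v \<subseteq> {a, b, c, d, z} - {v}" for v
      using nbhd_subset[of U v] z adjacent_irrefl[OF s] by (auto simp: in_nbhd s)
    have az: "adjacent U a z" by (rule third[of a b]) (use nz[of a] V e in \<open>auto simp: in_nbhd s\<close>)
    have bz: "adjacent U b z" by (rule third[of b a]) (use nz[of b] V e in \<open>auto simp: in_nbhd s\<close>)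
    have cz: "adjacent U c z" by (rule third[of c d])
      (use nz[of c] V e in \<open>auto simp: in_nbhd s adjacent_sym\<close>)
    have "{a, b, c} \<subseteq> nbhd U z" using az bz cz by (simp add: in_nbhd s adjacent_sym)
    hence "card {a, b, c} \<le> card (nbhd U z)" using finite_nbhd[OF s] by (intro card_mono) auto
    thus False using *(3,5) V(3) deg[of z] z by (simp add: degree_nbhd)
  qed
  have noC4: "\<not> has_C4 ?G"
  proof
    assume "has_C4 ?G"
    then obtain a b c d where *: "a \<noteq> c" "b \<noteq> d" "adjacent ?G a b" "adjacent ?G b c"
      "adjacent ?G c d" "adjacent ?G d a"
      unfolding has_C4_def by blast
    have e: "adjacent U a b" "adjacent U b a" "adjacent U b c" "adjacent U c b"
      "adjacent U c d" "adjacent U d c" "adjacent U d a" "adjacent U a d"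
      using *(3-6) by (auto simp: adjacent_induced adjacent_sym)
    note V = adjacentD[OF s e(1)] adjacentD[OF s e(3)] adjacentD[OF s e(5)] adjacentD[OF s e(7)]
    obtain z where z: "verts U = {a, b, c, d, z}" "z \<notin> {a, b, c, d}" using fifth[of a b c d] *(1,2) V by auto
    have nbs: "nbhd U a = {b, d}" "nbhd U b = {a, c}" "nbhd U c = {b, d}" "nbhd U d = {c, a}"
      using nb[OF e(1,8) *(2)] nb[OF e(2,3) *(1)] nb[OF e(4,5) *(2)] nb[OF e(6,7)] *(1) by auto
    have "v \<notin> nbhd U z" for v
    proof
      assume v: "v \<in> nbhd U z"
      hence "z \<in> nbhd U v" by (simp add: in_nbhd s adjacent_sym)
      moreover have "v \<in> {a, b, c, d}"
        using v nbhd_subset[of U z] z(1) adjacent_irrefl[OF s] by (auto simp: in_nbhd s)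
      ultimately show False using nbs z(2) by auto
    qed
    hence "nbhd U z = {}" by blast
    thus False using deg[of z] z(1) by (simp add: degree_nbhd)
  qed
  obtain a b c d e where C5: "is_C5 ?G a b c d e"
    using nonsplit_obstruction[OF sG nonsplit] no2K2 noC4 by blast
  hence "{a, b, c, d, e} \<subseteq> W" "distinct [a, b, c, d, e]"
    by (auto simp: is_C5_def adjacent_induced)
  hence "5 \<le> card W"
    using card_mono[of W "{a, b, c, d, e}"] finU W finite_subset by fastforce
  hence "W = verts U" using card_seteq[OF finU W] n by simp
  moreover have "induced U (verts U) = U"
    by (rule simple_graph_eqI) (use s in \<open>auto simp: simple_induced adjacent_induced dest: adjacentD\<close>)
  ultimately show ?thesis using n deg by (intro hcu_degreesI(5)) auto
qed

text \<open>The subgraph lies in an indecomposable rigid core, whose degrees are classified; the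
  complementary cases reduce to the others by complementation.\<close>

theorem induced_rigid_hcu_degrees:
  assumes U: "rigid U" "W \<subseteq> verts U"
    and G: "\<not> split_graph (induced U W)" "\<not> decomposable (induced U W)"
  shows "hcu_degrees (induced U W)"
proof -
  obtain C where C: "W \<subseteq> C" "C \<subseteq> verts U" "rigid (induced U C)" "\<not> split_graph (induced U C)"
    "\<not> decomposable (induced U C)"
    using exists_indecomposable_core[OF U G] by blast
  define X where "X = induced U C"
  have X: "rigid X" "\<not> split_graph X" "\<not> decomposable X" "simple_graph X" "W \<subseteq> verts X"
    and GX: "induced U W = induced X W"
    using C by (auto simp: X_def rigid_def induced_induced)
  let ?G = "induced X W"
  have sG: "simple_graph ?G" by (rule simple_induced[OF X(4,5)])
  have G': "\<not> split_graph ?G" "\<not> decomposable ?G" using G GX by auto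
  have n4: "4 \<le> card W" using nonsplit_card[OF sG G'(1)] by simp
  hence Wne: "W \<noteq> {}" by auto
  have bnd: "1 \<le> degree ?G v" "degree ?G v + 2 \<le> card W" if "v \<in> W" for v
    using indecomposable_degree_bounds[OF sG G'(2)] n4 that by auto
  have coG: "co ?G = induced (co X) W" by (rule co_induced[OF X(4,5)])
  have scoX: "simple_graph (co X)" "W \<subseteq> verts (co X)" using X by (auto simp: simple_co)
  have bnd': "1 \<le> degree (co ?G) v" "degree (co ?G) v + 2 \<le> card W" if "v \<in> W" for v
    using bnd[OF that] degree_co[OF sG, of v] that n4 by auto
  have n3: "3 \<le> card (verts X)"
    using n4 card_mono[OF finite_verts[OF X(4)] X(5)] by linarith
  have by_co: "hcu_degrees ?G" if "hcu_degrees (co ?G)"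
    using hcu_degrees_co[OF simple_co[OF sG] _ that] n4 by (simp add: co_co sG)
  have "hcu_degrees ?G"
    using rigid_classification[OF X(1-3)]
  proof (elim disjE bexE conjE)
    fix c assume c: "c \<in> verts X" "\<forall>v\<in>verts X - {c}. degree X v = 1"
    show ?thesis
    proof (rule induced_near_matching[OF X(4,5) Wne bnd(1), of c])
      fix v assume v: "v \<in> W - {c}"
      hence "degree X v = 1" using c(2) X(5) by blast
      thus "degree ?G v \<le> 1" using degree_induced_le[OF X(4,5), of v] v by simp
    qed auto
  next
    fix c assume c: "c \<in> verts X" "\<forall>v\<in>verts X - {c}. degree X v + 2 = card (verts X)"
    have "hcu_degrees (induced (co X) W)"
    proof (rule induced_near_matching[OF scoX Wne, of c])
      fix v assume v: "v \<in> W - {c}"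
      hence "degree X v + 2 = card (verts X)" "v \<in> verts X" using c(2) X(5) by blast+
      hence "degree (co X) v = 1" using degree_co[OF X(4), of v] by simp
      thus "degree (induced (co X) W) v \<le> 1" using degree_induced_le[OF scoX, of v] v by simp
    qed (use bnd'(1) coG in auto)
    thus ?thesis using by_co coG by simp
  next
    fix c assume c: "c \<in> verts X" "degree X c + 2 = card (verts X)" "\<forall>v\<in>verts X - {c}. degree X v = 2"
    show ?thesis by (rule induced_degree_two_type[OF X(4) c X(5) Wne bnd])
  next
    fix c assume c: "c \<in> verts X" "degree X c = 1" "\<forall>v\<in>verts X - {c}. degree X v + 3 = card (verts X)"
    have "hcu_degrees (induced (co X) W)"
    proof (rule induced_degree_two_type[OF scoX(1) _ _ _ scoX(2) Wne])
      show "c \<in> verts (co X)" "degree (co X) c + 2 = card (verts (co X))"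
        using c degree_co[OF X(4)] n3 by auto
      show "\<forall>v\<in>verts (co X) - {c}. degree (co X) v = 2"
      proof
        fix v assume v: "v \<in> verts (co X) - {c}"
        hence "degree X v + 3 = card (verts X)" using c(3) by simp
        thus "degree (co X) v = 2" using degree_co[OF X(4), of v] v by simp
      qed
    qed (use bnd' coG in auto)
    thus ?thesis using by_co coG by simp
  next
    assume "card (verts X) = 5" "\<forall>v\<in>verts X. degree X v = 2"
    thus ?thesis using induced_pentagon[OF X(4) _ _ X(5) G'(1)] by blast
  qed
  thus ?thesis using GX by simp
qed

lemma isomorphic_hcu_degrees:
  assumes "isomorphic G H" "hcu_degrees G"
  shows "hcu_degrees H"
proof -
  obtain f where f: "graph_iso f G H" using assms(1) by (auto simp: isomorphic_iff)
  have bij: "bij_betw f (verts G) (verts H)" using f by (simp add: graph_iso_def)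
  have im: "f ` verts G = verts H" and n: "card (verts H) = card (verts G)"
    and inj: "inj_on f (verts G)"
    using bij bij_betw_same_card[OF bij] by (auto simp: bij_betw_def)
  have d: "degree H (f v) = degree G v" if "v \<in> verts G" for v by (rule graph_iso_degree[OF f that])
  have im1: "verts H - {f c} = f ` (verts G - {c})" if "c \<in> verts G" for c
    using im inj that inj_on_image_set_diff[OF inj, of "verts G" "{c}"] by auto
  have dd: "degree H (f v) = degree G v" if "v \<in> verts G - {c}" for v c using d that by blast
  from assms(2) show ?thesis
  proof (cases rule: hcu_degreesE)
    case (one c)
    thus ?thesis using im im1[of c] d by (intro hcu_degreesI(1)[of "f c"]) auto
  next
    case (co_one c)
    thus ?thesis using im im1[of c] d n by (intro hcu_degreesI(2)[of "f c"]) auto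
  next
    case (two c)
    thus ?thesis using im im1[of c] d n by (intro hcu_degreesI(3)[of "f c"]) auto
  next
    case (co_two c)
    thus ?thesis using im im1[of c] d n by (intro hcu_degreesI(4)[of "f c"]) auto
  next
    case pentagon
    thus ?thesis using im[symmetric] d n by (intro hcu_degreesI(5)) auto
  qed
qed

theorem HCU_imp_hcu_degrees:
  fixes G :: "'a ugraph"
  assumes "G \<in> HCU" "\<not> split_graph G" "\<not> decomposable G"
  shows "hcu_degrees G"
proof -
  obtain U :: "nat ugraph" and W where s: "simple_graph G" and U: "unigraph U" "W \<subseteq> verts U"
    and iso: "isomorphic G (induced U W)"
    using assms(1) by (auto simp: HCU_def)
  have rU: "rigid U" by (rule unigraph_rigid[OF U(1)])
  hence sI: "simple_graph (induced U W)" using simple_induced U(2) by (auto simp: rigid_def)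
  note iso' = isomorphic_sym[OF iso]
  have "hcu_degrees (induced U W)"
    by (rule induced_rigid_hcu_degrees[OF rU U(2)])
      (use isomorphic_split[OF iso' s] isomorphic_decomposable[OF iso' sI s] assms in blast)+
  thus ?thesis by (rule isomorphic_hcu_degrees[OF iso'])
qed

section \<open>Graphs with these degrees are indecomposable\<close>

lemma split_if_core_stable:
  assumes "simple_graph G" "decomposes G K S C" "\<And>x y. x \<in> C \<Longrightarrow> y \<in> C \<Longrightarrow> \<not> adjacent G x y"
  shows "split_graph G"
proof (rule split_graphI[OF assms(1), of K "S \<union> C"])
  have SC: "\<not> adjacent G x y" if "x \<in> S" "y \<in> C" for x y
    using assms(2) that by (simp add: decomposes_def)
  show "\<not> adjacent G x y" if "x \<in> S \<union> C" "y \<in> S \<union> C" for x y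
    using that assms(2,3) SC[of x y] SC[of y x] adjacent_sym[of G x y]
    by (auto simp: decomposes_def stable_def)
qed (use assms(2) in \<open>auto simp: decomposes_def clique_def\<close>)

lemma split_if_core_clique:
  assumes "simple_graph G" "decomposes G K S C"
    "\<And>x y. x \<in> C \<Longrightarrow> y \<in> C \<Longrightarrow> x \<noteq> y \<Longrightarrow> adjacent G x y"
  shows "split_graph G"
proof (rule split_graphI[OF assms(1), of "K \<union> C" S])
  have KC: "adjacent G x y" if "x \<in> K" "y \<in> C" for x y
    using assms(2) that by (simp add: decomposes_def)
  show "adjacent G x y" if "x \<in> K \<union> C" "y \<in> K \<union> C" "x \<noteq> y" for x y
    using that assms(2,3) KC[of x y] KC[of y x] adjacent_sym[of G x y]
    by (auto simp: decomposes_def clique_def)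
qed (use assms(2) in \<open>auto simp: decomposes_def stable_def\<close>)

text \<open>No vertex is isolated, so \<open>K\<close> is not empty. The core is neither stable nor a clique, since it
  could otherwise be merged into one part of the split factor and the graph would be split.\<close>

lemma decomposition_witnesses:
  assumes s: "simple_graph G" and nonsplit: "\<not> split_graph G"
    and bnd: "\<And>v. v \<in> verts G \<Longrightarrow> 1 \<le> degree G v \<and> degree G v + 2 \<le> card (verts G)"
    and d: "decomposes G K S C" "K \<union> S \<noteq> {}"
  obtains k u v where "k \<in> K" "u \<in> C" "v \<in> C" "adjacent G u v" "3 \<le> card C"
proof -
  have V: "verts G = K \<union> S \<union> C" using d by (simp add: decomposes_def)
  have finC: "finite C" using V finite_verts[OF s] by (metis finite_Un)
  have KS: "\<And>x y. x \<in> K \<Longrightarrow> y \<in> K \<Longrightarrow> x \<noteq> y \<Longrightarrow> adjacent G x y"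
    "\<And>x y. x \<in> S \<Longrightarrow> y \<in> S \<Longrightarrow> \<not> adjacent G x y"
    "\<And>x y. x \<in> K \<Longrightarrow> y \<in> C \<Longrightarrow> adjacent G x y" "\<And>x y. x \<in> S \<Longrightarrow> y \<in> C \<Longrightarrow> \<not> adjacent G x y"
    and disj: "K \<inter> S = {}" "K \<inter> C = {}" "S \<inter> C = {}"
    using d by (auto simp: decomposes_def clique_def stable_def)
  have "K \<noteq> {}"
  proof
    assume K: "K = {}"
    then obtain x where x: "x \<in> S" using d by auto
    have "nbhd G x = {}" using KS(2,4)[OF x] V K by (auto simp: nbhd_def)
    thus False using bnd[of x] x V by (simp add: degree_nbhd)
  qed
  then obtain k where k: "k \<in> K" by blast
  obtain u v where uv: "u \<in> C" "v \<in> C" "adjacent G u v"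
    using split_if_core_stable[OF s d(1)] nonsplit by blast
  obtain x y where xy: "x \<in> C" "y \<in> C" "x \<noteq> y" "\<not> adjacent G x y"
    using split_if_core_clique[OF s d(1)] nonsplit by blast
  have "u \<noteq> v" using adjacentD(3)[OF s uv(3)] .
  have "\<not> C \<subseteq> {u, v}"
    using xy uv(3) adjacent_sym[of G u v] by blast
  then obtain z where z: "z \<in> C" "z \<noteq> u" "z \<noteq> v" by blast
  have "card {u, v, z} \<le> card C" using z uv finC by (intro card_mono) auto
  hence "3 \<le> card C" using z \<open>u \<noteq> v\<close> by simp
  thus ?thesis using that k uv by blast
qed

text \<open>A vertex of \<open>K\<close> is adjacent to the whole core, which has at least three vertices, so it is the
  exceptional vertex \<open>c\<close>. All the other vertices have a neighbour, and outside the core this can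
  only be \<open>c\<close>. So \<open>c\<close> would be dominating.\<close>

lemma hcu_degrees_indecomposable_sparse:
  assumes s: "simple_graph G" and nonsplit: "\<not> split_graph G"
    and bnd: "\<And>v. v \<in> verts G \<Longrightarrow> 1 \<le> degree G v \<and> degree G v + 2 \<le> card (verts G)"
    and sparse: "(\<exists>c. \<forall>v\<in>verts G - {c}. degree G v \<le> 1) \<or>
      (\<exists>c. \<forall>v\<in>verts G - {c}. degree G v \<le> 2)"
  shows "\<not> decomposable G"
proof
  assume "decomposable G"
  then obtain K S C where d: "decomposes G K S C" "K \<union> S \<noteq> {}"
    using decomposable_iff[OF s] by blast
  obtain k u v where w: "k \<in> K" "u \<in> C" "v \<in> C" "adjacent G u v" "3 \<le> card C"
    using decomposition_witnesses[OF s nonsplit bnd d] by blast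
  have V: "verts G = K \<union> S \<union> C" and KC: "K \<inter> C = {}" using d by (auto simp: decomposes_def)
  have full: "adjacent G x y" if "x \<in> K" "y \<in> C" for x y
    using d that by (auto simp: decomposes_def)
  have uv: "u \<noteq> v" using adjacentD(3)[OF s w(4)] .
  obtain c where c: "\<forall>v\<in>verts G - {c}. degree G v \<le> 2" using sparse by force
  have big: "x = c" if "x \<in> K" for x
  proof (rule ccontr)
    assume "x \<noteq> c"
    hence "degree G x \<le> 2" using c that V by blast
    moreover have "card C \<le> degree G x" by (rule degree_ge_card[OF s]) (use full that in blast)
    ultimately show False using w(5) by simp
  qed
  hence K: "K = {c}" using w(1) by blast
  \<comment> \<open>every further vertex has a neighbour, so it is adjacent to \<open>c\<close>\<close>
  have "adjacent G c x" if x: "x \<in> verts G - {c}" for x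
  proof (cases "x \<in> C")
    case True thus ?thesis using full K by blast
  next
    case False
    hence xS: "x \<in> S" using x V K by blast
    have "nbhd G x \<noteq> {}" using bnd[of x] x by (auto simp: degree_nbhd)
    then obtain y where y: "adjacent G x y" by (auto simp: nbhd_def)
    hence "y \<in> K" using adjacentD(2)[OF s y] d xS V by (auto simp: decomposes_def stable_def)
    thus ?thesis using K y adjacent_sym[of G] by blast
  qed
  hence "card (verts G - {c}) \<le> degree G c" by (intro degree_ge_card[OF s]) blast
  moreover have "c \<in> verts G" using K V by blast
  hence "degree G c + 2 \<le> card (verts G)" "card (verts G - {c}) = card (verts G) - 1"
    using bnd finite_verts[OF s] by auto
  ultimately show False by linarith
qed

lemma hcu_degrees_indecomposable:
  assumes s: "simple_graph G" and nonsplit: "\<not> split_graph G"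
    and bnd: "\<And>v. v \<in> verts G \<Longrightarrow> 1 \<le> degree G v \<and> degree G v + 2 \<le> card (verts G)"
    and G: "hcu_degrees G"
  shows "\<not> decomposable G"
proof -
  have bnd': "1 \<le> degree (co G) v \<and> degree (co G) v + 2 \<le> card (verts (co G))" if "v \<in> verts (co G)" for v
    using bnd[of v] degree_co[OF s, of v] that by auto
  have dense: "\<not> decomposable G" if ex: "\<exists>c. \<forall>v\<in>verts G - {c}. card (verts G) \<le> degree G v + 3"
  proof -
    obtain c where c: "\<forall>v\<in>verts G - {c}. card (verts G) \<le> degree G v + 3" using ex by blast
    have "\<forall>v\<in>verts (co G) - {c}. degree (co G) v \<le> 2"
    proof
      fix v assume v: "v \<in> verts (co G) - {c}"
      hence "card (verts G) \<le> degree G v + 3" using c by simp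
      thus "degree (co G) v \<le> 2" using degree_co[OF s, of v] v by simp
    qed
    hence "\<not> decomposable (co G)"
      using split_co[OF s] nonsplit
      by (intro hcu_degrees_indecomposable_sparse[OF simple_co[OF s] _ bnd']) blast+
    thus ?thesis by (simp add: decomposable_co s)
  qed
  have sparse: "\<not> decomposable G" if "\<exists>c. \<forall>v\<in>verts G - {c}. degree G v \<le> 2"
    using that by (intro hcu_degrees_indecomposable_sparse[OF s nonsplit bnd]) blast+
  from G show ?thesis
  proof (cases rule: hcu_degreesE)
    case (one c)
    thus ?thesis by (intro sparse exI[of _ c]) simp
  next
    case (co_one c)
    have "card (verts G) \<le> degree G v + 3" if "v \<in> verts G - {c}" for v
      using co_one(2)[rule_format, OF that] by simp
    thus ?thesis by (intro dense exI[of _ c]) blast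
  next
    case (two c)
    thus ?thesis by (intro sparse exI[of _ c]) simp
  next
    case (co_two c)
    thus ?thesis by (intro dense exI[of _ c]) simp
  next
    case pentagon
    thus ?thesis by (intro sparse) simp
  qed
qed

section \<open>The unigraphs of the classification\<close>

lemma iso_glue:
  assumes f: "graph_iso f (induced G X) (induced H X')" and g: "graph_iso g (induced G R) (induced H R')"
    and G: "verts G = X \<union> R" "X \<inter> R = {}" and H: "verts H = X' \<union> R'" "X' \<inter> R' = {}"
    and cross: "\<And>x r. x \<in> X \<Longrightarrow> r \<in> R \<Longrightarrow> adjacent G x r \<longleftrightarrow> adjacent H (f x) (g r)"
  shows "isomorphic G H"
proof -
  define h where "h = (\<lambda>v. if v \<in> X then f v else g v)"
  have hX: "h x = f x" if "x \<in> X" for x using that by (simp add: h_def)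
  have hR: "h x = g x" if "x \<in> R" for x using that G by (auto simp: h_def)
  have bf: "bij_betw f X X'" and bg: "bij_betw g R R'" using f g by (auto simp: graph_iso_def)
  have "bij_betw h X X'" using bf hX by (simp cong: bij_betw_cong)
  moreover have "bij_betw h R R'" using bg hR by (simp cong: bij_betw_cong)
  ultimately have bij: "bij_betw h (verts G) (verts H)"
    unfolding G(1) H(1) using H(2) by (rule bij_betw_combine)
  have fX: "adjacent H (f x) (f y) \<longleftrightarrow> adjacent G x y" if "x \<in> X" "y \<in> X" for x y
    using f that bij_betwE[OF bf] by (auto simp: graph_iso_def adjacent_induced)
  have gR: "adjacent H (g x) (g y) \<longleftrightarrow> adjacent G x y" if "x \<in> R" "y \<in> R" for x y
    using g that bij_betwE[OF bg] by (auto simp: graph_iso_def adjacent_induced)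
  have "adjacent G x y \<longleftrightarrow> adjacent H (h x) (h y)" if xy: "x \<in> verts G" "y \<in> verts G" for x y
  proof -
    consider "x \<in> X" "y \<in> X" | "x \<in> X" "y \<in> R" | "x \<in> R" "y \<in> X" | "x \<in> R" "y \<in> R"
      using xy G(1) by blast
    thus ?thesis
    proof cases
      case 1 thus ?thesis using fX hX by simp
    next
      case 2 thus ?thesis using cross hX hR by simp
    next
      case 3 thus ?thesis using cross[of y x] hX hR adjacent_sym[of G x y] adjacent_sym[of H "g x" "f y"] by simp
    next
      case 4 thus ?thesis using gR hR by simp
    qed
  qed
  thus ?thesis using bij by (auto simp: isomorphic_def)
qed

lemma nbhd_single:
  assumes "degree G v = 1" "simple_graph G"
  obtains u where "nbhd G v = {u}" "adjacent G v u"
proof -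
  obtain u where "nbhd G v = {u}" using assms(1) by (auto simp: degree_nbhd card_1_singleton_iff)
  thus ?thesis using that assms(2) in_nbhd[of G u v] by blast
qed

lemma matched_pair:
  assumes s: "simple_graph G" and deg: "\<And>v. v \<in> verts G \<Longrightarrow> degree G v = 1"
    and a: "nbhd G a = {b}" "adjacent G a b"
  shows "b \<in> verts G" "a \<noteq> b" "nbhd G b = {a}"
    "v \<in> verts G - {a, b} \<Longrightarrow> nbhd G v \<inter> (verts G - {a, b}) = nbhd G v"
proof -
  have nsym: "x \<in> nbhd G y \<longleftrightarrow> y \<in> nbhd G x" for x y by (simp add: in_nbhd s adjacent_sym)
  show bV: "b \<in> verts G" "a \<noteq> b" using adjacentD[OF s a(2)] by auto
  have "a \<in> nbhd G b" using nsym[of a b] a(1) by simp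
  thus nb: "nbhd G b = {a}"
    using deg[OF bV(1)] by (auto simp: degree_nbhd card_1_singleton_iff)
  show "nbhd G v \<inter> (verts G - {a, b}) = nbhd G v" if v: "v \<in> verts G - {a, b}"
  proof -
    have "a \<notin> nbhd G v" "b \<notin> nbhd G v" using nsym[of a v] nsym[of b v] a(1) nb v by auto
    thus ?thesis using nbhd_subset[of G v] by blast
  qed
qed

lemma matching_iso:
  fixes G :: "'a ugraph" and H :: "'b ugraph"
  assumes "simple_graph G" "simple_graph H" "card (verts G) = card (verts H)"
    "\<And>v. v \<in> verts G \<Longrightarrow> degree G v = 1" "\<And>v. v \<in> verts H \<Longrightarrow> degree H v = 1"
  shows "isomorphic G H"
  using assms
proof (induction "card (verts G)" arbitrary: G H rule: less_induct)
  case less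
  show ?case
  proof (cases "verts G = {}")
    case True
    hence "verts H = {}" using less.prems(2,3) finite_verts[of H] by simp
    thus ?thesis using True by (auto simp: isomorphic_def bij_betw_def)
  next
    case False
    then obtain a where a: "a \<in> verts G" by blast
    have "verts H \<noteq> {}" using False less.prems(1,3) finite_verts[of G] by auto
    then obtain a' where a': "a' \<in> verts H" by blast
    obtain b where b: "nbhd G a = {b}" "adjacent G a b" using nbhd_single less.prems(1,4) a by metis
    obtain b' where b': "nbhd H a' = {b'}" "adjacent H a' b'" using nbhd_single less.prems(2,5) a' by metis
    note p = matched_pair[OF less.prems(1,4) b]
    note p' = matched_pair[OF less.prems(2,5) b']
    let ?R = "verts G - {a, b}" and ?R' = "verts H - {a', b'}"
    have fin: "finite (verts G)" "finite (verts H)" using less.prems by (auto simp: finite_verts)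
    have cR: "card ?R = card (verts G) - 2" "card ?R' = card (verts H) - 2"
      using a a' p(1,2) p'(1,2) fin by (simp_all add: card_Diff_subset)
    have "card (verts G) > 0" using a fin by (auto simp: card_gt_0_iff)
    hence "isomorphic (induced G ?R) (induced H ?R')"
    proof (intro less.hyps)
      show "degree (induced G ?R) v = 1" if "v \<in> verts (induced G ?R)" for v
        using that degree_induced[OF less.prems(1), of ?R v] p(4)[of v] less.prems(4)[of v]
        by (simp add: degree_nbhd)
      show "degree (induced H ?R') v = 1" if "v \<in> verts (induced H ?R')" for v
        using that degree_induced[OF less.prems(2), of ?R' v] p'(4)[of v] less.prems(5)[of v]
        by (simp add: degree_nbhd)
    qed (use cR less.prems in \<open>auto intro: simple_induced\<close>)
    then obtain g where g: "graph_iso g (induced G ?R) (induced H ?R')" by (auto simp: isomorphic_iff)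
    define f where "f = (\<lambda>v. if v = a then a' else b')"
    have f: "graph_iso f (induced G {a, b}) (induced H {a', b'})"
      using p(2) p'(2) b(2) b'(2) adjacent_irrefl[OF less.prems(1)] adjacent_irrefl[OF less.prems(2)]
      by (auto simp: graph_iso_def adjacent_induced f_def bij_betw_def inj_on_def adjacent_sym)
    show ?thesis
    proof (rule iso_glue[OF f g])
      fix x r assume x: "x \<in> {a, b}" and r: "r \<in> ?R"
      have "g r \<in> ?R'" using g r by (auto simp: graph_iso_def bij_betw_def)
      hence "\<not> adjacent H (f x) (g r)"
        using b'(1) p'(3) by (auto simp: f_def in_nbhd[OF less.prems(2), symmetric])
      moreover have "\<not> adjacent G x r"
        using x r b(1) p(3) by (auto simp: in_nbhd[OF less.prems(1), symmetric])
      ultimately show "adjacent G x r \<longleftrightarrow> adjacent H (f x) (g r)" by blast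
    qed (use a a' p(1) p'(1) in auto)
  qed
qed

lemma degree_seq_one_exception:
  assumes "simple_graph U" "simple_graph H" "degree_seq H = degree_seq U"
    "c \<in> verts U" "\<And>v. v \<in> verts U - {c} \<Longrightarrow> degree U v = k"
  obtains c' where "c' \<in> verts H" "degree H c' = degree U c"
    "\<And>v. v \<in> verts H - {c'} \<Longrightarrow> degree H v = k" "card (verts H) = card (verts U)"
proof -
  have fin: "finite (verts U)" "finite (verts H)" using assms(1,2) by (auto simp: finite_verts)
  have eq: "image_mset (degree H) (mset_set (verts H)) = image_mset (degree U) (mset_set (verts U))"
    using assms(3) by (simp add: degree_seq_eq_mset)
  have "mset_set (verts U) = add_mset c (mset_set (verts U - {c}))"
    using assms(4) fin(1) by (simp add: mset_set.remove)
  moreover have "image_mset (degree U) (mset_set (verts U - {c})) =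
      replicate_mset (card (verts U - {c})) k"
    using assms(5) fin(1) image_mset_cong[of "mset_set (verts U - {c})" "degree U" "\<lambda>_. k"]
    by (simp add: image_mset_const_eq)
  ultimately have U: "image_mset (degree U) (mset_set (verts U)) =
      add_mset (degree U c) (replicate_mset (card (verts U - {c})) k)" by simp
  hence "degree U c \<in># image_mset (degree H) (mset_set (verts H))" by (simp add: eq)
  then obtain c' where c': "c' \<in> verts H" "degree H c' = degree U c" using fin(2) by auto
  have "mset_set (verts H) = add_mset c' (mset_set (verts H - {c'}))"
    using c'(1) fin(2) by (simp add: mset_set.remove)
  hence rest: "image_mset (degree H) (mset_set (verts H - {c'})) = replicate_mset (card (verts U - {c})) k"
    using eq U c'(2) by simp
  have "degree H v = k" if "v \<in> verts H - {c'}" for v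
  proof -
    have "degree H v \<in># image_mset (degree H) (mset_set (verts H - {c'}))" using that fin(2) by auto
    thus ?thesis unfolding rest by (simp split: if_splits)
  qed
  moreover have "card (verts H) = card (verts U)"
    using arg_cong[OF eq, of size] fin by simp
  ultimately show ?thesis using that c' by blast
qed

text \<open>The component of \<open>c\<close> is a star, and the remaining vertices are matched among themselves.\<close>

lemma star_structure:
  assumes s: "simple_graph G" and c: "c \<in> verts G"
    and one: "\<forall>v\<in>verts G - {c}. degree G v = 1"
  defines "R \<equiv> verts G - insert c (nbhd G c)"
  shows "v \<in> nbhd G c \<Longrightarrow> nbhd G v = {c}" "c \<notin> nbhd G c"
    "v \<in> R \<Longrightarrow> degree (induced G R) v = 1"
    "x \<in> insert c (nbhd G c) \<Longrightarrow> r \<in> R \<Longrightarrow> \<not> adjacent G x r"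
proof -
  have nsym: "x \<in> nbhd G y \<longleftrightarrow> y \<in> nbhd G x" for x y by (simp add: in_nbhd s adjacent_sym)
  show c_not: "c \<notin> nbhd G c" by (simp add: in_nbhd s adjacent_irrefl)
  have single: "nbhd G v = {u}" if v: "v \<in> verts G - {c}" "u \<in> nbhd G v" for v u
  proof -
    have "card (nbhd G v) = 1" using bspec[OF one v(1)] by (simp add: degree_nbhd)
    thus ?thesis using v(2) by (auto simp: card_1_singleton_iff)
  qed
  show leaf: "nbhd G v = {c}" if v: "v \<in> nbhd G c" for v
  proof (rule single)
    show "v \<in> verts G - {c}" using v c_not nbhd_subset[of G c] by blast
    show "c \<in> nbhd G v" using v nsym by simp
  qed
  show cross: "\<not> adjacent G x r" if "x \<in> insert c (nbhd G c)" "r \<in> R" for x r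
  proof
    assume "adjacent G x r"
    hence r: "r \<in> nbhd G x" by (simp add: in_nbhd s)
    show False
    proof (cases "x = c")
      case True thus False using r that(2) by (simp add: R_def)
    next
      case False
      hence "r = c" using r leaf[of x] that(1) by auto
      thus False using that(2) by (simp add: R_def)
    qed
  qed
  show "degree (induced G R) v = 1" if v: "v \<in> R" for v
  proof -
    have vV: "v \<in> verts G - {c}" using v by (simp add: R_def)
    obtain u where u: "nbhd G v = {u}" "adjacent G v u" using nbhd_single[OF bspec[OF one vV] s] by blast
    have "u \<in> verts G" using adjacentD(2)[OF s u(2)] .
    moreover have "u \<notin> insert c (nbhd G c)" using cross[of u v] v u(2) adjacent_sym[of G u v] by blast
    ultimately have "nbhd G v \<inter> R = {u}" using u(1) by (auto simp: R_def)
    thus ?thesis using degree_induced[OF s _ v] by (auto simp: R_def)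
  qed
qed

lemma star_and_matching_iso:
  fixes G :: "'a ugraph" and H :: "'b ugraph"
  assumes s: "simple_graph G" "simple_graph H"
    and c: "c \<in> verts G" "c' \<in> verts H" "degree H c' = degree G c" "card (verts H) = card (verts G)"
    and one: "\<forall>v\<in>verts G - {c}. degree G v = 1" "\<forall>v\<in>verts H - {c'}. degree H v = 1"
  shows "isomorphic G H"
proof -
  let ?A = "nbhd G c" and ?A' = "nbhd H c'"
  let ?R = "verts G - insert c ?A" and ?R' = "verts H - insert c' ?A'"
  note G = star_structure[OF s(1) c(1) one(1)]
  note H = star_structure[OF s(2) c(2) one(2)]
  have fin: "finite ?A" "finite ?A'" using s by (simp_all add: finite_nbhd)
  obtain f0 where f0: "bij_betw f0 ?A ?A'"
    using finite_same_card_bij[OF fin] c(3) by (auto simp: degree_nbhd)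
  define f where "f = (\<lambda>v. if v = c then c' else f0 v)"
  have fA: "f v \<in> ?A'" "v \<noteq> c" "f v \<noteq> c'" if "v \<in> ?A" for v
  proof -
    show "v \<noteq> c" using that G(2) by blast
    thus "f v \<in> ?A'" using that f0 by (auto simp: f_def bij_betw_def)
    thus "f v \<noteq> c'" using H(2) by blast
  qed
  have "bij_betw f (insert c ?A) (insert c' ?A')"
  proof -
    have "bij_betw f ?A ?A'" using f0 fA(2) by (intro bij_betw_cong[THEN iffD1, OF _ f0]) (auto simp: f_def)
    moreover have "bij_betw f {c} {c'}" by (simp add: f_def bij_betw_def)
    ultimately have "bij_betw f ({c} \<union> ?A) ({c'} \<union> ?A')" using H(2) by (intro bij_betw_combine) auto
    thus ?thesis by simp
  qed
  moreover have "adjacent G x y \<longleftrightarrow> adjacent H (f x) (f y)"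
    if xy: "x \<in> insert c ?A" "y \<in> insert c ?A" for x y
  proof -
    have "adjacent G x y \<longleftrightarrow> (x = c) \<noteq> (y = c)"
      using xy G(1)[of x] G(2) in_nbhd[OF s(1), of y x] by auto
    moreover have "adjacent H (f x) (f y) \<longleftrightarrow> (f x = c') \<noteq> (f y = c')"
    proof -
      have "f v \<in> insert c' ?A'" if "v \<in> insert c ?A" for v
        using that fA(1)[of v] by (cases "v = c") (simp_all add: f_def)
      hence "f x \<in> insert c' ?A'" "f y \<in> insert c' ?A'" using xy by blast+
      thus ?thesis using H(1)[of "f x"] H(2) in_nbhd[OF s(2), of "f y" "f x"] by auto
    qed
    moreover have "f v = c' \<longleftrightarrow> v = c" if "v \<in> insert c ?A" for v
      using that fA(3)[of v] by (cases "v = c") (simp_all add: f_def)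
    hence "f x = c' \<longleftrightarrow> x = c" "f y = c' \<longleftrightarrow> y = c" using xy by blast+
    ultimately show ?thesis by simp
  qed
  ultimately have f: "graph_iso f (induced G (insert c ?A)) (induced H (insert c' ?A'))"
    by (auto simp: graph_iso_def adjacent_induced bij_betw_def)
  have sub: "insert c ?A \<subseteq> verts G" "insert c' ?A' \<subseteq> verts H" using c(1,2) by (auto simp: nbhd_def)
  have "card ?R = card ?R'"
    using c sub fin G(2) H(2) by (simp add: card_Diff_subset degree_nbhd)
  hence "isomorphic (induced G ?R) (induced H ?R')"
    by (intro matching_iso simple_induced s) (use G(3) H(3) in auto)
  then obtain g where g: "graph_iso g (induced G ?R) (induced H ?R')" by (auto simp: isomorphic_iff)
  show ?thesis
  proof (rule iso_glue[OF f g])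
    fix x r assume x: "x \<in> insert c ?A" and r: "r \<in> ?R"
    have "g r \<in> ?R'" using g r by (auto simp: graph_iso_def bij_betw_def)
    moreover have "f x \<in> insert c' ?A'"
      using x fA(1)[of x] by (cases "x = c") (simp_all add: f_def)
    ultimately have "\<not> adjacent H (f x) (g r)" by (intro H(4))
    thus "adjacent G x r \<longleftrightarrow> adjacent H (f x) (g r)" using G(4)[OF x r] by blast
  qed (use sub in auto)
qed

text \<open>The unique non-neighbour \<open>w\<close> of \<open>c\<close> closes a four-cycle \<open>c a w b\<close>; every other vertex forms a
  triangle with \<open>c\<close> and its other neighbour.\<close>

lemma windmill_structure:
  assumes s: "simple_graph G" and c: "c \<in> verts G" "degree G c + 2 = card (verts G)"
    and two: "\<And>v. v \<in> verts G - {c} \<Longrightarrow> degree G v = 2"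
  obtains w a b where "distinct [c, w, a, b]" "{c, w, a, b} \<subseteq> verts G"
    "\<not> adjacent G c w" "nbhd G w = {a, b}" "nbhd G a = {c, w}" "nbhd G b = {c, w}"
    "\<And>r. r \<in> verts G - {c, w, a, b} \<Longrightarrow> adjacent G c r"
    "\<And>r. r \<in> verts G - {c, w, a, b} \<Longrightarrow> degree (induced G (verts G - {c, w, a, b})) r = 1"
proof -
  have nsym: "x \<in> nbhd G y \<longleftrightarrow> y \<in> nbhd G x" for x y by (simp add: in_nbhd s adjacent_sym)
  have irr: "x \<notin> nbhd G x" for x by (simp add: in_nbhd s adjacent_irrefl)
  have finV: "finite (verts G)" by (rule finite_verts[OF s])
  have "nbhd G c \<subseteq> verts G - {c}" using irr[of c] nbhd_subset[of G c] by blast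
  hence "card (verts G - {c} - nbhd G c) = 1"
    using c finV finite_nbhd[OF s, of c] by (simp add: card_Diff_subset degree_nbhd)
  then obtain w where w: "verts G - {c} - nbhd G c = {w}" by (auto simp: card_1_singleton_iff)
  hence wV: "w \<in> verts G - {c}" "w \<notin> nbhd G c" by auto
  have card2: "card (nbhd G v) = 2" if "v \<in> verts G - {c}" for v using two[OF that] by (simp add: degree_nbhd)
  obtain a b where ab: "nbhd G w = {a, b}" "a \<noteq> b" using card2[OF wV(1)] by (auto simp: card_2_iff)
  have cw: "c \<notin> nbhd G w" using wV(2) nsym by blast
  have abV: "x \<in> verts G" "x \<noteq> c" "x \<noteq> w" if "x \<in> {a, b}" for x
    using that ab cw irr[of w] nbhd_subset[of G w] by auto
  have to_c: "c \<in> nbhd G x" if "x \<in> verts G" "x \<noteq> c" "x \<noteq> w" for x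
  proof -
    have "x \<in> nbhd G c" using that w by blast
    thus ?thesis using nsym by blast
  qed
  have nab: "nbhd G x = {c, w}" if "x \<in> {a, b}" for x
  proof -
    have "c \<in> nbhd G x" using to_c abV[OF that] by blast
    moreover have "w \<in> nbhd G x" using nsym[of w x] ab(1) that by simp
    moreover have "card (nbhd G x) = 2" using card2 abV[OF that] by blast
    ultimately show ?thesis using wV(1) by (auto simp: card_2_iff)
  qed
  let ?R = "verts G - {c, w, a, b}"
  have rest: "degree (induced G ?R) r = 1" if r: "r \<in> ?R" for r
  proof -
    have "card (nbhd G r) = 2" using card2 r by blast
    moreover have cr: "c \<in> nbhd G r" using to_c r by blast
    ultimately have "\<exists>u. nbhd G r = {c, u} \<and> u \<noteq> c" by (auto simp: card_2_iff)
    then obtain u where u: "nbhd G r = {c, u}" "u \<noteq> c" by blast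
    have "w \<notin> nbhd G r" "a \<notin> nbhd G r" "b \<notin> nbhd G r"
      using nsym[of w r] nsym[of a r] nsym[of b r] ab(1) nab r by auto
    hence "nbhd G r \<inter> ?R = {u}" using u nbhd_subset[of G r] by auto
    thus ?thesis using degree_induced[OF s _ r] by auto
  qed
  have adj_c: "adjacent G c r" if r: "r \<in> ?R" for r
  proof -
    have "c \<in> nbhd G r" using to_c r by blast
    thus ?thesis by (simp add: in_nbhd s adjacent_sym)
  qed
  have cw': "\<not> adjacent G c w" using wV(2) by (simp add: in_nbhd s)
  have dist: "distinct [c, w, a, b]" "{c, w, a, b} \<subseteq> verts G"
    using wV(1) abV[of a] abV[of b] ab(2) c(1) by auto
  show ?thesis
    by (rule that[OF dist cw' ab(1) nab nab adj_c rest]) auto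
qed

lemma windmill_iso:
  fixes G :: "'a ugraph" and H :: "'b ugraph"
  assumes s: "simple_graph G" "simple_graph H"
    and c: "c \<in> verts G" "c' \<in> verts H" "degree G c + 2 = card (verts G)" "degree H c' + 2 = card (verts H)"
      "card (verts H) = card (verts G)"
    and two: "\<And>v. v \<in> verts G - {c} \<Longrightarrow> degree G v = 2" "\<And>v. v \<in> verts H - {c'} \<Longrightarrow> degree H v = 2"
  shows "isomorphic G H"
proof -
  obtain w a b where G: "distinct [c, w, a, b]" "{c, w, a, b} \<subseteq> verts G"
    "\<not> adjacent G c w" "nbhd G w = {a, b}" "nbhd G a = {c, w}" "nbhd G b = {c, w}"
    "\<And>r. r \<in> verts G - {c, w, a, b} \<Longrightarrow> adjacent G c r"
    "\<And>r. r \<in> verts G - {c, w, a, b} \<Longrightarrow> degree (induced G (verts G - {c, w, a, b})) r = 1"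
    by (rule windmill_structure[OF s(1) c(1,3) two(1)], assumption, rule that)
  obtain w' a' b' where H: "distinct [c', w', a', b']" "{c', w', a', b'} \<subseteq> verts H"
    "\<not> adjacent H c' w'" "nbhd H w' = {a', b'}" "nbhd H a' = {c', w'}" "nbhd H b' = {c', w'}"
    "\<And>r. r \<in> verts H - {c', w', a', b'} \<Longrightarrow> adjacent H c' r"
    "\<And>r. r \<in> verts H - {c', w', a', b'} \<Longrightarrow> degree (induced H (verts H - {c', w', a', b'})) r = 1"
    by (rule windmill_structure[OF s(2) c(2,4) two(2)], assumption, rule that)
  let ?X = "{c, w, a, b}" and ?X' = "{c', w', a', b'}"
  let ?R = "verts G - ?X" and ?R' = "verts H - ?X'"
  define f where "f = (\<lambda>v. if v = c then c' else if v = w then w' else if v = a then a' else b')"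
  have core: "adjacent X p q \<longleftrightarrow> (p \<in> {c, w} \<and> q \<in> {a, b} \<or> p \<in> {a, b} \<and> q \<in> {c, w})"
    if X: "simple_graph X" "distinct [c, w, a, b]" "\<not> adjacent X c w" "nbhd X w = {a, b}"
      "nbhd X a = {c, w}" "nbhd X b = {c, w}" and pq: "p \<in> {c, w, a, b}" "q \<in> {c, w, a, b}"
    for X :: "'c ugraph" and c w a b p q
  proof -
    have nb: "adjacent X w v \<longleftrightarrow> v \<in> {a, b}" "adjacent X a v \<longleftrightarrow> v \<in> {c, w}" "adjacent X b v \<longleftrightarrow> v \<in> {c, w}" for v
      using X(4-6) in_nbhd[OF X(1)] by blast+
    have nbc: "adjacent X c v \<longleftrightarrow> v \<in> {a, b}" if "v \<in> {c, w, a, b}" for v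
      using that X(3) nb(2,3)[of c] adjacent_irrefl[OF X(1)] adjacent_sym[of X c v] X(2) by auto
    from pq(1) consider "p = c" | "p = w" | "p = a" | "p = b" by auto
    thus ?thesis
      using nb[of q] nbc[OF pq(2)] X(2) by cases auto
  qed
  have f: "graph_iso f (induced G ?X) (induced H ?X')"
  proof -
    have "bij_betw f ?X ?X'" using G(1) H(1) by (auto simp: f_def bij_betw_def inj_on_def)
    moreover have "adjacent G x y \<longleftrightarrow> adjacent H (f x) (f y)" if xy: "x \<in> ?X" "y \<in> ?X" for x y
    proof -
      have fX: "f x \<in> ?X'" "f y \<in> ?X'" by (auto simp: f_def)
      have fiff: "f v \<in> {c', w'} \<longleftrightarrow> v \<in> {c, w}" "f v \<in> {a', b'} \<longleftrightarrow> v \<in> {a, b}" if "v \<in> ?X" for v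
        using that G(1) H(1) by (auto simp: f_def)
      show ?thesis
        unfolding core[OF s(1) G(1,3-6) xy] core[OF s(2) H(1,3-6) fX]
          fiff[OF xy(1)] fiff[OF xy(2)] by (rule refl)
    qed
    moreover have "f x \<in> ?X'" for x by (simp add: f_def)
    ultimately show ?thesis unfolding graph_iso_def adjacent_induced verts_induced by blast
  qed
  have "card ?X = 4" "card ?X' = 4" using G(1) H(1) by simp_all
  hence "card ?R = card ?R'" using G(2) H(2) c(5) by (simp add: card_Diff_subset)
  hence "isomorphic (induced G ?R) (induced H ?R')"
    by (intro matching_iso simple_induced s) (use G(8) H(8) in auto)
  then obtain g where g: "graph_iso g (induced G ?R) (induced H ?R')" by (auto simp: isomorphic_iff)
  have cross: "adjacent X x r \<longleftrightarrow> x = c"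
    if X: "simple_graph X" "nbhd X w = {a, b}" "nbhd X a = {c, w}" "nbhd X b = {c, w}" "adjacent X c r"
      "x \<in> {c, w, a, b}" "r \<notin> {c, w, a, b}" "distinct [c, w, a, b]"
    for X :: "'c ugraph" and c w a b x r
  proof -
    have "r \<notin> nbhd X w" "r \<notin> nbhd X a" "r \<notin> nbhd X b" using X(2-4,7) by simp_all
    hence "\<not> adjacent X w r" "\<not> adjacent X a r" "\<not> adjacent X b r" by (simp_all add: in_nbhd X(1))
    thus ?thesis using X(5,6,8) by auto
  qed
  show ?thesis
  proof (rule iso_glue[OF f g])
    fix x r assume x: "x \<in> ?X" and r: "r \<in> ?R"
    have gr: "g r \<in> ?R'" using g r by (auto simp: graph_iso_def bij_betw_def)
    have "adjacent G x r \<longleftrightarrow> x = c" by (rule cross[OF s(1) G(4-6) G(7)[OF r] x _ G(1)]) (use r in simp)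
    moreover have "adjacent H (f x) (g r) \<longleftrightarrow> f x = c'"
      by (rule cross[OF s(2) H(4-6) H(7)[OF gr] _ _ H(1)]) (use gr in \<open>auto simp: f_def\<close>)
    moreover have "f x = c' \<longleftrightarrow> x = c" using x H(1) by (auto simp: f_def)
    ultimately show "adjacent G x r \<longleftrightarrow> adjacent H (f x) (g r)" by simp
  qed (use G(2) H(2) in auto)
qed

text \<open>Walking along the neighbours from \<open>a\<close> in both directions, the walk cannot close up before all
  five vertices are used, because the vertices left over would be too few to have degree two.\<close>

lemma pentagon_structure:
  assumes s: "simple_graph G" and n: "card (verts G) = 5" and two: "\<And>v. v \<in> verts G \<Longrightarrow> degree G v = 2"
  obtains a b c d e where "distinct [a, b, c, d, e]" "verts G = {a, b, c, d, e}"
    "nbhd G a = {b, e}" "nbhd G b = {a, c}" "nbhd G c = {b, d}" "nbhd G d = {c, e}" "nbhd G e = {a, d}"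
proof -
  have nsym: "x \<in> nbhd G y \<longleftrightarrow> y \<in> nbhd G x" for x y by (simp add: in_nbhd s adjacent_sym)
  have irr: "x \<notin> nbhd G x" for x by (simp add: in_nbhd s adjacent_irrefl)
  have finV: "finite (verts G)" by (rule finite_verts[OF s])
  have card2: "card (nbhd G v) = 2" if "v \<in> verts G" for v using two[OF that] by (simp add: degree_nbhd)
  have other: "\<exists>w. nbhd G v = {u, w} \<and> w \<noteq> u \<and> w \<noteq> v \<and> w \<in> verts G" if v: "v \<in> verts G" "u \<in> nbhd G v" for u v
  proof -
    have "\<exists>w. nbhd G v = {u, w} \<and> w \<noteq> u" using card2[OF v(1)] v(2) by (auto simp: card_2_iff)
    then obtain w where "nbhd G v = {u, w}" "w \<noteq> u" by blast
    thus ?thesis using irr[of v] nbhd_subset[of G v] by (intro exI[of _ w]) auto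
  qed
  have more: "\<exists>z\<in>verts G. z \<notin> set xs" if "length xs < 5" for xs
  proof -
    have "card (set xs) < card (verts G)" using card_length[of xs] that n by linarith
    hence "\<not> verts G \<subseteq> set xs" using card_mono[of "set xs" "verts G"] by auto
    thus ?thesis by blast
  qed
  obtain a where a: "a \<in> verts G" using more[of "[]"] by auto
  obtain b e where be: "nbhd G a = {b, e}" "b \<noteq> e" using card2[OF a] by (auto simp: card_2_iff)
  have V: "b \<in> verts G" "e \<in> verts G" "b \<noteq> a" "e \<noteq> a" using be nbhd_subset[of G a] irr[of a] by auto
  have ab: "a \<in> nbhd G b" and ae: "a \<in> nbhd G e" using nsym be by auto
  obtain c where c: "nbhd G b = {a, c}" "c \<noteq> a" "c \<noteq> b" "c \<in> verts G" using other[OF V(1) ab] by blast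
  obtain d where d: "nbhd G e = {a, d}" "d \<noteq> a" "d \<noteq> e" "d \<in> verts G" using other[OF V(2) ae] by blast
  have bc: "b \<in> nbhd G c" and de: "e \<in> nbhd G d" using nsym c(1) d(1) by auto
  have ce: "c \<noteq> e"
  proof
    assume eq: "c = e"
    hence ne: "nbhd G e = {a, b}" using bc d(1,3) V be(2) by auto
    \<comment> \<open>a triangle leaves only two further vertices\<close>
    obtain y where y: "y \<in> verts G" "y \<notin> {a, b, e}" using more[of "[a, b, e]"] by auto
    have nb: "nbhd G y \<subseteq> verts G - {a, b, e} - {y}"
    proof
      fix x assume x: "x \<in> nbhd G y"
      hence "y \<in> nbhd G x" using nsym by blast
      hence "x \<noteq> a" "x \<noteq> b" "x \<noteq> e" using y be(1) c(1) eq ne by auto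
      thus "x \<in> verts G - {a, b, e} - {y}" using x irr nbhd_subset[of G y] by blast
    qed
    have "card (verts G - {a, b, e} - {y}) = 1"
      using n finV a V be(2) y by (simp add: card_Diff_subset)
    hence "card (nbhd G y) \<le> 1" using card_mono[OF _ nb] finV by simp
    thus False using card2[OF y(1)] by simp
  qed
  have db: "d \<noteq> b"
  proof
    assume "d = b"
    hence "e \<in> nbhd G b" using nsym[of e b] d(1) by simp
    thus False using c(1) ce V(4) by simp
  qed
  have cd: "c \<noteq> d"
  proof
    assume eq: "c = d"
    obtain x where x: "nbhd G c = {b, x}" "x \<noteq> b" using other[OF c(4) bc] by blast
    hence nc: "nbhd G c = {b, e}" using de eq be(2) by auto
    obtain z where z: "z \<in> verts G" "z \<notin> {a, b, e, c}" using more[of "[a, b, e, c]"] by auto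
    have nb: "nbhd G z \<subseteq> verts G - {a, b, e, c} - {z}"
    proof
      fix x assume x: "x \<in> nbhd G z"
      hence "z \<in> nbhd G x" using nsym by blast
      hence "x \<noteq> a" "x \<noteq> b" "x \<noteq> e" "x \<noteq> c" using z be(1) c(1) d(1) eq nc by auto
      thus "x \<in> verts G - {a, b, e, c} - {z}" using x irr nbhd_subset[of G z] by blast
    qed
    have "card (verts G - {a, b, e, c} - {z}) = 0"
      using n finV a V be(2) c ce z by (simp add: card_Diff_subset)
    hence "card (nbhd G z) \<le> 0" using card_mono[OF _ nb] finV by (metis finite_Diff)
    thus False using card2[OF z(1)] by simp
  qed
  have dist: "distinct [a, b, c, d, e]" using V be(2) c d ce db cd by auto
  have "card {a, b, c, d, e} = 5" using dist by simp
  hence VV: "verts G = {a, b, c, d, e}"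
    using card_subset_eq[OF finV, of "{a, b, c, d, e}"] n a V c(4) d(4) by auto
  obtain x where x: "nbhd G c = {b, x}" "x \<noteq> b" "x \<noteq> c" "x \<in> verts G" using other[OF c(4) bc] by blast
  have "c \<in> nbhd G x" using nsym[of c x] x(1) by simp
  hence "x \<noteq> a" "x \<noteq> e" using be(1) d(1) dist by auto
  hence nc: "nbhd G c = {b, d}" using x VV by auto
  hence "c \<in> nbhd G d" using nsym[of c d] by simp
  hence nd: "nbhd G d = {c, e}" using de card2[OF d(4)] ce by (auto simp: card_2_iff)
  show ?thesis by (rule that[OF dist VV be(1) c(1) nc nd d(1)])
qed

lemma pentagon_iso:
  fixes G :: "'a ugraph" and H :: "'b ugraph"
  assumes s: "simple_graph G" "simple_graph H"
    and n: "card (verts G) = 5" "card (verts H) = 5"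
    and two: "\<And>v. v \<in> verts G \<Longrightarrow> degree G v = 2" "\<And>v. v \<in> verts H \<Longrightarrow> degree H v = 2"
  shows "isomorphic G H"
proof -
  obtain a b c d e where G: "distinct [a, b, c, d, e]" "verts G = {a, b, c, d, e}"
    "nbhd G a = {b, e}" "nbhd G b = {a, c}" "nbhd G c = {b, d}" "nbhd G d = {c, e}" "nbhd G e = {a, d}"
    by (rule pentagon_structure[OF s(1) n(1) two(1)], assumption, rule that)
  obtain a' b' c' d' e' where H: "distinct [a', b', c', d', e']" "verts H = {a', b', c', d', e'}"
    "nbhd H a' = {b', e'}" "nbhd H b' = {a', c'}" "nbhd H c' = {b', d'}" "nbhd H d' = {c', e'}"
    "nbhd H e' = {a', d'}"
    by (rule pentagon_structure[OF s(2) n(2) two(2)], assumption, rule that)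
  define f where "f = (\<lambda>v. if v = a then a' else if v = b then b' else if v = c then c'
    else if v = d then d' else e')"
  have f: "f a = a'" "f b = b'" "f c = c'" "f d = d'" "f e = e'"
    using G(1) by (auto simp: f_def)
  have bij: "bij_betw f (verts G) (verts H)"
    unfolding G(2) H(2) bij_betw_def inj_on_def using f G(1) H(1) by auto
  have inj: "f x = f y \<longleftrightarrow> x = y" if "x \<in> verts G" "y \<in> verts G" for x y
    using bij that by (auto simp: bij_betw_def inj_on_def)
  have "nbhd H (f x) = f ` nbhd G x" if "x \<in> verts G" for x
    using that unfolding G(2) by (elim insertE emptyE; simp add: f G(3-7) H(3-7))
  moreover have "f y \<in> f ` nbhd G x \<longleftrightarrow> y \<in> nbhd G x" if "y \<in> verts G" for x y
    using inj[OF that] nbhd_subset[of G x] by auto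
  ultimately have "adjacent G x y \<longleftrightarrow> adjacent H (f x) (f y)" if "x \<in> verts G" "y \<in> verts G" for x y
    using that by (simp add: in_nbhd[OF s(1), symmetric] in_nbhd[OF s(2), symmetric])
  thus ?thesis using bij by (auto simp: isomorphic_def)
qed

lemma degree_seq_co:
  assumes "simple_graph G" "simple_graph H" "degree_seq H = degree_seq G"
  shows "degree_seq (co H) = degree_seq (co G)"
proof -
  have eq: "image_mset (degree H) (mset_set (verts H)) = image_mset (degree G) (mset_set (verts G))"
    using assms(3) by (simp add: degree_seq_eq_mset)
  have n: "card (verts H) = card (verts G)" using arg_cong[OF eq, of size] by simp
  have "image_mset (degree (co X)) (mset_set (verts X)) =
      image_mset (\<lambda>k. card (verts X) - 1 - k) (image_mset (degree X) (mset_set (verts X)))"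
    if "simple_graph X" for X :: "'c ugraph"
    using that unfolding image_mset.compositionality
    by (intro image_mset_cong) (auto simp: degree_co finite_verts)
  note co = this[OF assms(1)] this[OF assms(2)]
  show ?thesis unfolding degree_seq_eq_mset verts_co co eq n ..
qed

lemma unigraph_co:
  fixes G :: "'a ugraph"
  assumes "unigraph G"
  shows "unigraph (co G)"
  unfolding unigraph_def
proof (intro conjI allI impI)
  have s: "simple_graph G" using assms by (simp add: unigraph_def)
  thus "simple_graph (co G)" by (rule simple_co)
  fix H :: "'a ugraph"
  assume H: "simple_graph H \<and> degree_seq H = degree_seq (co G)"
  hence "degree_seq (co H) = degree_seq G"
    using degree_seq_co[OF simple_co[OF s], of H] by (simp add: co_co s)
  hence "isomorphic G (co H)" using assms H simple_co by (auto simp: unigraph_def)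
  hence "isomorphic (co G) (co (co H))" by (rule isomorphic_co)
  thus "isomorphic (co G) H" using H by (simp add: co_co)
qed

lemma HCU_co:
  fixes G :: "'a ugraph"
  assumes "G \<in> HCU"
  shows "co G \<in> HCU"
proof -
  obtain U :: "nat ugraph" and W where s: "simple_graph G" and U: "unigraph U" "W \<subseteq> verts U"
    and iso: "isomorphic G (induced U W)"
    using assms by (auto simp: HCU_def)
  have sU: "simple_graph U" using U(1) by (simp add: unigraph_def)
  have "isomorphic (co G) (induced (co U) W)"
    using isomorphic_co[OF iso] co_induced[OF sU U(2)] by simp
  moreover have "W \<subseteq> verts (co U)" using U(2) by simp
  ultimately show ?thesis
    unfolding HCU_def using unigraph_co[OF U(1)] simple_co[OF s] by blast
qed

lemma induced_verts: "simple_graph G \<Longrightarrow> induced G (verts G) = G"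
  by (rule simple_graph_eqI) (auto simp: simple_induced adjacent_induced dest: adjacentD)

lemma unigraph_HCU:
  fixes U :: "nat ugraph"
  assumes "unigraph U" "W \<subseteq> verts U"
  shows "induced U W \<in> HCU"
proof -
  have "simple_graph (induced U W)" using assms simple_induced by (auto simp: unigraph_def)
  thus ?thesis
    unfolding HCU_def using assms isomorphic_refl[of "induced U W"] by blast
qed

lemma unigraph_star_and_matching:
  fixes G :: "'a ugraph"
  assumes "simple_graph G" "c \<in> verts G" "\<forall>v\<in>verts G - {c}. degree G v = 1"
  shows "unigraph G"
  unfolding unigraph_def
proof (intro conjI allI impI assms(1))
  fix H :: "'a ugraph" assume "simple_graph H \<and> degree_seq H = degree_seq G"
  hence H: "simple_graph H" "degree_seq H = degree_seq G" by auto
  obtain c' where c': "c' \<in> verts H" "degree H c' = degree G c"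
    "\<And>v. v \<in> verts H - {c'} \<Longrightarrow> degree H v = 1" "card (verts H) = card (verts G)"
    by (rule degree_seq_one_exception[OF assms(1) H assms(2) assms(3)[rule_format]], assumption, rule that)
  show "isomorphic G H"
    by (rule star_and_matching_iso[OF assms(1) H(1) assms(2) c'(1,2,4) assms(3)]) (use c'(3) in blast)
qed

lemma unigraph_windmill:
  fixes G :: "'a ugraph"
  assumes "simple_graph G" "c \<in> verts G" "degree G c + 2 = card (verts G)"
    "\<forall>v\<in>verts G - {c}. degree G v = 2"
  shows "unigraph G"
  unfolding unigraph_def
proof (intro conjI allI impI assms(1))
  fix H :: "'a ugraph" assume "simple_graph H \<and> degree_seq H = degree_seq G"
  hence H: "simple_graph H" "degree_seq H = degree_seq G" by auto
  obtain c' where c': "c' \<in> verts H" "degree H c' = degree G c"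
    "\<And>v. v \<in> verts H - {c'} \<Longrightarrow> degree H v = 2" "card (verts H) = card (verts G)"
    by (rule degree_seq_one_exception[OF assms(1) H assms(2) assms(4)[rule_format]], assumption, rule that)
  have d: "degree H c' + 2 = card (verts H)" using c' assms(3) by simp
  show "isomorphic G H"
    by (rule windmill_iso[OF assms(1) H(1) assms(2) c'(1) assms(3) d c'(4)]) (use assms(4) c'(3) in blast)+
qed

lemma unigraph_pentagon:
  fixes G :: "'a ugraph"
  assumes "simple_graph G" "card (verts G) = 5" "\<forall>v\<in>verts G. degree G v = 2"
  shows "unigraph G"
  unfolding unigraph_def
proof (intro conjI allI impI assms(1))
  fix H :: "'a ugraph" assume "simple_graph H \<and> degree_seq H = degree_seq G"
  hence H: "simple_graph H" "degree_seq H = degree_seq G" by auto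
  have "verts G \<noteq> {}" using assms(2) by auto
  then obtain c where c: "c \<in> verts G" by blast
  obtain c' where c': "c' \<in> verts H" "degree H c' = degree G c"
    "\<And>v. v \<in> verts H - {c'} \<Longrightarrow> degree H v = 2" "card (verts H) = card (verts G)"
    by (rule degree_seq_one_exception[OF assms(1) H c, of 2]) (use assms(3) that in auto)
  have "degree H v = 2" if "v \<in> verts H" for v
    using c'(2) c'(3)[of v] assms(3) c that by (cases "v = c'") auto
  thus "isomorphic G H"
    using assms c'(4) by (intro pentagon_iso[OF assms(1) H(1)]) auto
qed

text \<open>Every vertex \<open>v\<close> of degree one receives a new partner \<open>v + N\<close>, adjacent to \<open>v\<close> and to \<open>c\<close>. In
  the resulting graph all vertices other than \<open>c\<close> have degree two and \<open>c\<close> still has a single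
  non-neighbour.\<close>

lemma HCU_degree_two_type:
  fixes G :: "nat ugraph"
  assumes s: "simple_graph G" and n4: "4 \<le> card (verts G)"
    and c: "c \<in> verts G" "degree G c + 2 = card (verts G)"
    and two: "\<And>v. v \<in> verts G - {c} \<Longrightarrow> degree G v = 1 \<or> degree G v = 2"
    and w: "\<And>v. v \<in> verts G \<Longrightarrow> 1 \<le> degree G v"
  shows "G \<in> HCU"
proof -
  let ?V = "verts G"
  define L where "L = {v \<in> ?V. degree G v = 1}"
  define N where "N = Suc (Max ?V)"
  have finV: "finite ?V" by (rule finite_verts[OF s])
  have lt: "v < N" if "v \<in> ?V" for v using finV that by (simp add: N_def le_imp_less_Suc)
  define L' where "L' = (\<lambda>v. v + N) ` L"
  have finL: "finite L" "L \<subseteq> ?V" using finV by (auto simp: L_def)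
  have cL: "c \<notin> L" using c(2) n4 by (auto simp: L_def)
  have disj: "?V \<inter> L' = {}" using lt by (force simp: L'_def)
  have cL': "card L' = card L" by (simp add: L'_def card_image)
  define R where "R = (\<lambda>x y. adjacent G x y \<or> (\<exists>v\<in>L. y = v + N \<and> (x = v \<or> x = c)))"
  define U where "U = graph_of (?V \<union> L') R"
  have sU: "simple_graph U" and VU: "verts U = ?V \<union> L'"
    using finV finL(1) by (simp_all add: U_def simple_graph_of L'_def)
  have inV: "adjacent U x y \<longleftrightarrow> adjacent G x y" if "x \<in> ?V" "y \<in> ?V" for x y
    using that lt[of x] lt[of y] adjacentD[OF s, of x y] adjacent_sym[of G x y]
    unfolding U_def adjacent_graph_of R_def by auto
  have toL: "adjacent U x (v + N) \<longleftrightarrow> x = v \<or> x = c" if "v \<in> L" "x \<in> ?V" for x v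
  proof -
    have "v + N \<in> L'" using that(1) by (simp add: L'_def)
    moreover have "v + N \<notin> ?V" using lt[of "v + N"] by auto
    ultimately show ?thesis
      using that lt[OF that(2)] adjacentD[OF s]
      unfolding U_def adjacent_graph_of R_def by auto
  qed
  have LL: "\<not> adjacent U (u + N) (v + N)" if "u \<in> L" "v \<in> L" for u v
  proof -
    have "u + N \<notin> ?V" "v + N \<notin> ?V" using lt[of "u + N"] lt[of "v + N"] by auto
    moreover have "u < N" "v < N" "c < N" using that finL(2) c(1) lt by auto
    ultimately show ?thesis
      using adjacentD[OF s] unfolding U_def adjacent_graph_of R_def by auto
  qed
  have nbV: "nbhd U x = nbhd G x \<union> (\<lambda>v. v + N) ` {v \<in> L. x = v \<or> x = c}" if x: "x \<in> ?V" for x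
  proof (intro equalityI subsetI)
    fix y assume "y \<in> nbhd U x"
    hence y: "y \<in> ?V \<union> L'" "adjacent U x y" by (auto simp: nbhd_def VU)
    thus "y \<in> nbhd G x \<union> (\<lambda>v. v + N) ` {v \<in> L. x = v \<or> x = c}"
      using inV[OF x] toL[OF _ x] by (auto simp: L'_def nbhd_def)
  next
    fix y assume "y \<in> nbhd G x \<union> (\<lambda>v. v + N) ` {v \<in> L. x = v \<or> x = c}"
    thus "y \<in> nbhd U x" using inV[OF x] toL[OF _ x] by (auto simp: L'_def nbhd_def VU)
  qed
  have degV: "degree U x = degree G x + card {v \<in> L. x = v \<or> x = c}" if x: "x \<in> ?V" for x
  proof -
    have "nbhd G x \<inter> (\<lambda>v. v + N) ` {v \<in> L. x = v \<or> x = c} = {}"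
      using disj nbhd_subset[of G x] by (auto simp: L'_def)
    moreover have "card ((\<lambda>v. v + N) ` {v \<in> L. x = v \<or> x = c}) = card {v \<in> L. x = v \<or> x = c}"
      by (simp add: card_image)
    ultimately show ?thesis
      using finL(1) finite_nbhd[OF s, of x] by (simp add: degree_nbhd nbV[OF x] card_Un_disjoint)
  qed
  have "degree U c + 2 = card (verts U)"
    using degV[OF c(1)] c(2) finV finL(1) disj cL' by (simp add: VU card_Un_disjoint L'_def)
  moreover have "degree U x = 2" if x: "x \<in> verts U - {c}" for x
  proof (cases "x \<in> ?V")
    case True
    have "{v \<in> L. x = v \<or> x = c} = (if x \<in> L then {x} else {})" using x by auto
    thus ?thesis using degV[OF True] two[of x] x True by (auto simp: L_def)
  next
    case False
    then obtain v where v: "v \<in> L" "x = v + N" using x by (auto simp: VU L'_def)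
    have "nbhd U x = {v, c}"
    proof (intro equalityI subsetI)
      fix y assume "y \<in> nbhd U x"
      hence y: "y \<in> ?V \<union> L'" "adjacent U y x" by (auto simp: nbhd_def VU adjacent_sym)
      show "y \<in> {v, c}"
      proof (cases "y \<in> ?V")
        case True thus ?thesis using toL[OF v(1) True] y(2) v(2) by auto
      next
        case False thus ?thesis using y LL v by (auto simp: L'_def)
      qed
    next
      fix y assume "y \<in> {v, c}"
      hence "y \<in> ?V" "adjacent U y x" using toL[OF v(1), of y] v finL(2) c(1) by auto
      thus "y \<in> nbhd U x" by (auto simp: nbhd_def VU adjacent_sym)
    qed
    moreover have "v \<noteq> c" using v(1) cL by blast
    ultimately show ?thesis by (simp add: degree_nbhd)
  qed
  ultimately have "unigraph U" using c(1) VU by (intro unigraph_windmill[OF sU, of c]) auto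
  moreover have "induced U ?V = G"
  proof (rule simple_graph_eqI)
    show "adjacent (induced U ?V) x y \<longleftrightarrow> adjacent G x y" for x y
      using inV[of x y] adjacentD[OF s, of x y] unfolding adjacent_induced by blast
  qed (use s sU VU in \<open>auto simp: simple_induced\<close>)
  ultimately show ?thesis using unigraph_HCU[of U ?V] VU by auto
qed

theorem hcu_degrees_HCU:
  fixes G :: "nat ugraph"
  assumes s: "simple_graph G" and n4: "4 \<le> card (verts G)"
    and bnd: "\<And>v. v \<in> verts G \<Longrightarrow> 1 \<le> degree G v \<and> degree G v + 2 \<le> card (verts G)"
    and G: "hcu_degrees G"
  shows "G \<in> HCU"
proof -
  have self: "H \<in> HCU" if "unigraph H" for H :: "nat ugraph"
    using unigraph_HCU[OF that, of "verts H"] that induced_verts[of H] by (auto simp: unigraph_def)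
  have by_co: "G \<in> HCU" if "co G \<in> HCU"
    using HCU_co[OF that] by (simp add: co_co s)
  note dco = degree_co[OF s]
  from G show ?thesis
  proof (cases rule: hcu_degreesE)
    case (one c)
    thus ?thesis by (intro self unigraph_star_and_matching[OF s])
  next
    case (co_one c)
    have "\<forall>v\<in>verts (co G) - {c}. degree (co G) v = 1"
    proof
      fix v assume v: "v \<in> verts (co G) - {c}"
      hence "degree G v + 2 = card (verts G)" using co_one(2) by simp
      thus "degree (co G) v = 1" using dco[of v] v by simp
    qed
    thus ?thesis using co_one(1) by (intro by_co self unigraph_star_and_matching[OF simple_co[OF s]]) auto
  next
    case (two c)
    have "degree G v = 1 \<or> degree G v = 2" if "v \<in> verts G - {c}" for v
    proof -
      have "degree G v \<le> 2" "1 \<le> degree G v" using two(3) bnd that by auto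
      thus ?thesis by linarith
    qed
    thus ?thesis using bnd by (intro HCU_degree_two_type[OF s n4 two(1,2)]) auto
  next
    case (co_two c)
    show ?thesis
    proof (intro by_co HCU_degree_two_type[OF simple_co[OF s]])
      show "degree (co G) c + 2 = card (verts (co G))" using dco[OF co_two(1)] co_two(2) n4 by simp
      show "1 \<le> degree (co G) v" if "v \<in> verts (co G)" for v using bnd[of v] dco[of v] that by auto
      show "degree (co G) v = 1 \<or> degree (co G) v = 2" if v: "v \<in> verts (co G) - {c}" for v
      proof -
        have "card (verts G) \<le> degree G v + 3" "degree G v + 2 \<le> card (verts G)" "v \<in> verts G"
          using co_two(3) bnd[of v] v by auto
        thus ?thesis using dco[of v] by linarith
      qed
    qed (use n4 co_two in auto)
  next
    case pentagon
    thus ?thesis by (intro self unigraph_pentagon[OF s])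
  qed
qed

section \<open>Reading the degree conditions off the sequence\<close>

lemma sorted_list_of_multiset_eqI:
  assumes "sorted xs" "mset xs = M"
  shows "sorted_list_of_multiset M = xs"
  using assms properties_for_sort[of xs xs] sorted_list_of_multiset_mset[of xs] by simp

lemma realizes_mset:
  assumes "realizes G \<pi>"
  shows "mset \<pi> = image_mset (degree G) (mset_set (verts G))"
    "set \<pi> = degree G ` verts G" "length \<pi> = card (verts G)"
proof -
  have s: "simple_graph G" and seq: "degree_seq G = \<pi>" using assms by (auto simp: realizes_def)
  show m: "mset \<pi> = image_mset (degree G) (mset_set (verts G))"
    unfolding seq[symmetric] degree_seq_def by simp
  show "set \<pi> = degree G ` verts G"
    using arg_cong[OF m, of set_mset] finite_verts[OF s] by simp
  show "length \<pi> = card (verts G)"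
    using arg_cong[OF m, of size] by simp
qed

text \<open>The second entry of the sequence belongs to the vertices other than \<open>c\<close>, where \<open>c\<close> is any vertex
  of maximum degree. It is described by what it bounds and where it is attained, so that the
  choice of a second vertex does not matter.\<close>

lemma realizes_first_two:
  assumes "realizes G \<pi>" "c \<in> verts G" "\<And>v. v \<in> verts G \<Longrightarrow> degree G v \<le> degree G c"
    "2 \<le> card (verts G)"
  shows "\<pi> ! 0 = degree G c" "\<pi> ! 1 \<in> degree G ` (verts G - {c})"
    "\<forall>v\<in>verts G - {c}. degree G v \<le> \<pi> ! 1"
proof -
  have s: "simple_graph G" and seq: "degree_seq G = \<pi>" using assms by (auto simp: realizes_def)
  have finV: "finite (verts G)" by (rule finite_verts[OF s])
  let ?M = "image_mset (degree G) (mset_set (verts G - {c}))"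
  define l where "l = sorted_list_of_multiset ?M"
  have set_l: "set l = degree G ` (verts G - {c})" using finV by (simp add: l_def)
  have sorted_l: "sorted l" by (simp add: l_def)
  have "mset_set (verts G) = add_mset c (mset_set (verts G - {c}))"
    using assms(2) finV by (simp add: mset_set.remove)
  hence "sorted_list_of_multiset (image_mset (degree G) (mset_set (verts G))) = l @ [degree G c]"
    using sorted_l set_l assms(3) by (intro sorted_list_of_multiset_eqI) (auto simp: sorted_append l_def)
  hence pi: "\<pi> = degree G c # rev l" by (simp add: seq[symmetric] degree_seq_def)
  have "verts G - {c} \<noteq> {}"
    using assms(4) card_mono[of "{c}" "verts G"] by auto
  hence ne: "l \<noteq> []" using set_l by auto
  show "\<pi> ! 0 = degree G c" by (simp add: pi)
  have last: "\<pi> ! 1 = last l" using ne by (simp add: pi hd_rev[symmetric] hd_conv_nth)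
  show "\<pi> ! 1 \<in> degree G ` (verts G - {c})" using last ne set_l last_in_set by metis
  have "x \<le> last l" if "x \<in> set l" for x
  proof -
    have l: "butlast l @ [last l] = l" using ne by simp
    hence "sorted (butlast l @ [last l])" "x \<in> set (butlast l @ [last l])"
      using sorted_l that by simp_all
    thus ?thesis by (auto simp only: sorted_append set_append list.set)
  qed
  thus "\<forall>v\<in>verts G - {c}. degree G v \<le> \<pi> ! 1" using set_l last by auto
qed

lemma realizes_last_two:
  assumes "realizes G \<pi>" "c \<in> verts G" "\<And>v. v \<in> verts G \<Longrightarrow> degree G c \<le> degree G v"
    "2 \<le> card (verts G)" "n = card (verts G)"
  shows "\<pi> ! (n - 1) = degree G c" "\<pi> ! (n - 2) \<in> degree G ` (verts G - {c})"
    "\<forall>v\<in>verts G - {c}. \<pi> ! (n - 2) \<le> degree G v"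
proof -
  have s: "simple_graph G" and seq: "degree_seq G = \<pi>" using assms by (auto simp: realizes_def)
  have finV: "finite (verts G)" by (rule finite_verts[OF s])
  let ?M = "image_mset (degree G) (mset_set (verts G - {c}))"
  define l where "l = sorted_list_of_multiset ?M"
  have set_l: "set l = degree G ` (verts G - {c})" using finV by (simp add: l_def)
  have sorted_l: "sorted l" by (simp add: l_def)
  have "mset_set (verts G) = add_mset c (mset_set (verts G - {c}))"
    using assms(2) finV by (simp add: mset_set.remove)
  hence "sorted_list_of_multiset (image_mset (degree G) (mset_set (verts G))) = degree G c # l"
    using sorted_l set_l assms(3) by (intro sorted_list_of_multiset_eqI) (auto simp: l_def)
  hence pi: "\<pi> = rev l @ [degree G c]" by (simp add: seq[symmetric] degree_seq_def)
  have len: "length l = n - 1" using realizes_mset(3)[OF assms(1)] assms(5) by (simp add: pi)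
  hence ne: "l \<noteq> []" using assms(4,5) by auto
  show "\<pi> ! (n - 1) = degree G c" using len by (simp add: pi nth_append)
  have hd: "\<pi> ! (n - 2) = hd l"
  proof -
    have "n - 2 < length (rev l)" "n - 2 = length (rev l) - 1" using len assms(4,5) by auto
    hence "\<pi> ! (n - 2) = rev l ! (length (rev l) - 1)" by (simp only: pi nth_append if_True)
    also have "\<dots> = last (rev l)" using ne by (metis last_conv_nth rev_is_Nil_conv)
    finally show ?thesis using ne by (simp add: last_rev)
  qed
  show "\<pi> ! (n - 2) \<in> degree G ` (verts G - {c})" using hd ne set_l hd_in_set by metis
  have "hd l \<le> x" if "x \<in> set l" for x
    using that sorted_l by (cases l) auto
  thus "\<forall>v\<in>verts G - {c}. \<pi> ! (n - 2) \<le> degree G v" using set_l hd by auto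
qed

text \<open>In each of the conditions the exceptional vertex has the largest or the smallest degree, so it
  can be taken to be the first or the last entry.\<close>

lemma hcu_degrees_iff_sequence:
  assumes G: "realizes G \<pi>" and n: "n = length \<pi>" "4 \<le> n"
  shows "(\<forall>v\<in>verts G. 1 \<le> degree G v \<and> degree G v + 2 \<le> card (verts G)) \<and> hcu_degrees G \<longleftrightarrow>
    \<pi> ! (n - 1) \<ge> 1 \<and> \<pi> ! 0 \<le> n - 2 \<and>
      (\<pi> ! 1 = 1 \<or> \<pi> ! (n - 2) = n - 2 \<or> (\<pi> ! 0 = n - 2 \<and> \<pi> ! 1 = 2) \<or>
       (\<pi> ! (n - 1) = 1 \<and> \<pi> ! (n - 2) = n - 3) \<or> \<pi> = [2, 2, 2, 2, 2])"
    (is "?bnd \<and> _ \<longleftrightarrow> ?lo \<and> ?hi \<and> ?cond")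
proof -
  have s: "simple_graph G" using G by (simp add: realizes_def)
  have finV: "finite (verts G)" by (rule finite_verts[OF s])
  have nV: "n = card (verts G)" and set_pi: "set \<pi> = degree G ` verts G"
    using realizes_mset[OF G] n(1) by auto
  have two: "2 \<le> card (verts G)" using n(2) nV by simp
  hence ne: "degree G ` verts G \<noteq> {}" by auto
  obtain a where a: "a \<in> verts G" "\<And>v. v \<in> verts G \<Longrightarrow> degree G v \<le> degree G a"
  proof -
    obtain a where "a \<in> verts G" "degree G a = Max (degree G ` verts G)"
      using Max_in[OF finite_imageI[OF finV] ne] by (metis imageE)
    thus ?thesis using that[of a] Max_ge[OF finite_imageI[OF finV, of "degree G"]] by (metis imageI)
  qed
  obtain z where z: "z \<in> verts G" "\<And>v. v \<in> verts G \<Longrightarrow> degree G z \<le> degree G v"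
  proof -
    obtain z where "z \<in> verts G" "degree G z = Min (degree G ` verts G)"
      using Min_in[OF finite_imageI[OF finV] ne] by (metis imageE)
    thus ?thesis using that[of z] Min_le[OF finite_imageI[OF finV, of "degree G"]] by (metis imageI)
  qed
  note first = realizes_first_two[OF G _ _ two] and last = realizes_last_two[OF G _ _ two nV]
  note fa = first[OF a] and lz = last[OF z]
  have bnd_iff: "?bnd \<longleftrightarrow> ?lo \<and> ?hi"
  proof
    assume ?bnd
    thus "?lo \<and> ?hi" using lz(1) fa(1) a(1) z(1) nV by auto
  next
    assume lh: "?lo \<and> ?hi"
    show ?bnd
    proof
      fix v assume v: "v \<in> verts G"
      show "1 \<le> degree G v \<and> degree G v + 2 \<le> card (verts G)"
        using lh lz(1) fa(1) a(2)[OF v] z(2)[OF v] nV n(2) by linarith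
    qed
  qed
  have pent: "\<pi> = [2, 2, 2, 2, 2] \<longleftrightarrow> card (verts G) = 5 \<and> (\<forall>v\<in>verts G. degree G v = 2)"
  proof
    assume pi: "\<pi> = [2, 2, 2, 2, 2]"
    hence "degree G ` verts G = {2}" using set_pi by auto
    thus "card (verts G) = 5 \<and> (\<forall>v\<in>verts G. degree G v = 2)" using nV n(1) pi by auto
  next
    assume "card (verts G) = 5 \<and> (\<forall>v\<in>verts G. degree G v = 2)"
    hence "length \<pi> = 5" "\<And>x. x \<in> set \<pi> \<Longrightarrow> x = 2" using nV n(1) set_pi by auto
    hence "\<pi> = replicate 5 2" by (intro replicate_eqI) auto
    thus "\<pi> = [2, 2, 2, 2, 2]" by (simp add: numeral_eq_Suc)
  qed
  have "hcu_degrees G \<longleftrightarrow> ?cond" if bnd: ?bnd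
  proof
    assume "hcu_degrees G"
    thus ?cond
    proof (cases rule: hcu_degreesE)
      case (one c)
      have "degree G v \<le> degree G c" if "v \<in> verts G" for v
        using one bnd that by (cases "v = c") auto
      from first(2)[OF one(1) this] one(2) show ?cond by auto
    next
      case (co_one c)
      have "degree G c \<le> degree G v" if v: "v \<in> verts G" for v
      proof (cases "v = c")
        case False
        hence "degree G v + 2 = card (verts G)" using co_one(2) v by blast
        thus ?thesis using bnd co_one(1) by force
      qed simp
      from last(2)[OF co_one(1) this] obtain v where v: "v \<in> verts G - {c}" "\<pi> ! (n - 2) = degree G v" by blast
      have "degree G v + 2 = card (verts G)" using co_one(2) v(1) by blast
      hence "\<pi> ! (n - 2) = n - 2" using v(2) nV by linarith
      thus ?cond by blast
    next
      case (two c)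
      have max: "degree G v \<le> degree G c" if v: "v \<in> verts G" for v
      proof (cases "v = c")
        case False
        hence "degree G v \<le> 2" using two(3) v by blast
        thus ?thesis using two(2) nV n(2) by linarith
      qed simp
      note f = first[OF two(1) max]
      obtain v where "v \<in> verts G - {c}" "\<pi> ! 1 = degree G v" using f(2) by blast
      hence "\<pi> ! 1 \<le> 2" using two(3) by simp
      moreover have "2 \<le> \<pi> ! 1" using two(4) f(3) by metis
      ultimately have "\<pi> ! 1 = 2" by linarith
      moreover have "\<pi> ! 0 = n - 2" using f(1) two(2) nV by simp
      ultimately show ?cond by blast
    next
      case (co_two c)
      have min: "degree G c \<le> degree G v" if "v \<in> verts G" for v using co_two(2) bnd that by auto
      note f = last[OF co_two(1) min]
      obtain v where "v \<in> verts G - {c}" "\<pi> ! (n - 2) = degree G v" using f(2) by blast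
      hence "n \<le> \<pi> ! (n - 2) + 3" using co_two(3) nV by simp
      moreover have "\<pi> ! (n - 2) + 3 \<le> n"
      proof -
        obtain v where "v \<in> verts G - {c}" "degree G v + 3 = card (verts G)" using co_two(4) by blast
        moreover from this have "\<pi> ! (n - 2) \<le> degree G v" using f(3) by blast
        ultimately show ?thesis using nV by simp
      qed
      ultimately have "\<pi> ! (n - 2) = n - 3" by linarith
      moreover have "\<pi> ! (n - 1) = 1" using f(1) co_two(2) by simp
      ultimately show ?cond by blast
    next
      case pentagon
      thus ?cond using pent by blast
    qed
  next
    assume ?cond
    thus "hcu_degrees G"
    proof (elim disjE conjE)
      assume p: "\<pi> ! 1 = 1"
      have "degree G v = 1" if v: "v \<in> verts G - {a}" for v
      proof -
        have "degree G v \<le> 1" "1 \<le> degree G v" using fa(3) bnd v p by auto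
        thus ?thesis by simp
      qed
      thus ?thesis using a(1) by (intro hcu_degreesI(1)[of a]) blast+
    next
      assume p: "\<pi> ! (n - 2) = n - 2"
      have "degree G v + 2 = card (verts G)" if v: "v \<in> verts G - {z}" for v
      proof -
        have "n - 2 \<le> degree G v" "degree G v + 2 \<le> card (verts G)" using lz(3) bnd v p by auto
        thus ?thesis using nV by linarith
      qed
      thus ?thesis using z(1) by (intro hcu_degreesI(2)[of z]) blast+
    next
      assume p: "\<pi> ! 0 = n - 2" "\<pi> ! 1 = 2"
      show ?thesis
      proof (rule hcu_degreesI(3)[OF a(1)])
        show "degree G a + 2 = card (verts G)" using fa(1) p(1) nV n(2) by simp
        show "\<forall>v\<in>verts G - {a}. degree G v \<le> 2" using fa(3) p(2) by simp
        show "\<exists>v\<in>verts G - {a}. degree G v = 2" using fa(2) p(2) by (metis imageE)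
      qed
    next
      assume p: "\<pi> ! (n - 1) = 1" "\<pi> ! (n - 2) = n - 3"
      show ?thesis
      proof (rule hcu_degreesI(4)[OF z(1)])
        show "degree G z = 1" using lz(1) p(1) by simp
        show "\<forall>v\<in>verts G - {z}. card (verts G) \<le> degree G v + 3"
        proof
          fix v assume "v \<in> verts G - {z}"
          hence "n - 3 \<le> degree G v" using lz(3) p(2) by simp
          thus "card (verts G) \<le> degree G v + 3" using nV by linarith
        qed
        obtain v where "v \<in> verts G - {z}" "n - 3 = degree G v" using lz(2) p(2) by (metis imageE)
        thus "\<exists>v\<in>verts G - {z}. degree G v + 3 = card (verts G)" using nV n(2) by (intro bexI[of _ v]) auto
      qed
    next
      assume "\<pi> = [2, 2, 2, 2, 2]"
      thus ?thesis using pent by (intro hcu_degreesI(5)) auto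
    qed
  qed
  thus ?thesis using bnd_iff by blast
qed

theorem theorem4p6:
  fixes \<pi> :: "nat list" and n :: nat
  assumes "n = length \<pi>" and "graphic \<pi>" and "nonsplit_seq \<pi>"
  shows "(\<forall>G :: nat ugraph. realizes G \<pi> \<longrightarrow> indecomposable G \<and> G \<in> HCU) \<longleftrightarrow>
    \<pi> ! (n - 1) \<ge> 1 \<and> \<pi> ! 0 \<le> n - 2 \<and>
      (\<pi> ! 1 = 1 \<or>
       \<pi> ! (n - 2) = n - 2 \<or>
       (\<pi> ! 0 = n - 2 \<and> \<pi> ! 1 = 2) \<or>
       (\<pi> ! (n - 1) = 1 \<and> \<pi> ! (n - 2) = n - 3) \<or>
       \<pi> = [2, 2, 2, 2, 2])"
proof -
  have nonsplit: "\<not> split_graph G" if "realizes G \<pi>" for G :: "nat ugraph"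
    using assms(3) that by (simp add: nonsplit_seq_def)
  have n4: "4 \<le> card (verts G)" "4 \<le> n" if "realizes G \<pi>" for G :: "nat ugraph"
  proof -
    show "4 \<le> card (verts G)"
      using nonsplit_card[OF _ nonsplit[OF that]] that by (simp add: realizes_def)
    thus "4 \<le> n" using realizes_mset(3)[OF that] assms(1) by simp
  qed
  obtain G0 :: "nat ugraph" where G0: "realizes G0 \<pi>" using assms(2) by (auto simp: graphic_def)
  have per_graph: "indecomposable G \<and> G \<in> HCU \<longleftrightarrow>
      (\<forall>v\<in>verts G. 1 \<le> degree G v \<and> degree G v + 2 \<le> card (verts G)) \<and> hcu_degrees G"
    if G: "realizes G \<pi>" for G :: "nat ugraph"
  proof -
    have s: "simple_graph G" using G by (simp add: realizes_def)
    note n4G = n4(1)[OF G] and ns = nonsplit[OF G]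
    show ?thesis
    proof (intro iffI conjI ballI; elim conjE)
      show "1 \<le> degree G v" "degree G v + 2 \<le> card (verts G)"
        if "indecomposable G" "v \<in> verts G" for v
        using indecomposable_degree_bounds[OF s that(1) _ that(2)] n4G by auto
      show "hcu_degrees G" if "indecomposable G" "G \<in> HCU"
        by (rule HCU_imp_hcu_degrees[OF that(2) ns that(1)])
      assume b: "\<forall>v\<in>verts G. 1 \<le> degree G v \<and> degree G v + 2 \<le> card (verts G)"
        and h: "hcu_degrees G"
      show "indecomposable G" by (rule hcu_degrees_indecomposable[OF s ns _ h]) (use b in blast)
      show "G \<in> HCU" by (rule hcu_degrees_HCU[OF s n4G _ h]) (use b in blast)
    qed
  qed
  let ?R = "\<pi> ! (n - 1) \<ge> 1 \<and> \<pi> ! 0 \<le> n - 2 \<and>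
      (\<pi> ! 1 = 1 \<or> \<pi> ! (n - 2) = n - 2 \<or> (\<pi> ! 0 = n - 2 \<and> \<pi> ! 1 = 2) \<or>
       (\<pi> ! (n - 1) = 1 \<and> \<pi> ! (n - 2) = n - 3) \<or> \<pi> = [2, 2, 2, 2, 2])"
  have iff: "indecomposable G \<and> G \<in> HCU \<longleftrightarrow> ?R" if G: "realizes G \<pi>" for G :: "nat ugraph"
    by (rule trans[OF per_graph[OF G] hcu_degrees_iff_sequence[OF G assms(1) n4(2)[OF G]]])
  show ?thesis
  proof
    assume "\<forall>G :: nat ugraph. realizes G \<pi> \<longrightarrow> indecomposable G \<and> G \<in> HCU"
    hence "indecomposable G0 \<and> G0 \<in> HCU" using G0 by blast
    thus ?R by (rule iff[OF G0, THEN iffD1])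
  next
    assume R: ?R
    show "\<forall>G :: nat ugraph. realizes G \<pi> \<longrightarrow> indecomposable G \<and> G \<in> HCU"
      by (intro allI impI) (rule iff[THEN iffD2, OF _ R])
  qed
qed

end
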